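(* Let $\mathbb{W},\mathbb{U}$ be Banach spaces, $T>0$, $\alpha>0$, $\beta\ge 0$, $0<\nu<1$, and let $\mathrm{A}:D(\mathrm{A})\subseteq\mathbb{W}\to\mathbb{W}$ be a closed, densely defined linear operator which is sectorial of angle $\frac{\nu\pi}{2}$ and such that $(\lambda_0\mathrm{I}-\mathrm{A})^{-1}$ is compact for some $\lambda_0\in\rho(\mathrm{A})$. Let $(\mathscr{G}(t))_{t\ge0}$ be the $(\alpha,\beta,\nu)$-resolvent family generated by $\mathrm{A}$, let $N$ be a constant with $\sup_{t\in[0,T]}\|\mathscr{G}(t)\|_{\mathcal{L}(\mathbb{W})}\le N$, let $\mathrm{B}:\mathbb{U}\to\mathbb{W}$ be a bounded linear operator with $\|\mathrm{B}\|_{\mathcal{L}(\mathbb{U};\mathbb{W})}=M$, and let $\zeta\in\mathbb{W}$. Let $f:[0,T]\times\mathbb{W}\to\mathbb{W}$ satisfy: (i) for a.e. $t\in[0,T]$ the map $f(t,\cdot):\mathbb{W}\to\mathbb{W}$ is continuous, and for each $w\in\mathbb{W}$ the map $t\mapsto f(t,w)$ is strongly measurable on $[0,T]$; (ii) for each $r>0$ there exists a positive function $\gamma_r\in\mathrm{L}^1([0,T];\mathbb{R}^+)$ such that $\|f(t,w)\|_{\mathbb{W}}\le\gamma_r(t)$ for a.e. $t\in[0,T]$ and all $w\in\mathbb{W}$ with $\|w\|_{\mathbb{W}}\le r$. Let $u\in\mathrm{L}^2([0,T];\mathbb{U})$ and suppose there exists $\tilde r>0$ such that $$N\|\zeta\|_{\mathbb{W}}+NMT^{1/2}\|u\|_{\mathrm{L}^2([0,T];\mathbb{U})}+N\|\gamma_{\tilde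 r}\|_{\mathrm{L}^1([0,T];\mathbb{R}^+)}\le\tilde r.$$ Then the system $$w'(t)=\mathrm{A}w(t)+\int_0^t\kappa(t-s)\mathrm{A}w(s)\,\mathrm{d}s+\mathrm{B}u(t)+f(t,w(t)),\quad t\in(0,T],\qquad w(0)=\zeta,$$ where $\kappa(t)=\alpha e^{-\beta t}\frac{t^{\nu-1}}{\Gamma(\nu)}$, has at least one mild solution, i.e. there exists $w\in C([0,T];\mathbb{W})$ such that $$w(t)=\mathscr{G}(t)\zeta+\int_0^t\mathscr{G}(t-s)\left[\mathrm{B}u(s)+f(s,w(s))\right]\mathrm{d}s,\quad t\in[0,T].$$
   Context: Sectorial operator: $\mathrm{A}$ is sectorial of angle $\theta\in(0,\frac{\pi}{2}]$ if $\Sigma_\theta:=\{\lambda\in\mathbb{C}\setminus\{0\}:|\arg(\lambda)|<\theta+\frac{\pi}{2}\}\subset\rho(\mathrm{A})$ and for each $\omega\in(0,\theta)$ there exists $K_\omega\ge1$ such that $\|(\lambda\mathrm{I}-\mathrm{A})^{-1}\|\le K_\omega/|\lambda|$ for all $0\ne\lambda\in\overline{\Sigma}_{\theta-\omega}$. (If the scalar field is real, resolvent set and resolvents are understood in the complexification.) $(\alpha,\beta,\nu)$-resolvent family: with $\kappa(t)=\alpha e^{-\beta t}\frac{t^{\nu-1}}{\Gamma(\nu)}$, $t>0$, it is the family $(\mathscr{G}(t))_{t\ge0}=(\mathscr{G}_{\alpha,\beta}^{\nu}(t))_{t\ge 0}$ of bounded linear operators on $\mathbb{W}$ such that (a) $\mathscr{G}(\cdot)$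 is strongly continuous on $[0,\infty)$ and $\mathscr{G}(0)=\mathrm{I}$; (b) $\mathscr{G}(t)z\in D(\mathrm{A})$ and $\mathscr{G}(t)\mathrm{A}z=\mathrm{A}\mathscr{G}(t)z$ for all $z\in D(\mathrm{A})$, $t\ge0$; (c) $\mathscr{G}(t)z=z+\int_0^t(1+1*\kappa)(t-s)\mathrm{A}\mathscr{G}(s)z\,\mathrm{d}s$ for all $z\in D(\mathrm{A})$, $t\ge0$, where $(1*\kappa)(t)=\int_0^t\kappa(s)\,\mathrm{d}s$. If $\mathrm{A}$ is sectorial of angle $\frac{\nu\pi}{2}$, such a family exists and is unique. *)

theory Defs
  imports "HOL-Analysis.Analysis"
begin

section \<open>Banach spaces over the real or the complex field\<close>

text \<open>
  The library has no class of complex Banach spaces. A normed space over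
  the field \<open>K\<close> (\<open>K = \<real>\<close> or \<open>K = UNIV\<close> as sets of complex numbers) is a
  type of class \<open>real_normed_vector\<close> together with a scalar multiplication \<open>s c x\<close> that extends
  \<open>scaleR\<close> and whose values matter only for \<open>c \<in> K\<close>. Hence for \<open>K = \<real>\<close> the map \<open>s\<close> carries no
  information beyond the real normed space itself.
\<close>

definition scalar_field :: "complex set \<Rightarrow> bool" where
  "scalar_field K \<longleftrightarrow> K = \<real> \<or> K = UNIV"

definition normed_space_over :: "complex set \<Rightarrow> (complex \<Rightarrow> 'a \<Rightarrow> 'a::real_normed_vector) \<Rightarrow> bool" where
  "normed_space_over K s \<longleftrightarrow>
     (\<forall>c\<in>K. \<forall>x y. s c (x + y) = s c x + s c y) \<and>
     (\<forall>c\<in>K. \<forall>d\<in>K. \<forall>x. s (c + d) x = s c x + s d x) \<and>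
     (\<forall>c\<in>K. \<forall>d\<in>K. \<forall>x. s c (s d x) = s (c * d) x) \<and>
     (\<forall>r x. s (complex_of_real r) x = r *\<^sub>R x) \<and>
     (\<forall>c\<in>K. \<forall>x. norm (s c x) = cmod c * norm x)"

definition homogeneous_over ::
    "complex set \<Rightarrow> (complex \<Rightarrow> 'a \<Rightarrow> 'a) \<Rightarrow> (complex \<Rightarrow> 'b \<Rightarrow> 'b) \<Rightarrow> ('a \<Rightarrow> 'b) \<Rightarrow> bool" where
  "homogeneous_over K s s' F \<longleftrightarrow> (\<forall>c\<in>K. \<forall>x. F (s c x) = s' c (F x))"


section \<open>Complexification of a real normed space\<close>

datatype 'a complexification = Cplx (re_part: 'a) (im_part: 'a)

instantiation complexification :: (real_vector) real_vector
begin

definition "0 = Cplx 0 0"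
definition "z + w = Cplx (re_part z + re_part w) (im_part z + im_part w)"
definition "- z = Cplx (- re_part z) (- im_part z)"
definition "z - w = Cplx (re_part z - re_part w) (im_part z - im_part w)"
definition "r *\<^sub>R z = Cplx (r *\<^sub>R re_part z) (r *\<^sub>R im_part z)"

instance
  by standard
    (simp_all add: zero_complexification_def plus_complexification_def uminus_complexification_def
      minus_complexification_def scaleR_complexification_def algebra_simps complexification.expand)

end

lemma complexification_parts [simp]:
  fixes z w :: "'a::real_vector complexification"
  shows "re_part (0 :: 'a complexification) = 0" "im_part (0 :: 'a complexification) = 0"
    "re_part (z + w) = re_part z + re_part w" "im_part (z + w) = im_part z + im_part w"
    "re_part (- z) = - re_part z" "im_part (- z) = - im_part z"
    "re_part (z - w) = re_part z - re_part w" "im_part (z - w) = im_part z - im_part w"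
    "re_part (r *\<^sub>R z) = r *\<^sub>R re_part z" "im_part (r *\<^sub>R z) = r *\<^sub>R im_part z"
  by (simp_all add: zero_complexification_def plus_complexification_def uminus_complexification_def
      minus_complexification_def scaleR_complexification_def)

definition scaleCplx :: "complex \<Rightarrow> 'a::real_vector complexification \<Rightarrow> 'a complexification" where
  "scaleCplx c z = Cplx (Re c *\<^sub>R re_part z - Im c *\<^sub>R im_part z) (Re c *\<^sub>R im_part z + Im c *\<^sub>R re_part z)"

text \<open>The norm is the Taylor norm, the smallest complex-homogeneous norm that restricts to the
  given norm on real vectors and is invariant under conjugation.\<close>

instantiation complexification :: (real_normed_vector) real_normed_vector
begin

definition norm_complexification_def:
  "norm (z :: 'a complexification) = (SUP \<theta>. norm (cos \<theta> *\<^sub>R re_part z + sin \<theta> *\<^sub>R im_part z))"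
definition dist_complexification_def:
  "dist z w = norm (z - w :: 'a complexification)"
definition sgn_complexification_def:
  "sgn (z :: 'a complexification) = z /\<^sub>R norm z"
definition uniformity_complexification_def [code del]:
  "(uniformity :: ('a complexification \<times> 'a complexification) filter) =
     (INF e\<in>{0 <..}. principal {(x, y). dist x y < e})"
definition open_complexification_def [code del]:
  "open (U :: 'a complexification set) \<longleftrightarrow> (\<forall>x\<in>U. \<forall>\<^sub>F (x', y) in uniformity. x' = x \<longrightarrow> y \<in> U)"

lemma Taylor_term_le:
  "norm (cos \<theta> *\<^sub>R x + sin \<theta> *\<^sub>R y) \<le> norm x + norm (y :: 'a)"
proof -
  have "norm (cos \<theta> *\<^sub>R x + sin \<theta> *\<^sub>R y) \<le> \<bar>cos \<theta>\<bar> * norm x + \<bar>sin \<theta>\<bar> * norm y"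
    by (metis norm_triangle_ineq norm_scaleR)
  also have "\<dots> \<le> 1 * norm x + 1 * norm y"
    by (intro add_mono mult_right_mono) auto
  finally show ?thesis by simp
qed

lemma Taylor_bdd: "bdd_above (range (\<lambda>\<theta>. norm (cos \<theta> *\<^sub>R x + sin \<theta> *\<^sub>R (y :: 'a))))"
  using Taylor_term_le by (intro bdd_aboveI[where M = "norm x + norm y"]) auto

lemma Taylor_upper: "norm (cos \<theta> *\<^sub>R re_part z + sin \<theta> *\<^sub>R im_part z) \<le> norm (z :: 'a complexification)"
  unfolding norm_complexification_def by (rule cSUP_upper[OF _ Taylor_bdd]) simp

lemma Taylor_least:
  assumes "\<And>\<theta>. norm (cos \<theta> *\<^sub>R re_part z + sin \<theta> *\<^sub>R im_part z) \<le> C"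
  shows "norm (z :: 'a complexification) \<le> C"
  unfolding norm_complexification_def by (rule cSUP_least) (use assms in auto)

lemma norm_re_part_le: "norm (re_part z) \<le> norm (z :: 'a complexification)"
  using Taylor_upper[of 0 z] by simp

lemma norm_im_part_le: "norm (im_part z) \<le> norm (z :: 'a complexification)"
  using Taylor_upper[of "pi/2" z] by simp

lemma norm_complexification_le: "norm (z :: 'a complexification) \<le> norm (re_part z) + norm (im_part z)"
  by (rule Taylor_least) (rule Taylor_term_le)

instance
proof
  fix z w :: "'a complexification" and r :: real
  show "(norm z = 0) = (z = 0)"
  proof
    assume "norm z = 0"
    then have "re_part z = 0" "im_part z = 0"
      using norm_re_part_le[of z] norm_im_part_le[of z] by auto
    then show "z = 0" by (simp add: complexification.expand)
  next
    assume "z = 0"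
    then show "norm z = 0"
      by (simp add: norm_complexification_def)
  qed
  show "norm (z + w) \<le> norm z + norm w"
  proof (rule Taylor_least)
    fix \<theta>
    have "norm (cos \<theta> *\<^sub>R re_part (z + w) + sin \<theta> *\<^sub>R im_part (z + w)) =
      norm ((cos \<theta> *\<^sub>R re_part z + sin \<theta> *\<^sub>R im_part z) + (cos \<theta> *\<^sub>R re_part w + sin \<theta> *\<^sub>R im_part w))"
      by (simp add: algebra_simps)
    also have "\<dots> \<le> norm z + norm w"
      by (intro order_trans[OF norm_triangle_ineq] add_mono Taylor_upper)
    finally show "norm (cos \<theta> *\<^sub>R re_part (z + w) + sin \<theta> *\<^sub>R im_part (z + w)) \<le> norm z + norm w" .
  qed
  have *: "norm (r *\<^sub>R z) \<le> \<bar>r\<bar> * norm z" for r and z :: "'a complexification"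
  proof (rule Taylor_least)
    fix \<theta>
    have "norm (cos \<theta> *\<^sub>R re_part (r *\<^sub>R z) + sin \<theta> *\<^sub>R im_part (r *\<^sub>R z)) =
      norm (r *\<^sub>R (cos \<theta> *\<^sub>R re_part z + sin \<theta> *\<^sub>R im_part z))"
      by (simp add: algebra_simps)
    also have "\<dots> \<le> \<bar>r\<bar> * norm z"
      unfolding norm_scaleR by (intro mult_left_mono Taylor_upper) simp
    finally show "norm (cos \<theta> *\<^sub>R re_part (r *\<^sub>R z) + sin \<theta> *\<^sub>R im_part (r *\<^sub>R z)) \<le> \<bar>r\<bar> * norm z" .
  qed
  show "norm (r *\<^sub>R z) = \<bar>r\<bar> * norm z"
  proof (cases "r = 0")
    case True
    then show ?thesis by (simp add: norm_complexification_def)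
  next
    case False
    then have "norm z \<le> \<bar>1 / r\<bar> * norm (r *\<^sub>R z)"
      using *[of "1 / r" "r *\<^sub>R z"] by simp
    then have "\<bar>r\<bar> * norm z \<le> norm (r *\<^sub>R z)"
      using False by (simp add: field_simps)
    with *[of r z] show ?thesis by simp
  qed
qed (fact dist_complexification_def sgn_complexification_def uniformity_complexification_def
  open_complexification_def)+

end

instance complexification :: (banach) banach
proof
  fix X :: "nat \<Rightarrow> 'a complexification"
  assume X: "Cauchy X"
  have Cauchy_le: "Cauchy Y"
    if Y: "\<And>m n. norm (Y m - Y n) \<le> norm (X m - X n)" for Y :: "nat \<Rightarrow> 'a"
  proof (rule metric_CauchyI)
    fix e :: real assume "0 < e"
    then obtain M where M: "\<And>m n. m \<ge> M \<Longrightarrow> n \<ge> M \<Longrightarrow> dist (X m) (X n) < e"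
      using metric_CauchyD[OF X] by blast
    have "dist (Y m) (Y n) < e" if "m \<ge> M" "n \<ge> M" for m n
      using M[OF that] Y[of m n] unfolding dist_norm by (rule order_le_less_trans[rotated])
    then show "\<exists>M. \<forall>m\<ge>M. \<forall>n\<ge>M. dist (Y m) (Y n) < e"
      by blast
  qed
  have "Cauchy (\<lambda>n. re_part (X n))" "Cauchy (\<lambda>n. im_part (X n))"
    by (rule Cauchy_le, use norm_re_part_le[of "X _ - X _"] in simp)
      (rule Cauchy_le, use norm_im_part_le[of "X _ - X _"] in simp)
  then obtain x y where x: "(\<lambda>n. re_part (X n)) \<longlonglongrightarrow> x" and y: "(\<lambda>n. im_part (X n)) \<longlonglongrightarrow> y"
    unfolding Cauchy_convergent_iff convergent_def by auto
  have "(\<lambda>n. norm (re_part (X n) - x) + norm (im_part (X n) - y)) \<longlonglongrightarrow> 0"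
    using tendsto_add[OF x[THEN LIM_zero, THEN tendsto_norm_zero] y[THEN LIM_zero, THEN tendsto_norm_zero]]
    by simp
  then have "(\<lambda>n. norm (X n - Cplx x y)) \<longlonglongrightarrow> 0"
  proof (rule Lim_null_comparison[rotated], intro always_eventually allI)
    show "norm (norm (X n - Cplx x y)) \<le> norm (re_part (X n) - x) + norm (im_part (X n) - y)" for n
      using norm_complexification_le[of "X n - Cplx x y"] by simp
  qed
  then show "convergent X"
    using LIM_zero_cancel[OF tendsto_norm_zero_cancel] by (auto simp: convergent_def)
qed

lemma normed_space_over_complexification:
  "normed_space_over UNIV (scaleCplx :: complex \<Rightarrow> 'a complexification \<Rightarrow> 'a::real_normed_vector complexification)"
proof -
  have le: "norm (scaleCplx c z) \<le> cmod c * norm z" for c and z :: "'a complexification"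
  proof (rule Taylor_least)
    fix \<theta>
    define \<phi> where "\<phi> = Arg c"
    have c: "Re c = cmod c * cos \<phi>" "Im c = cmod c * sin \<phi>"
      using arg_cong[OF rcis_cmod_Arg[of c], of Re] arg_cong[OF rcis_cmod_Arg[of c], of Im]
      by (simp_all add: \<phi>_def)
    have "cos \<theta> *\<^sub>R re_part (scaleCplx c z) + sin \<theta> *\<^sub>R im_part (scaleCplx c z) =
      cmod c *\<^sub>R (cos (\<theta> - \<phi>) *\<^sub>R re_part z + sin (\<theta> - \<phi>) *\<^sub>R im_part z)"
      unfolding scaleCplx_def cos_diff sin_diff complexification.sel c by (simp add: algebra_simps)
    then have "norm (cos \<theta> *\<^sub>R re_part (scaleCplx c z) + sin \<theta> *\<^sub>R im_part (scaleCplx c z)) =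
      cmod c * norm (cos (\<theta> - \<phi>) *\<^sub>R re_part z + sin (\<theta> - \<phi>) *\<^sub>R im_part z)"
      by simp
    also have "\<dots> \<le> cmod c * norm z"
      by (intro mult_left_mono Taylor_upper) simp
    finally show "norm (cos \<theta> *\<^sub>R re_part (scaleCplx c z) + sin \<theta> *\<^sub>R im_part (scaleCplx c z)) \<le> cmod c * norm z" .
  qed
  have mult: "scaleCplx c (scaleCplx d z) = scaleCplx (c * d) z" for c d and z :: "'a complexification"
    by (simp add: scaleCplx_def algebra_simps)
  have real: "scaleCplx (complex_of_real r) z = r *\<^sub>R z" for r and z :: "'a complexification"
    by (simp add: scaleCplx_def scaleR_complexification_def)
  have "norm (scaleCplx c z) = cmod c * norm z" for c and z :: "'a complexification"
  proof (cases "c = 0")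
    case True
    then show ?thesis using real[of 0 z] by simp
  next
    case False
    have "scaleCplx (inverse c) (scaleCplx c z) = z"
      using False real[of 1 z] by (simp add: mult)
    then have "norm z \<le> cmod (inverse c) * norm (scaleCplx c z)"
      using le[of "inverse c" "scaleCplx c z"] by simp
    then have "cmod c * norm z \<le> norm (scaleCplx c z)"
      using False by (metis inverse_inverse_eq norm_inverse pos_divide_le_eq divide_inverse mult.commute
          inverse_positive_iff_positive zero_less_norm_iff)
    with le[of c z] show ?thesis by simp
  qed
  moreover have "scaleCplx c (z + w) = scaleCplx c z + scaleCplx c w"
    "scaleCplx (c + d) z = scaleCplx c z + scaleCplx d z" for c d and z w :: "'a complexification"
    unfolding scaleCplx_def plus_complexification_def complexification.sel plus_complex.sel complexification.inject
      scaleR_add_left scaleR_add_right by simp_all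
  ultimately show ?thesis
    unfolding normed_space_over_def using mult real by blast
qed


section \<open>Unbounded operators, resolvents and sectoriality\<close>

text \<open>An unbounded operator is a pair of a domain \<open>D\<close> and a function \<open>A\<close> whose values outside \<open>D\<close>
  are irrelevant.\<close>

definition linear_operator_on ::
    "complex set \<Rightarrow> (complex \<Rightarrow> 'a \<Rightarrow> 'a) \<Rightarrow> 'a::real_vector set \<Rightarrow> ('a \<Rightarrow> 'a) \<Rightarrow> bool" where
  "linear_operator_on K s D A \<longleftrightarrow> 0 \<in> D \<and>
     (\<forall>x\<in>D. \<forall>y\<in>D. x + y \<in> D \<and> A (x + y) = A x + A y) \<and>
     (\<forall>c\<in>K. \<forall>x\<in>D. s c x \<in> D \<and> A (s c x) = s c (A x))"

definition closed_operator :: "'a::topological_space set \<Rightarrow> ('a \<Rightarrow> 'a) \<Rightarrow> bool" where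
  "closed_operator D A \<longleftrightarrow> closed {(x, A x) | x. x \<in> D}"

definition densely_defined :: "'a::topological_space set \<Rightarrow> bool" where
  "densely_defined D \<longleftrightarrow> closure D = UNIV"

definition resolvent ::
    "(complex \<Rightarrow> 'a \<Rightarrow> 'a) \<Rightarrow> 'a::real_normed_vector set \<Rightarrow> ('a \<Rightarrow> 'a) \<Rightarrow> complex \<Rightarrow> 'a \<Rightarrow> 'a" where
  "resolvent s D A \<mu> = inv_into D (\<lambda>x. s \<mu> x - A x)"

definition resolvent_set ::
    "(complex \<Rightarrow> 'a \<Rightarrow> 'a) \<Rightarrow> 'a::real_normed_vector set \<Rightarrow> ('a \<Rightarrow> 'a) \<Rightarrow> complex set" where
  "resolvent_set s D A =
     {\<mu>. bij_betw (\<lambda>x. s \<mu> x - A x) D UNIV \<and> bounded_linear (resolvent s D A \<mu>)}"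

definition sector :: "real \<Rightarrow> complex set" where
  "sector \<theta> = {\<mu>. \<mu> \<noteq> 0 \<and> \<bar>Arg \<mu>\<bar> < \<theta> + pi / 2}"

definition complex_sectorial ::
    "(complex \<Rightarrow> 'a \<Rightarrow> 'a) \<Rightarrow> 'a::real_normed_vector set \<Rightarrow> ('a \<Rightarrow> 'a) \<Rightarrow> real \<Rightarrow> bool" where
  "complex_sectorial s D A \<theta> \<longleftrightarrow> 0 < \<theta> \<and> \<theta> \<le> pi / 2 \<and>
     sector \<theta> \<subseteq> resolvent_set s D A \<and>
     (\<forall>\<omega>. 0 < \<omega> \<and> \<omega> < \<theta> \<longrightarrow>
        (\<exists>C\<ge>1. \<forall>\<mu>\<in>closure (sector (\<theta> - \<omega>)). \<mu> \<noteq> 0 \<longrightarrow> onorm (resolvent s D A \<mu>) \<le> C / cmod \<mu>))"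

definition compact_operator :: "('a::real_normed_vector \<Rightarrow> 'b::real_normed_vector) \<Rightarrow> bool" where
  "compact_operator R \<longleftrightarrow> bounded_linear R \<and> (\<forall>S. bounded S \<longrightarrow> compact (closure (R ` S)))"

definition complex_compact_resolvent ::
    "(complex \<Rightarrow> 'a \<Rightarrow> 'a) \<Rightarrow> 'a::real_normed_vector set \<Rightarrow> ('a \<Rightarrow> 'a) \<Rightarrow> bool" where
  "complex_compact_resolvent s D A \<longleftrightarrow>
     (\<exists>\<mu>\<^sub>0\<in>resolvent_set s D A. compact_operator (resolvent s D A \<mu>\<^sub>0))"

definition complexify_dom :: "'a set \<Rightarrow> 'a complexification set" where
  "complexify_dom D = {z. re_part z \<in> D \<and> im_part z \<in> D}"

definition complexify_op :: "('a \<Rightarrow> 'a) \<Rightarrow> 'a complexification \<Rightarrow> 'a complexification" where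
  "complexify_op A z = Cplx (A (re_part z)) (A (im_part z))"

text \<open>Over the real field all spectral notions refer to the complexified operator.\<close>

definition sectorial ::
    "complex set \<Rightarrow> (complex \<Rightarrow> 'a \<Rightarrow> 'a) \<Rightarrow> 'a::real_normed_vector set \<Rightarrow> ('a \<Rightarrow> 'a) \<Rightarrow> real \<Rightarrow> bool" where
  "sectorial K s D A \<theta> \<longleftrightarrow>
     (if K = UNIV then complex_sectorial s D A \<theta>
      else complex_sectorial scaleCplx (complexify_dom D) (complexify_op A) \<theta>)"

definition compact_resolvent ::
    "complex set \<Rightarrow> (complex \<Rightarrow> 'a \<Rightarrow> 'a) \<Rightarrow> 'a::real_normed_vector set \<Rightarrow> ('a \<Rightarrow> 'a) \<Rightarrow> bool" where
  "compact_resolvent K s D A \<longleftrightarrow>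
     (if K = UNIV then complex_compact_resolvent s D A
      else complex_compact_resolvent scaleCplx (complexify_dom D) (complexify_op A))"


section \<open>The resolvent family\<close>

definition kernel :: "real \<Rightarrow> real \<Rightarrow> real \<Rightarrow> real \<Rightarrow> real" where
  "kernel \<alpha> \<beta> \<nu> t = \<alpha> * exp (- \<beta> * t) * (t powr (\<nu> - 1) / Gamma \<nu>)"

text \<open>By the first two groups of conditions the integrand in the last one is continuous in \<open>r\<close>,
  so the choice of integral for vector-valued functions is immaterial there.\<close>

definition resolvent_family ::
    "complex set \<Rightarrow> (complex \<Rightarrow> 'a \<Rightarrow> 'a) \<Rightarrow> 'a::real_normed_vector set \<Rightarrow> ('a \<Rightarrow> 'a) \<Rightarrow>
     real \<Rightarrow> real \<Rightarrow> real \<Rightarrow> (real \<Rightarrow> 'a \<Rightarrow>\<^sub>L 'a) \<Rightarrow> bool" where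
  "resolvent_family K s D A \<alpha> \<beta> \<nu> G \<longleftrightarrow>
     (\<forall>t\<ge>0. homogeneous_over K s s (G t)) \<and>
     (\<forall>z. continuous_on {0..} (\<lambda>t. G t z)) \<and> G 0 = id_blinfun \<and>
     (\<forall>t\<ge>0. \<forall>z\<in>D. G t z \<in> D \<and> G t (A z) = A (G t z)) \<and>
     (\<forall>t\<ge>0. \<forall>z\<in>D.
        ((\<lambda>r. (1 + integral {0..t - r} (kernel \<alpha> \<beta> \<nu>)) *\<^sub>R A (G r z)) has_integral (G t z - z)) {0..t})"


section \<open>Strong measurability and the Bochner integral without separability\<close>

text \<open>The library's Bochner integral is restricted to second-countable spaces. The definitions below
  are its counterparts for an arbitrary Banach space, with Borel measurability replaced by strong
  measurability.\<close>

definition strongly_measurable :: "'b measure \<Rightarrow> ('b \<Rightarrow> 'a::real_normed_vector) \<Rightarrow> bool" where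
  "strongly_measurable M g \<longleftrightarrow>
     (\<exists>S. (\<forall>i::nat. simple_function M (S i)) \<and> (AE x in M. (\<lambda>i. S i x) \<longlonglongrightarrow> g x))"

definition has_strong_bochner_integral ::
    "'b measure \<Rightarrow> ('b \<Rightarrow> 'a::real_normed_vector) \<Rightarrow> 'a \<Rightarrow> bool" where
  "has_strong_bochner_integral M g I \<longleftrightarrow> strongly_measurable M g \<and>
     (\<exists>S. (\<forall>i::nat. Bochner_Integration.simple_bochner_integrable M (S i)) \<and>
          (\<lambda>i. \<integral>\<^sup>+x. norm (g x - S i x) \<partial>M) \<longlonglongrightarrow> 0 \<and>
          (\<lambda>i. Bochner_Integration.simple_bochner_integral M (S i)) \<longlonglongrightarrow> I)"

definition in_L2 :: "real \<Rightarrow> (real \<Rightarrow> 'a::real_normed_vector) \<Rightarrow> bool" where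
  "in_L2 T g \<longleftrightarrow> strongly_measurable (lebesgue_on {0..T}) g \<and>
     integrable (lebesgue_on {0..T}) (\<lambda>t. (norm (g t))\<^sup>2)"

definition L2_norm_on :: "real \<Rightarrow> (real \<Rightarrow> 'a::real_normed_vector) \<Rightarrow> real" where
  "L2_norm_on T g = sqrt (integral\<^sup>L (lebesgue_on {0..T}) (\<lambda>t. (norm (g t))\<^sup>2))"

definition L1_norm_on :: "real \<Rightarrow> (real \<Rightarrow> real) \<Rightarrow> real" where
  "L1_norm_on T g = integral\<^sup>L (lebesgue_on {0..T}) (\<lambda>t. \<bar>g t\<bar>)"


section \<open>Mild solutions\<close>

definition mild_solution ::
    "(real \<Rightarrow> 'w \<Rightarrow>\<^sub>L 'w) \<Rightarrow> ('u::real_normed_vector \<Rightarrow>\<^sub>L 'w) \<Rightarrow> (real \<Rightarrow> 'u) \<Rightarrow> (real \<Rightarrow> 'w \<Rightarrow> 'w) \<Rightarrow>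
     'w \<Rightarrow> real \<Rightarrow> (real \<Rightarrow> 'w::real_normed_vector) \<Rightarrow> bool"
  where
  "mild_solution G B u f \<zeta> T w \<longleftrightarrow> continuous_on {0..T} w \<and>
     (\<forall>t\<in>{0..T}. \<exists>I.
        has_strong_bochner_integral (lebesgue_on {0..t}) (\<lambda>s. G (t - s) (B (u s) + f s (w s))) I \<and>
        w t = G t \<zeta> + I)"

end

(*
The resolvent family G is shown to be norm continuous and compact on (0,T]. Its Laplace transform is
formally H(z) = c(z) (m(z) - A)^-1 with c = 1/(1 + kap) and m = z c, where kap is the transform of the
kernel. Sectoriality gives H'(z) = O(|z|^-2) on a half plane, so Q(t) = -(1/2 pi i) int e^(zt) H'(z) dz
converges absolutely in operator norm; Q is norm continuous and has compact values because the
resolvents are compact. No exponential bound on G is available, but the transform of G over [0,T]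
deviates from H by O(|z| e^(-T Re z)) only, and this already forces Q(t) = t G(t) on [0,T].

The mild equation is then solved without a fixed point theorem. The equations with delay 1/n in the
nonlinearity are solvable by finite iteration, their solutions are equicontinuous with relatively
compact values, and a limit furnished by the Arzela-Ascoli theorem solves the original equation by
dominated convergence.
*)

theory Submission
  imports Defs "HOL-Complex_Analysis.Complex_Analysis" "HOL-Library.Diagonal_Subsequence"
begin

section \<open>Laplace transforms of powers\<close>

text \<open>The factor t is forced: \<open>G\<close> is only strongly continuous at 0, and its
  transform decays like 1/|z|, too slowly for an absolutely convergent inversion integral.
  Differentiating the transform gains the missing power of |z| and amounts to multiplying by -t,
  which costs nothing away from t = 0. On a fixed vertical line the truncation error need not be
  smaller than the transform itself; it becomes negligible only when the line is moved to the right,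
  and that requires decay on a whole half plane. Convolution with t^2/2 supplies it through the
  factor z^-3, the exponential e^(zt) with t \<le> T being absorbed by e^(-T Re z); three
  differentiations remove the convolution again. In the nonlinear part all forcing terms are
  dominated by one function \<open>\<psi>\<close>; the condition on the radius then keeps the closed
  ball invariant under the delayed iteration, and equicontinuity and compactness hold uniformly for
  everything dominated by \<open>\<psi>\<close>.\<close>

lemma integrable_powr_exp:
  fixes a c :: real
  assumes "a > -1" "c > 0"
  shows "(\<lambda>u. u powr a * exp (- c * u)) integrable_on {0<..}"
proof -
  have "(\<lambda>t. complex_of_real t powr (complex_of_real (a + 1) - 1) / of_real (exp (c * t))) absolutely_integrable_on {0<..}"
    using assms by (intro absolutely_integrable_Gamma_integral) auto
  then have "(\<lambda>t. norm (complex_of_real t powr (complex_of_real (a + 1) - 1) / of_real (exp (c * t)))) integrable_on {0<..}"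
    by (simp add: absolutely_integrable_on_def)
  then show ?thesis
  proof (rule integrable_eq)
    fix x :: real assume "x \<in> {0<..}"
    then show "norm (complex_of_real x powr (complex_of_real (a + 1) - 1) / of_real (exp (c * x))) = x powr a * exp (- c * x)"
      by (simp add: norm_divide norm_mult norm_inverse norm_powr_real_powr exp_minus divide_inverse)
  qed
qed

definition laplace_powr :: "real \<Rightarrow> complex \<Rightarrow> complex" where
  "laplace_powr a p = integral {0<..} (\<lambda>u. of_real (u powr a) * exp (- p * of_real u))"

lemma absolutely_integrable_powr_cexp:
  assumes "a > -1" "Re p > 0"
  shows "(\<lambda>u. of_real (u powr a) * exp (- p * of_real u)) absolutely_integrable_on {0<..}"
proof (rule measurable_bounded_by_integrable_imp_absolutely_integrable)
  show "(\<lambda>u. complex_of_real (u powr a) * exp (- p * complex_of_real u)) \<in> borel_measurable (lebesgue_on {0<..})"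
    by (intro continuous_imp_measurable_on_sets_lebesgue continuous_intros) auto
  show "(\<lambda>u. u powr a * exp (- Re p * u)) integrable_on {0<..}"
    using assms by (intro integrable_powr_exp) auto
qed (use assms in \<open>auto simp: norm_mult\<close>)

lemma integrable_powr_cexp:
  assumes "a > -1" "Re p > 0"
  shows "(\<lambda>u. of_real (u powr a) * exp (- p * of_real u)) integrable_on {0<..}"
  using absolutely_integrable_powr_cexp[OF assms] by (simp add: absolutely_integrable_on_def)

lemma norm_exp_remainder:
  fixes z :: complex
  shows "cmod (exp z - 1 - z) \<le> cmod z ^ 2 * exp (cmod z)"
proof -
  have "cmod (exp z - (\<Sum>i\<le>1. z ^ i / fact i)) \<le> exp \<bar>Re z\<bar> * (cmod z ^ Suc 1) / fact 1"
    by (rule Taylor_exp)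
  also have "\<dots> \<le> exp (cmod z) * cmod z ^ 2"
    using abs_Re_le_cmod[of z] by (simp add: power2_eq_square mult_right_mono)
  finally show ?thesis by (simp add: algebra_simps)
qed

text \<open>Differentiation under the integral sign by a direct estimate: the second-order Taylor
  remainder of e^(-hu) contributes |h|^2 u^2, so the error of the difference quotient is O(|h|) with
  an integrable majorant independent of h.\<close>

lemma laplace_powr_field_derivative:
  assumes a: "a > -1" and p: "Re p > 0"
  shows "(laplace_powr a has_field_derivative - laplace_powr (a + 1) p) (at p)"
proof -
  \<comment> \<open>Half of the decay e^(-u Re p) is kept; the other half absorbs the growth e^(|h|
    u) of the remainder for |h| < c.\<close>
  define c where "c = Re p / 2"
  have c: "c > 0" using p by (simp add: c_def)
  define B where "B = integral {0<..} (\<lambda>u. u powr (a + 2) * exp (- c * u))"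
  have est: "cmod (laplace_powr a (p + h) - laplace_powr a p + h * laplace_powr (a + 1) p) \<le> cmod h ^ 2 * B"
    if h: "cmod h < c" for h
  proof -
    have Reh: "Re (p + h) > 0" using h c abs_Re_le_cmod[of h] by (simp add: c_def)
    have "laplace_powr a (p + h) - laplace_powr a p + h * laplace_powr (a + 1) p =
      integral {0<..} (\<lambda>u. of_real (u powr a) * exp (- (p + h) * of_real u) - of_real (u powr a) * exp (- p * of_real u)
         + h * (of_real (u powr (a + 1)) * exp (- p * of_real u)))"
      unfolding laplace_powr_def using a p Reh
      by (subst integral_add integral_diff integral_mult_right | intro integrable_diff integrable_add integrable_powr_cexp integrable_on_mult_right | simp)+
    also have "cmod \<dots> \<le> integral {0<..} (\<lambda>u. cmod h ^ 2 * (u powr (a + 2) * exp (- c * u)))"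
    proof (rule integral_norm_bound_integral)
      show "(\<lambda>u. of_real (u powr a) * exp (- (p + h) * of_real u) - of_real (u powr a) * exp (- p * of_real u)
         + h * (of_real (u powr (a + 1)) * exp (- p * of_real u))) integrable_on {0<..}"
        using a p Reh by (intro integrable_add integrable_diff integrable_on_mult_right integrable_powr_cexp) auto
      show "(\<lambda>u. cmod h ^ 2 * (u powr (a + 2) * exp (- c * u))) integrable_on {0<..}"
        using a c by (intro integrable_on_mult_right integrable_powr_exp) auto
      fix u :: real assume u: "u \<in> {0<..}"
      have "of_real (u powr a) * exp (- (p + h) * of_real u) - of_real (u powr a) * exp (- p * of_real u)
         + h * (of_real (u powr (a + 1)) * exp (- p * of_real u))
         = of_real (u powr a) * exp (- p * of_real u) * (exp (- h * of_real u) - 1 - (- h * of_real u))"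
        using u by (simp add: powr_add exp_add[symmetric] algebra_simps)
      also have "cmod \<dots> = u powr a * exp (- Re p * u) * cmod (exp (- h * of_real u) - 1 - (- h * of_real u))"
        using u by (simp add: norm_mult)
      also have "\<dots> \<le> u powr a * exp (- Re p * u) * (cmod (- h * of_real u) ^ 2 * exp (cmod (- h * of_real u)))"
        by (intro mult_left_mono norm_exp_remainder) auto
      also have "\<dots> = cmod h ^ 2 * (u powr (a + 2) * exp (- Re p * u + cmod h * u))"
        using u unfolding exp_add by (simp add: norm_mult powr_add power2_eq_square power_mult_distrib)
      also have "\<dots> \<le> cmod h ^ 2 * (u powr (a + 2) * exp (- c * u))"
      proof -
        have "- Re p * u + cmod h * u \<le> - c * u"
          using h u mult_right_mono[of "cmod h" "c" u] by (simp add: c_def algebra_simps)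
        then show ?thesis by (intro mult_left_mono) auto
      qed
      finally show "cmod (of_real (u powr a) * exp (- (p + h) * of_real u) - of_real (u powr a) * exp (- p * of_real u)
         + h * (of_real (u powr (a + 1)) * exp (- p * of_real u))) \<le> cmod h ^ 2 * (u powr (a + 2) * exp (- c * u))" .
    qed
    finally show ?thesis by (simp add: B_def)
  qed
  have "((\<lambda>h. (laplace_powr a (p + h) - laplace_powr a p) / h - - laplace_powr (a + 1) p) \<longlongrightarrow> 0) (at 0)"
  proof (rule Lim_null_comparison)
    have "\<forall>\<^sub>F h in at 0. h \<noteq> 0 \<and> cmod h < c"
      using c by (auto simp: eventually_at intro!: exI[of _ c])
    then show "\<forall>\<^sub>F h in at 0. cmod ((laplace_powr a (p + h) - laplace_powr a p) / h - - laplace_powr (a + 1) p) \<le> cmod h * B"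
    proof eventually_elim
      case (elim h)
      then have "(laplace_powr a (p + h) - laplace_powr a p) / h - - laplace_powr (a + 1) p =
        (laplace_powr a (p + h) - laplace_powr a p + h * laplace_powr (a + 1) p) / h"
        by (simp add: field_simps)
      then show ?case using est[of h] elim
        by (simp add: norm_divide field_simps power2_eq_square)
    qed
    show "((\<lambda>h. cmod h * B) \<longlongrightarrow> 0) (at 0)"
      by (auto intro!: tendsto_eq_intros)
  qed
  then have "((\<lambda>h. (laplace_powr a (p + h) - laplace_powr a p) / h) \<longlongrightarrow> - laplace_powr (a + 1) p) (at 0)"
    using LIM_zero_iff by blast
  then show ?thesis by (simp add: DERIV_def)
qed

text \<open>The substitution u \<mapsto> c u turns this into the Gamma integral. It is made for
  nonnegative Lebesgue integrals, where it holds without integrability conditions, and the value is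
  then transferred to the gauge integral.\<close>

lemma real_powr_exp_has_integral:
  assumes \<nu>: "\<nu> > (0::real)" and c: "c > 0"
  shows "((\<lambda>u. u powr (\<nu> - 1) * exp (- c * u)) has_integral Gamma \<nu> * c powr (- \<nu>)) {0<..}"
proof -
  have nn: "(\<integral>\<^sup>+t. ennreal (t powr (\<nu> - 1) / exp t) * indicator {0..} t \<partial>lborel) = ennreal (Gamma \<nu>)"
    unfolding Gamma_conv_nn_integral_real[OF \<nu>]
    by (intro nn_integral_cong) (simp add: indicator_def)
  have "(\<integral>\<^sup>+t. ennreal (t powr (\<nu> - 1) / exp t) * indicator {0..} t \<partial>lborel) =
    c * (\<integral>\<^sup>+t. ennreal ((c * t) powr (\<nu> - 1) / exp (c * t)) * indicator {0..} (c * t) \<partial>lborel)"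
    using nn_integral_real_affine[of "\<lambda>t. ennreal (t powr (\<nu> - 1) / exp t) * indicator {0..} t" c 0] c by simp
  also have "\<dots> = (\<integral>\<^sup>+t. ennreal c * (ennreal ((c * t) powr (\<nu> - 1) / exp (c * t)) * indicator {0..} (c * t)) \<partial>lborel)"
    by (rule nn_integral_cmult[symmetric]) measurable
  also have "\<dots> = (\<integral>\<^sup>+t. ennreal (indicator {0<..} t * (c powr \<nu> * (t powr (\<nu> - 1) * exp (- c * t)))) \<partial>lborel)"
  proof (intro nn_integral_cong)
    fix t :: real
    have "c * ((c * t) powr (\<nu> - 1) / exp (c * t)) = c powr \<nu> * (t powr (\<nu> - 1) * exp (- c * t))" if "t > 0"
      using that c by (simp add: powr_mult powr_diff exp_minus field_simps)
    then show "ennreal c * (ennreal ((c * t) powr (\<nu> - 1) / exp (c * t)) * indicator {0..} (c * t)) =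
      ennreal (indicator {0<..} t * (c powr \<nu> * (t powr (\<nu> - 1) * exp (- c * t))))"
      using c by (cases "t = 0"; auto simp: indicator_def ennreal_mult[symmetric] zero_le_mult_iff)
  qed
  finally have "(\<integral>\<^sup>+t. ennreal (indicator {0<..} t * (c powr \<nu> * (t powr (\<nu> - 1) * exp (- c * t)))) \<partial>lborel) = ennreal (Gamma \<nu>)"
    using nn by simp
  moreover have "((\<lambda>t. c powr \<nu> * (t powr (\<nu> - 1) * exp (- c * t))) has_integral
      integral {0<..} (\<lambda>t. c powr \<nu> * (t powr (\<nu> - 1) * exp (- c * t)))) {0<..}"
    using \<nu> c by (intro integrable_integral integrable_on_mult_right integrable_powr_exp) auto
  moreover from this have "(\<integral>\<^sup>+t. ennreal (indicator {0<..} t * (c powr \<nu> * (t powr (\<nu> - 1) * exp (- c * t)))) \<partial>lborel) =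
    ennreal (integral {0<..} (\<lambda>t. c powr \<nu> * (t powr (\<nu> - 1) * exp (- c * t))))"
    by (intro nn_integral_has_integral_lebesgue) auto
  ultimately have "integral {0<..} (\<lambda>t. c powr \<nu> * (t powr (\<nu> - 1) * exp (- c * t))) = Gamma \<nu>"
    using \<nu> c by (metis (no_types, lifting) ennreal_inj Gamma_real_pos less_imp_le has_integral_nonneg
        mult_nonneg_nonneg powr_ge_zero exp_ge_zero)
  then have "((\<lambda>t. c powr \<nu> * (t powr (\<nu> - 1) * exp (- c * t))) has_integral Gamma \<nu>) {0<..}"
    using \<open>(_ has_integral _) {0<..}\<close> by simp
  from has_integral_mult_right[OF this, of "c powr (- \<nu>)"] show ?thesis
    using c by (simp add: powr_minus field_simps)
qed

text \<open>Both sides are holomorphic in the right half plane and agree on the positive reals by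
  scaling, so analytic continuation replaces a rotation of the ray of integration.\<close>

lemma laplace_powr_eq:
  assumes \<nu>: "\<nu> > 0" and p: "Re p > 0"
  shows "laplace_powr (\<nu> - 1) p = of_real (Gamma \<nu>) * p powr (- of_real \<nu>)"
proof -
  let ?S = "{p::complex. Re p > 0}"
  let ?f = "\<lambda>p::complex. laplace_powr (\<nu> - 1) p - of_real (Gamma \<nu>) * p powr (- of_real \<nu>)"
  have S: "open ?S" by (rule open_halfspace_Re_gt)
  have "?f p = 0"
  proof (rule analytic_continuation[of ?f ?S "of_real ` {0<..}" 1])
    show "?f holomorphic_on ?S"
    proof (rule holomorphic_on_diff)
      show "laplace_powr (\<nu> - 1) holomorphic_on ?S"
        using laplace_powr_field_derivative[of "\<nu> - 1"] \<nu> S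
        by (auto simp: holomorphic_on_open)
      show "(\<lambda>p. of_real (Gamma \<nu>) * p powr (- of_real \<nu>)) holomorphic_on ?S"
        by (intro holomorphic_intros) (auto simp: complex_nonpos_Reals_iff)
    qed
    show "connected ?S" by (rule convex_connected[OF convex_halfspace_Re_gt])
    show "(1::complex) islimpt complex_of_real ` {0<..}"
    proof (rule islimptI)
      fix T :: "complex set" assume T: "1 \<in> T" "open T"
      then obtain e where e: "e > 0" "ball 1 e \<subseteq> T" by (meson open_contains_ball)
      have "of_real (1 + e/2) \<in> T" using e by (intro set_mp[OF e(2)]) (auto simp: dist_norm)
      then show "\<exists>y\<in>complex_of_real ` {0<..}. y \<in> T \<and> y \<noteq> 1"
        using e(1) by (intro bexI[of _ "of_real (1 + e/2)"] conjI imageI) (simp_all only: of_real_eq_1_iff, auto)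
    qed
    fix z assume "z \<in> complex_of_real ` {0<..}"
    then obtain c where c: "c > 0" "z = of_real c" by auto
    have "((\<lambda>u. complex_of_real (u powr (\<nu> - 1) * exp (- c * u))) has_integral of_real (Gamma \<nu> * c powr (- \<nu>))) {0<..}"
      by (intro has_integral_of_real real_powr_exp_has_integral \<nu> c)
    then have "((\<lambda>u. of_real (u powr (\<nu> - 1)) * exp (- z * of_real u)) has_integral of_real (Gamma \<nu> * c powr (- \<nu>))) {0<..}"
      by (rule has_integral_eq[rotated]) (simp add: c exp_of_real[symmetric])
    then show "?f z = 0"
      unfolding laplace_powr_def using c powr_of_real[of c "- \<nu>"] by (simp add: integral_unique)
  qed (use S p in auto)
  then show ?thesis by simp
qed

text \<open>The difference is the integral over the tail beyond v. Translating the tail to the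
  origin produces the factor e^(-v Re p), and since \<nu> < 1 the power u^(\<nu>-1) is decreasing,
  so what remains is at most the full real integral.\<close>

lemma laplace_powr_tail:
  fixes p :: complex
  assumes \<nu>: "0 < \<nu>" "\<nu> < 1" and p: "Re p > 0" and v: "v \<ge> 0"
  shows "cmod (of_real (Gamma \<nu>) * p powr (- of_real \<nu>) - integral {0..v} (\<lambda>u. of_real (u powr (\<nu> - 1)) * exp (- p * of_real u)))
    \<le> exp (- v * Re p) * (Gamma \<nu> * Re p powr (- \<nu>))"
proof -
  let ?f = "\<lambda>u. of_real (u powr (\<nu> - 1)) * exp (- p * of_real u)"
  let ?g = "\<lambda>u. u powr (\<nu> - 1) * exp (- Re p * u)"
  have fi: "?f absolutely_integrable_on {0<..}"
    using \<nu> p by (intro absolutely_integrable_powr_cexp) auto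
  have f1: "?f integrable_on {0<..v}" "?f integrable_on {v<..}"
    by (rule set_lebesgue_integral_eq_integral(1)[OF set_integrable_subset[OF fi]]; use v in auto)+
  have gi: "?g absolutely_integrable_on {0<..}"
    by (intro nonnegative_absolutely_integrable_1 integrable_powr_exp) (use \<nu> p in auto)
  have un: "{0<..v} \<union> {v<..} = {0<..}" using v by auto
  have "(?f has_integral (integral {0<..v} ?f + integral {v<..} ?f)) ({0<..v} \<union> {v<..})"
    by (intro has_integral_Un integrable_integral f1) (auto intro: negligible_subset[of "{}"])
  then have "laplace_powr (\<nu> - 1) p = integral {0<..v} ?f + integral {v<..} ?f"
    unfolding un laplace_powr_def by (rule integral_unique)
  moreover have "integral {0<..v} ?f = integral {0..v} ?f"
    by (rule integral_spike_set) (auto intro: negligible_subset[of "{0}"])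
  ultimately have "of_real (Gamma \<nu>) * p powr (- of_real \<nu>) - integral {0..v} ?f = integral {v<..} ?f"
    using laplace_powr_eq[OF \<nu>(1) p] by simp
  also have "cmod \<dots> \<le> integral {v<..} ?g"
  proof (rule integral_norm_bound_integral[OF f1(2)])
    show "?g integrable_on {v<..}"
      by (rule set_lebesgue_integral_eq_integral(1)[OF set_integrable_subset[OF gi]]) (use v in auto)
  qed (simp add: norm_mult)
  also have "\<dots> \<le> exp (- v * Re p) * (Gamma \<nu> * Re p powr (- \<nu>))"
  proof -
    have "((\<lambda>u. u powr (\<nu> - 1) * exp (- Re p * u)) has_integral Gamma \<nu> * Re p powr (- \<nu>)) {0<..}"
      using \<nu> p by (intro real_powr_exp_has_integral) auto
    from has_integral_mult_right[OF this, of "exp (- v * Re p)"]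
    have 1: "(\<integral>\<^sup>+u. ennreal (indicator {0<..} u * (exp (- v * Re p) * (u powr (\<nu> - 1) * exp (- Re p * u)))) \<partial>lborel) =
        ennreal (exp (- v * Re p) * (Gamma \<nu> * Re p powr (- \<nu>)))"
      by (intro nn_integral_has_integral_lebesgue) auto
    have "(?g has_integral integral {v<..} ?g) {v<..}"
      by (rule integrable_integral[OF set_lebesgue_integral_eq_integral(1)[OF set_integrable_subset[OF gi]]]) (use v in auto)
    then have "ennreal (integral {v<..} ?g) = (\<integral>\<^sup>+u. ennreal (indicator {v<..} u * ?g u) \<partial>lborel)"
      by (intro nn_integral_has_integral_lebesgue[symmetric]) auto
    also have "\<dots> = (\<integral>\<^sup>+u. ennreal (indicator {v<..} (v + u) * ?g (v + u)) \<partial>lborel)"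
      by (subst nn_integral_real_affine[where t = v and c = 1]) auto
    also have "\<dots> \<le> (\<integral>\<^sup>+u. ennreal (indicator {0<..} u * (exp (- v * Re p) * (u powr (\<nu> - 1) * exp (- Re p * u)))) \<partial>lborel)"
    proof (intro nn_integral_mono ennreal_leI)
      fix u :: real
      have "?g (v + u) \<le> exp (- v * Re p) * (u powr (\<nu> - 1) * exp (- Re p * u))" if u: "u > 0"
      proof -
        have "(v + u) powr (\<nu> - 1) \<le> u powr (\<nu> - 1)"
          using u v \<nu> by (intro powr_mono2') auto
        then have "(v + u) powr (\<nu> - 1) * exp (- Re p * (v + u)) \<le> u powr (\<nu> - 1) * exp (- Re p * (v + u))"
          by (intro mult_right_mono) auto
        also have "\<dots> = exp (- v * Re p) * (u powr (\<nu> - 1) * exp (- Re p * u))"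
          by (simp add: ring_distribs exp_add[symmetric] mult_ac)
        finally show ?thesis .
      qed
      then show "indicator {v<..} (v + u) * ?g (v + u) \<le> indicator {0<..} u * (exp (- v * Re p) * (u powr (\<nu> - 1) * exp (- Re p * u)))"
        by (auto simp: indicator_def)
    qed
    finally show ?thesis
      unfolding 1 using \<nu> by (subst (asm) ennreal_le_iff) (auto simp: Gamma_real_pos less_imp_le)
  qed
  finally show ?thesis .
qed

section \<open>Vertical line integrals in complex Banach spaces\<close>

locale complex_banach =
  fixes s :: "complex \<Rightarrow> 'e \<Rightarrow> 'e::banach"
  assumes space: "normed_space_over UNIV s"
begin

lemma s_add_right: "s c (x + y) = s c x + s c y"
  and s_add_left: "s (c + d) x = s c x + s d x"
  and s_mult: "s c (s d x) = s (c * d) x"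
  and s_of_real: "s (of_real r) x = r *\<^sub>R x"
  and norm_s: "norm (s c x) = cmod c * norm x"
  using space by (auto simp: normed_space_over_def)

lemma s_one [simp]: "s 1 x = x"
  using s_of_real[of 1 x] by simp

sublocale s: bounded_bilinear s
proof
  show "s (r *\<^sub>R c) x = r *\<^sub>R s c x" for r c x
    using s_mult[of "of_real r" c x] by (simp add: s_of_real scaleR_conv_of_real)
  show "s c (r *\<^sub>R x) = r *\<^sub>R s c x" for r c x
    using s_mult[of c "of_real r" x] s_mult[of "of_real r" c x] by (simp add: s_of_real mult.commute)
  show "\<exists>K. \<forall>c x. norm (s c x) \<le> norm c * norm x * K"
    by (rule exI[of _ 1]) (simp add: norm_s)
qed (fact s_add_right s_add_left)+

text \<open>The contour integrals of the library are scalar-valued. Only vertical segments and rectangles occur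
  here, so their sides are treated as Henstock integrals over real intervals.\<close>

definition has_cderiv :: "(complex \<Rightarrow> 'e) \<Rightarrow> 'e \<Rightarrow> complex \<Rightarrow> bool" where
  "has_cderiv f f' z \<longleftrightarrow> (f has_derivative (\<lambda>h. s h f')) (at z)"

lemma has_cderiv_diff:
  "has_cderiv f f' z \<Longrightarrow> has_cderiv g g' z \<Longrightarrow> has_cderiv (\<lambda>z. f z - g z) (f' - g') z"
  unfolding has_cderiv_def s.diff_right by (rule has_derivative_diff)

lemma has_cderiv_scale:
  assumes "(c has_field_derivative c') (at z)" "has_cderiv f f' z"
  shows "has_cderiv (\<lambda>z. s (c z) (f z)) (s c' (f z) + s (c z) f') z"
proof -
  have "((\<lambda>z. s (c z) (f z)) has_derivative (\<lambda>h. s (c z) (s h f') + s (c' * h) (f z))) (at z)"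
    using assms unfolding has_cderiv_def has_field_derivative_def by (rule s.FDERIV)
  then show ?thesis
    unfolding has_cderiv_def by (rule back_subst[of "\<lambda>F. (_ has_derivative F) _"])
      (auto simp: fun_eq_iff s_mult s_add_right mult_ac)
qed

lemma has_cderiv_continuous: "has_cderiv f f' z \<Longrightarrow> continuous (at z within S) f"
  unfolding has_cderiv_def by (meson has_derivative_continuous continuous_at_imp_continuous_at_within)

lemma has_cderiv_vector_derivative:
  assumes "has_cderiv f f' (g x)" "(g has_vector_derivative g') (at x within S)"
  shows "((\<lambda>x. f (g x)) has_vector_derivative s g' f') (at x within S)"
proof -
  have "(f has_derivative (\<lambda>h. s h f')) (at (g x) within g ` S)"
    using assms(1) unfolding has_cderiv_def by (rule has_derivative_at_withinI)
  from has_derivative_in_compose[OF assms(2)[unfolded has_vector_derivative_def] this]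
  show ?thesis by (simp add: has_vector_derivative_def s.scaleR_left)
qed

text \<open>The integral is taken in \<tau>, not in z: the factor \<open>\<i>\<close> of dz = i
  d\<tau> is left out, and reappears as \<open>s (- \<i>)\<close> when a derivative is
  integrated.\<close>

definition line_integral :: "real \<Rightarrow> real \<Rightarrow> (complex \<Rightarrow> 'e) \<Rightarrow> 'e" where
  "line_integral a L f = integral {-L..L} (\<lambda>\<tau>. f (Complex a \<tau>))"

lemma vertical_vector_derivative: "((\<lambda>\<tau>. Complex a \<tau>) has_vector_derivative \<i>) (at \<tau> within S)"
  unfolding has_vector_derivative_def Complex_eq
  by (auto intro!: derivative_eq_intros simp: scaleR_conv_of_real)

lemma horizontal_vector_derivative: "((\<lambda>r. Complex r \<tau>) has_vector_derivative 1) (at r within S)"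
  unfolding has_vector_derivative_def Complex_eq
  by (auto intro!: derivative_eq_intros simp: scaleR_conv_of_real)

lemma continuous_on_Complex [continuous_intros]:
  "continuous_on S f \<Longrightarrow> continuous_on S g \<Longrightarrow> continuous_on S (\<lambda>x. Complex (f x) (g x))"
  unfolding Complex_eq by (intro continuous_intros)

lemma line_derivative_integral:
  assumes "L \<ge> 0" and f: "\<And>\<tau>. has_cderiv f (f' (Complex a \<tau>)) (Complex a \<tau>)"
  shows "((\<lambda>\<tau>. f' (Complex a \<tau>)) has_integral s (- \<i>) (f (Complex a L) - f (Complex a (- L)))) {-L..L}"
proof -
  have "((\<lambda>\<tau>. f (Complex a \<tau>)) has_vector_derivative s \<i> (f' (Complex a \<tau>))) (at \<tau> within {-L..L})" for \<tau>
    by (rule has_cderiv_vector_derivative[OF f vertical_vector_derivative])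
  then have "((\<lambda>\<tau>. s \<i> (f' (Complex a \<tau>))) has_integral (f (Complex a L) - f (Complex a (- L)))) {-L..L}"
    using assms(1) by (intro fundamental_theorem_of_calculus) auto
  from has_integral_linear[OF this s.bounded_linear_right[of "- \<i>"]]
  show ?thesis by (simp add: o_def s_mult)
qed

text \<open>Cauchy's theorem for a rectangle: up to the factor \<open>\<i>\<close>, both differences
  of opposite sides are the iterated integral of f' over the rectangle, in the two possible orders.
  Continuity of f' makes the exchange elementary.\<close>

lemma line_integral_rectangle:
  assumes ab: "a \<le> b" and L: "L \<ge> 0"
    and f: "\<And>z. a \<le> Re z \<Longrightarrow> has_cderiv f (f' z) z"
    and f': "continuous_on {z. a \<le> Re z} f'"
  shows "line_integral b L f - line_integral a L f =
    integral {a..b} (\<lambda>r. s (- \<i>) (f (Complex r L) - f (Complex r (- L))))"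
proof -
  have cf: "continuous_on {z. a \<le> Re z} f"
    using has_cderiv_continuous[OF f] by (simp add: continuous_on_eq_continuous_within)
  have 1: "((\<lambda>r. f' (Complex r \<tau>)) has_integral f (Complex b \<tau>) - f (Complex a \<tau>)) {a..b}" for \<tau>
  proof (rule fundamental_theorem_of_calculus[OF ab])
    fix r assume "r \<in> {a..b}"
    then show "((\<lambda>r. f (Complex r \<tau>)) has_vector_derivative f' (Complex r \<tau>)) (at r within {a..b})"
      using has_cderiv_vector_derivative[OF f horizontal_vector_derivative, of r \<tau> "{a..b}"] by simp
  qed
  have "line_integral b L f - line_integral a L f = integral {-L..L} (\<lambda>\<tau>. f (Complex b \<tau>) - f (Complex a \<tau>))"
    unfolding line_integral_def
    by (rule integral_diff[symmetric]; intro integrable_continuous_real continuous_on_compose2[OF cf] continuous_intros)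
      (use ab in auto)
  also have "\<dots> = integral {-L..L} (\<lambda>\<tau>. integral {a..b} (\<lambda>r. f' (Complex r \<tau>)))"
    by (simp only: integral_unique[OF 1])
  also have "\<dots> = integral {a..b} (\<lambda>r. integral {-L..L} (\<lambda>\<tau>. f' (Complex r \<tau>)))"
  proof -
    have "continuous_on (cbox (- L, a) (L, b)) (\<lambda>(\<tau>, r). f' (Complex r \<tau>))"
      unfolding split_beta by (intro continuous_on_compose2[OF f'] continuous_intros) (auto simp: cbox_Pair_eq)
    from integral_swap_continuous[OF this] show ?thesis by simp
  qed
  also have "\<dots> = integral {a..b} (\<lambda>r. s (- \<i>) (f (Complex r L) - f (Complex r (- L))))"
    by (intro integral_cong integral_unique line_derivative_integral L f) simp
  finally show ?thesis .
qed

text \<open>The line is moved from Re z = a to Re z = L. The new side has length 2 L, the two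
  horizontal sides at most L each, and everywhere |z| \<ge> L, so each of the two groups contributes
  at most 2 C / L.\<close>

lemma line_integral_decay:
  assumes a: "a > 0" and L: "L > a"
    and f: "\<And>z. a \<le> Re z \<Longrightarrow> has_cderiv f (f' z) z"
    and f': "continuous_on {z. a \<le> Re z} f'"
    and C: "\<And>z. a \<le> Re z \<Longrightarrow> norm (f z) \<le> C / (cmod z)\<^sup>2"
  shows "norm (line_integral a L f) \<le> 4 * C / L"
proof -
  have cf: "continuous_on {z. a \<le> Re z} f"
    using has_cderiv_continuous[OF f] by (simp add: continuous_on_eq_continuous_within)
  have C0: "C \<ge> 0"
    using C[of "of_real a"] a by (smt (verit) Re_complex_of_real divide_neg_pos norm_ge_zero norm_of_real zero_less_power2)
  have le: "norm (f z) \<le> C / L\<^sup>2" if "a \<le> Re z" "L \<le> cmod z" for z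
  proof -
    have "0 < cmod z" using that a L by linarith
    then have "C / (cmod z)\<^sup>2 \<le> C / L\<^sup>2"
      using that a L C0 by (intro divide_left_mono power_mono) auto
    then show ?thesis using C[OF that(1)] by simp
  qed
  have "norm (line_integral L L f) \<le> integral {-L..L} (\<lambda>\<tau>. C / L\<^sup>2)"
    unfolding line_integral_def
  proof (rule integral_norm_bound_integral)
    show "(\<lambda>\<tau>. f (Complex L \<tau>)) integrable_on {- L..L}"
      by (intro integrable_continuous_real continuous_on_compose2[OF cf] continuous_intros) (use L in auto)
    fix \<tau> show "norm (f (Complex L \<tau>)) \<le> C / L\<^sup>2"
      using L a abs_Re_le_cmod[of "Complex L \<tau>"] by (intro le) auto
  qed auto
  also have "\<dots> = 2 * C / L" using a L by (simp add: field_simps power2_eq_square)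
  finally have 1: "norm (line_integral L L f) \<le> 2 * C / L" .
  have "norm (integral {a..L} (\<lambda>r. s (- \<i>) (f (Complex r L) - f (Complex r (- L))))) \<le> integral {a..L} (\<lambda>r. 2 * C / L\<^sup>2)"
  proof (rule integral_norm_bound_integral)
    show "(\<lambda>r. s (- \<i>) (f (Complex r L) - f (Complex r (- L)))) integrable_on {a..L}"
      by (intro integrable_continuous_real s.continuous_on continuous_intros continuous_on_compose2[OF cf]) auto
    fix r assume "r \<in> {a..L}"
    then have "norm (f (Complex r L)) \<le> C / L\<^sup>2" "norm (f (Complex r (- L))) \<le> C / L\<^sup>2"
      using L a abs_Im_le_cmod[of "Complex r L"] abs_Im_le_cmod[of "Complex r (- L)"] by (auto intro!: le)
    then show "norm (s (- \<i>) (f (Complex r L) - f (Complex r (- L)))) \<le> 2 * C / L\<^sup>2"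
      using norm_triangle_ineq4[of "f (Complex r L)" "f (Complex r (- L))"] by (simp add: norm_s)
  qed auto
  also have "\<dots> \<le> L * (2 * C / L\<^sup>2)"
    using a L C0 mult_nonneg_nonneg[of a C] by (simp add: divide_simps, simp add: algebra_simps)
  also have "\<dots> = 2 * C / L" using a L by (simp add: field_simps power2_eq_square)
  finally have 2: "norm (integral {a..L} (\<lambda>r. s (- \<i>) (f (Complex r L) - f (Complex r (- L))))) \<le> 2 * C / L" .
  have "line_integral a L f = line_integral L L f - integral {a..L} (\<lambda>r. s (- \<i>) (f (Complex r L) - f (Complex r (- L))))"
    using line_integral_rectangle[OF _ _ f f', of L L] L a by (simp add: algebra_simps)
  then show ?thesis
    using 1 2 norm_triangle_ineq4[of "line_integral L L f" "integral {a..L} (\<lambda>r. s (- \<i>) (f (Complex r L) - f (Complex r (- L))))"]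
    by simp
qed

end

section \<open>Inverse Laplace transforms of negative powers\<close>

interpretation complex: complex_banach "(*) :: complex \<Rightarrow> complex \<Rightarrow> complex"
  rewrites "complex.has_cderiv f f' z \<longleftrightarrow> (f has_field_derivative f') (at z)"
proof -
  show *: "complex_banach ((*) :: complex \<Rightarrow> complex \<Rightarrow> complex)"
    by standard (simp add: normed_space_over_def algebra_simps norm_mult scaleR_conv_of_real)
  show "complex_banach.has_cderiv (*) f f' z \<longleftrightarrow> (f has_field_derivative f') (at z)"
    unfolding complex_banach.has_cderiv_def[OF *] has_field_derivative_def
    by (rule arg_cong[of _ _ "\<lambda>F. (f has_derivative F) (at z)"]) (simp add: fun_eq_iff)
qed

text \<open>For v \<le> 0 the exponential is bounded by 1 on the right half plane, so the contour is
  closed to the right, away from the pole; the surplus n - 2 powers of 1/|z| are estimated by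
  1/a.\<close>

lemma inverse_laplace_power_neg:
  assumes a: "a > 0" and n: "n \<ge> 2" and L: "L > a" and v: "v \<le> 0"
  shows "cmod (complex.line_integral a L (\<lambda>z. exp (z * of_real v) / z ^ n)) \<le> 4 * (1 / a ^ (n - 2)) / L"
proof (rule complex.line_integral_decay[OF a L])
  fix z assume z: "a \<le> Re z"
  then have z0: "z \<noteq> 0" using a by auto
  show "((\<lambda>z. exp (z * of_real v) / z ^ n) has_field_derivative
    (of_real v * exp (z * of_real v) / z ^ n - of_nat n * exp (z * of_real v) / z ^ Suc n)) (at z)"
    using z0 n by (auto intro!: derivative_eq_intros simp: field_simps power_Suc[symmetric] simp del: power_Suc)
      (simp add: algebra_simps power_eq_if power_add[symmetric])
  have za: "a \<le> cmod z" using z complex_Re_le_cmod[of z] by linarith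
  have "cmod (exp (z * of_real v) / z ^ n) = exp (Re z * v) / (cmod z ^ (n - 2) * (cmod z)\<^sup>2)"
  proof -
    have "cmod z ^ n = cmod z ^ (n - 2) * (cmod z)\<^sup>2"
      using n by (simp only: power_add[symmetric] le_add_diff_inverse2)
    then show ?thesis by (simp add: norm_divide norm_power)
  qed
  also have "\<dots> \<le> 1 / (a ^ (n - 2) * (cmod z)\<^sup>2)"
    using a z z0 v za by (intro frac_le mult_mono power_mono) (auto simp: mult_nonneg_nonpos)
  finally show "cmod (exp (z * of_real v) / z ^ n) \<le> 1 / a ^ (n - 2) / (cmod z)\<^sup>2" by simp
next
  show "continuous_on {z. a \<le> Re z} (\<lambda>z. of_real v * exp (z * of_real v) / z ^ n - of_nat n * exp (z * of_real v) / z ^ Suc n)"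
    using a by (intro continuous_intros) auto
qed

text \<open>For v \<ge> 0 the contour is closed to the left by a rectangle around the pole at 0,
  whose residue is v^(n-1)/(n-1)!. The three remaining sides have length at most 2 L, and the
  integrand is at most e^(a v) / L^2 on them, whence the constant 6.\<close>

lemma inverse_laplace_power_pos:
  assumes a: "a > 0" and n: "n \<ge> 2" and L: "L > a" "L \<ge> 1" and v: "0 \<le> v"
  shows "cmod (complex.line_integral a L (\<lambda>z. exp (z * of_real v) / z ^ n) - 2 * pi * (v ^ (n - 1) / fact (n - 1)))
    \<le> 6 * exp (a * v) / L"
proof -
  define f where "f = (\<lambda>z. exp (z * of_real v) / z ^ n :: complex)"
  let ?p = "rectpath (Complex (- L) (- L)) (Complex a L)"
  have L0: "L > 0" using a L by simp
  have 0: "0 \<in> box (Complex (- L) (- L)) (Complex a L)"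
    using a L by (auto simp: in_box_complex_iff)
  then have notin: "0 \<notin> path_image ?p"
    by (subst path_image_rectpath_cbox_minus_box) (use a L in auto)
  have holo: "f holomorphic_on UNIV - {0}"
    unfolding f_def by (intro holomorphic_intros) auto
  have "contour_integral ?p f = 2 * pi * \<i> * (\<Sum>p\<in>{0}. winding_number ?p p * residue f p)"
    by (rule Residue_theorem[OF _ _ _ holo]) (use notin in auto)
  also have "\<dots> = 2 * pi * \<i> * residue f 0"
    using winding_number_rectpath[OF 0] by simp
  also have "residue f 0 = (deriv ^^ (n - 1)) (\<lambda>z. exp (z * of_real v)) 0 / fact (n - 1)"
  proof -
    have "(\<lambda>z. exp (z * of_real v)) holomorphic_on UNIV" by (intro holomorphic_intros)
    then show ?thesis
      unfolding f_def using residue_holomorphic_over_power'[of UNIV "\<lambda>z. exp (z * of_real v)" "n - 1"] n by simp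
  qed
  also have "(deriv ^^ m) (\<lambda>z. exp (z * of_real v)) = (\<lambda>z. of_real v ^ m * exp (z * of_real v))" for m
  proof (induction m)
    case (Suc m)
    show ?case unfolding funpow.simps o_def Suc
      by (intro ext DERIV_imp_deriv) (auto intro!: derivative_eq_intros)
  qed simp
  finally have int: "contour_integral ?p f = 2 * pi * \<i> * (of_real v ^ (n - 1) / fact (n - 1))" by simp
  let ?b = "linepath (Complex (- L) (- L)) (Complex a (- L))" and ?r = "linepath (Complex a (- L)) (Complex a L)"
    and ?t = "linepath (Complex a L) (Complex (- L) L)" and ?l = "linepath (Complex (- L) L) (Complex (- L) (- L))"
  have img: "path_image ?p = path_image ?b \<union> path_image ?r \<union> path_image ?t \<union> path_image ?l"
    unfolding rectpath_def Let_def by (simp add: path_image_join Un_assoc)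
  have ci: "f contour_integrable_on linepath p q" if "path_image (linepath p q) \<subseteq> path_image ?p" for p q
  proof (rule contour_integrable_continuous_linepath)
    show "continuous_on (closed_segment p q) f"
      using that notin by (intro holomorphic_on_imp_continuous_on holomorphic_on_subset[OF holo]) auto
  qed
  have "contour_integral ?p f = contour_integral ?b f + (contour_integral ?r f + (contour_integral ?t f + contour_integral ?l f))"
  proof -
    have "f contour_integrable_on ?b" "f contour_integrable_on ?r" "f contour_integrable_on ?t" "f contour_integrable_on ?l"
      by (rule ci, use img in blast)+
    then show ?thesis
      unfolding rectpath_def Let_def by (simp add: contour_integrable_joinI valid_path_join)
  qed
  moreover have "contour_integral ?r f = \<i> * complex.line_integral a L f"
    unfolding complex.line_integral_def using L0 by (intro contour_integral_linepath_same_Re) auto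
  ultimately have eq: "\<i> * (complex.line_integral a L f - 2 * pi * (of_real v ^ (n - 1) / fact (n - 1))) =
      - (contour_integral ?b f + contour_integral ?t f + contour_integral ?l f)"
    using int by (simp add: algebra_simps)
  have bd: "cmod (f z) \<le> exp (a * v) / L\<^sup>2" if "Re z \<le> a" "L \<le> cmod z" for z
  proof -
    have "cmod (f z) = exp (Re z * v) / cmod z ^ n" by (simp add: f_def norm_divide norm_power)
    also have "\<dots> \<le> exp (a * v) / L\<^sup>2"
    proof (rule frac_le)
      show "exp (Re z * v) \<le> exp (a * v)" using that v by (simp add: mult_right_mono)
      have "L ^ 2 \<le> L ^ n" using L n by (intro power_increasing) auto
      also have "\<dots> \<le> cmod z ^ n" using L0 that by (intro power_mono) auto
      finally show "L\<^sup>2 \<le> cmod z ^ n" .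
    qed (use L0 in auto)
    finally show ?thesis .
  qed
  have seg: "cmod (contour_integral (linepath p q) f) \<le> exp (a * v) / L\<^sup>2 * (2 * L)"
    if "path_image (linepath p q) \<subseteq> path_image ?p" "\<And>z. z \<in> closed_segment p q \<Longrightarrow> Re z \<le> a \<and> L \<le> cmod z" "cmod (q - p) \<le> 2 * L" for p q
  proof -
    have "cmod (contour_integral (linepath p q) f) \<le> exp (a * v) / L\<^sup>2 * cmod (q - p)"
      using has_contour_integral_bound_linepath[OF has_contour_integral_integral[OF ci[OF that(1)]], of "exp (a * v) / L\<^sup>2"] bd that(2) by auto
    also have "\<dots> \<le> exp (a * v) / L\<^sup>2 * (2 * L)"
      using that(3) by (intro mult_left_mono) auto
    finally show ?thesis .
  qed
  have b: "cmod (contour_integral ?b f) \<le> exp (a * v) / L\<^sup>2 * (2 * L)"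
  proof (rule seg)
    fix z assume "z \<in> closed_segment (Complex (- L) (- L)) (Complex a (- L))"
    then have "Im z = - L" "Re z \<le> a" using a L0
      by (auto simp: closed_segment_same_Im closed_segment_eq_real_ivl)
    then show "Re z \<le> a \<and> L \<le> cmod z" using abs_Im_le_cmod[of z] L0 by auto
  next
    have "Complex a (- L) - Complex (- L) (- L) = of_real (a + L)" by (simp add: complex_eq_iff)
    then show "cmod (Complex a (- L) - Complex (- L) (- L)) \<le> 2 * L" using a L by (simp only: norm_of_real)
  qed (auto simp: img)
  have t: "cmod (contour_integral ?t f) \<le> exp (a * v) / L\<^sup>2 * (2 * L)"
  proof (rule seg)
    fix z assume "z \<in> closed_segment (Complex a L) (Complex (- L) L)"
    then have "Im z = L" "Re z \<le> a" using a L0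
      by (auto simp: closed_segment_same_Im closed_segment_eq_real_ivl)
    then show "Re z \<le> a \<and> L \<le> cmod z" using abs_Im_le_cmod[of z] L0 by auto
  next
    have "Complex (- L) L - Complex a L = - of_real (a + L)" by (simp add: complex_eq_iff)
    then show "cmod (Complex (- L) L - Complex a L) \<le> 2 * L" using a L by (simp only: norm_of_real norm_minus_cancel)
  qed (auto simp: img)
  have l: "cmod (contour_integral ?l f) \<le> exp (a * v) / L\<^sup>2 * (2 * L)"
  proof (rule seg)
    fix z assume "z \<in> closed_segment (Complex (- L) L) (Complex (- L) (- L))"
    then have "Re z = - L" 
      by (auto simp: closed_segment_same_Re)
    then show "Re z \<le> a \<and> L \<le> cmod z" using abs_Re_le_cmod[of z] L0 a by auto
  next
    have "Complex (- L) (- L) - Complex (- L) L = - (\<i> * of_real (2 * L))" by (simp add: complex_eq_iff)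
    then show "cmod (Complex (- L) (- L) - Complex (- L) L) \<le> 2 * L" using L0 by (simp only: norm_mult norm_minus_cancel norm_of_real norm_ii)
  qed (auto simp: img)
  have "cmod (complex.line_integral a L f - 2 * pi * (of_real v ^ (n - 1) / fact (n - 1))) =
    cmod (\<i> * (complex.line_integral a L f - 2 * pi * (of_real v ^ (n - 1) / fact (n - 1))))"
    by (simp add: norm_mult)
  also have "\<dots> = cmod (contour_integral ?b f + contour_integral ?t f + contour_integral ?l f)"
    unfolding eq by (simp only: norm_minus_cancel)
  also have "\<dots> \<le> 3 * (exp (a * v) / L\<^sup>2 * (2 * L))"
  proof -
    have "cmod (x + y + z) \<le> 3 * K" if "cmod x \<le> K" "cmod y \<le> K" "cmod z \<le> K" for x y z K
      using that norm_triangle_ineq[of "x + y" z] norm_triangle_ineq[of x y] by linarith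
    from this[OF b t l] show ?thesis .
  qed
  also have "\<dots> = 6 * exp (a * v) / L" using L0 by (simp add: field_simps power2_eq_square)
  finally show ?thesis by (simp add: f_def)
qed

text \<open>Riemann sums over tagged divisions are linear combinations of values in
  \<open>Z\<close>, and the integral is their limit. Applied to the closed subspace of compact
  operators and to the graph of \<open>A\<close>.\<close>

lemma integral_in_closed_subspace:
  fixes f :: "real \<Rightarrow> 'a::banach"
  assumes Z: "closed Z" "subspace Z" and f: "f integrable_on {a..b}" "\<And>x. x \<in> {a..b} \<Longrightarrow> f x \<in> Z"
  shows "integral {a..b} f \<in> Z"
proof -
  have "\<exists>y\<in>Z. dist y (integral {a..b} f) < e" if e: "e > 0" for e
  proof -
    have "(f has_integral integral {a..b} f) (cbox a b)" using f(1) by (simp add: integrable_integral)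
    then obtain \<gamma> where \<gamma>: "gauge \<gamma>"
      "\<And>\<D>. \<D> tagged_division_of (cbox a b) \<Longrightarrow> \<gamma> fine \<D> \<Longrightarrow> norm ((\<Sum>(x,k)\<in>\<D>. measure lborel k *\<^sub>R f x) - integral {a..b} f) < e"
      using e unfolding has_integral by (metis (no_types, lifting))
    obtain \<D> where \<D>: "\<D> tagged_division_of (cbox a b)" "\<gamma> fine \<D>"
      using fine_division_exists[OF \<gamma>(1), of a b] by blast
    have "(\<Sum>(x,k)\<in>\<D>. measure lborel k *\<^sub>R f x) \<in> Z"
      using Z(2) f(2) tag_in_interval[OF \<D>(1)] by (intro subspace_sum) (auto intro!: subspace_scale)
    then show ?thesis using \<gamma>(2)[OF \<D>] by (auto simp: dist_norm)
  qed
  then show ?thesis using Z(1) by (metis closed_approachable)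
qed

text \<open>Three differentiations of the convolution with t^2/2 return \<phi>. Expanding (t-s)^2 in
  powers of s leaves only products of polynomials in t with the moments \<open>m\<close>, so no
  parameter integral has to be differentiated; the terms with \<phi> cancel at the first two
  stages.\<close>

lemma inverse_convolution_square_eq_0:
  fixes \<phi> :: "real \<Rightarrow> 'a::banach"
  assumes T: "T > 0" and \<phi>: "continuous_on {0..T} \<phi>"
    and 0: "\<And>t. t \<in> {0..T} \<Longrightarrow> integral {0..t} (\<lambda>s. ((t - s)\<^sup>2 / 2) *\<^sub>R \<phi> s) = 0"
    and t: "t \<in> {0..T}"
  shows "\<phi> t = 0"
proof -
  define m where "m j t = integral {0..t} (\<lambda>s. s ^ j *\<^sub>R \<phi> s)" for j t
  have cont: "continuous_on {0..T} (\<lambda>s. s ^ j *\<^sub>R \<phi> s)" for j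
    by (intro continuous_intros \<phi>)
  have m [derivative_intros]: "(m j has_vector_derivative t ^ j *\<^sub>R \<phi> t) (at t within {0..T})" if "t \<in> {0..T}" for j t
    unfolding m_def by (rule integral_has_vector_derivative[OF cont that])
  \<comment> \<open>Derivatives are taken within \<open>{0..T}\<close>, hence one-sided at the end
    points; they are unique because every point of the interval is a limit point of it.\<close>
  have uniq: "f' = 0" if "(f has_vector_derivative f') (at t within {0..T})" "t \<in> {0..T}"
    "\<And>t. t \<in> {0..T} \<Longrightarrow> f t = 0" for f :: "real \<Rightarrow> 'a" and f' t
  proof -
    have "((\<lambda>_. 0) has_vector_derivative f') (at t within {0..T})"
      by (rule has_vector_derivative_transform[OF that(2) _ that(1)]) (simp add: that(3))
    moreover have "((\<lambda>_. 0) has_vector_derivative (0::'a)) (at t within {0..T})" by simp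
    ultimately show ?thesis
      using vector_derivative_unique_within[of t "{0..T}"] that(2) T
      by (metis atLeastAtMost_iff cbox_interval islimpt_Icc trivial_limit_within)
  qed
  have M0: "(t\<^sup>2 / 2) *\<^sub>R m 0 t - t *\<^sub>R m 1 t + (1 / 2) *\<^sub>R m 2 t = 0" if "t \<in> {0..T}" for t
  proof -
    have int: "(\<lambda>s. s ^ j *\<^sub>R \<phi> s) integrable_on {0..t}" for j
      using that by (intro integrable_continuous_real continuous_on_subset[OF cont]) auto
    have "((t\<^sup>2 / 2) *\<^sub>R m 0 t - t *\<^sub>R m 1 t + (1 / 2) *\<^sub>R m 2 t) =
      integral {0..t} (\<lambda>s. (t\<^sup>2 / 2) *\<^sub>R (s ^ 0 *\<^sub>R \<phi> s) - t *\<^sub>R (s ^ 1 *\<^sub>R \<phi> s) + (1 / 2) *\<^sub>R (s ^ 2 *\<^sub>R \<phi> s))"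
      unfolding m_def
      by (subst integral_add, (intro integrable_diff integrable_cmul int)+, subst integral_diff, (intro integrable_cmul int)+)
        (simp only: integral_cmul)
    also have "\<dots> = integral {0..t} (\<lambda>s. ((t - s)\<^sup>2 / 2) *\<^sub>R \<phi> s)"
    proof (rule integral_cong)
      fix s
      show "(t\<^sup>2 / 2) *\<^sub>R (s ^ 0 *\<^sub>R \<phi> s) - t *\<^sub>R (s ^ 1 *\<^sub>R \<phi> s) + (1 / 2) *\<^sub>R (s ^ 2 *\<^sub>R \<phi> s) = ((t - s)\<^sup>2 / 2) *\<^sub>R \<phi> s"
        by (simp add: power2_eq_square field_simps flip: scaleR_diff_left scaleR_add_left)
    qed
    finally show ?thesis using 0[OF that] by simp
  qed
  have M1: "t *\<^sub>R m 0 t - m 1 t = 0" if "t \<in> {0..T}" for t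
  proof -
    have "((\<lambda>t. (t\<^sup>2 / 2) *\<^sub>R m 0 t - t *\<^sub>R m 1 t + (1 / 2) *\<^sub>R m 2 t) has_vector_derivative
      ((t\<^sup>2 / 2) *\<^sub>R (t ^ 0 *\<^sub>R \<phi> t) + t *\<^sub>R m 0 t) - (t *\<^sub>R (t ^ 1 *\<^sub>R \<phi> t) + 1 *\<^sub>R m 1 t)
       + (1 / 2) *\<^sub>R (t ^ 2 *\<^sub>R \<phi> t)) (at t within {0..T})"
      using that by (intro has_vector_derivative_add has_vector_derivative_diff has_vector_derivative_scaleR m
          has_vector_derivative_const[THEN has_vector_derivative_eq_rhs] bounded_linear.has_vector_derivative[OF bounded_linear_scaleR_right])
        (auto intro!: derivative_eq_intros)
    from uniq[OF this that M0] show ?thesis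
      by (simp add: power2_eq_square algebra_simps flip: scaleR_add_left)
  qed
  have M2: "m 0 t = 0" if "t \<in> {0..T}" for t
  proof -
    have "((\<lambda>t. t *\<^sub>R m 0 t - m 1 t) has_vector_derivative
      ((t *\<^sub>R (t ^ 0 *\<^sub>R \<phi> t) + 1 *\<^sub>R m 0 t) - (t ^ 1 *\<^sub>R \<phi> t))) (at t within {0..T})"
      using that by (intro has_vector_derivative_diff has_vector_derivative_scaleR m) (auto intro!: derivative_eq_intros)
    from uniq[OF this that M1] show ?thesis by simp
  qed
  show ?thesis using uniq[OF m[OF t, of 0] t M2] by simp
qed

text \<open>Elements of \<open>'e \<Rightarrow>\<^sub>L 'e\<close> are only real linear, so the
  scalar acts after \<open>X\<close>. With this multiplication the operators form a complex Banach
  space themselves, and the line integrals above apply to operator-valued functions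
  unchanged.\<close>

definition op_scale :: "(complex \<Rightarrow> 'e \<Rightarrow> 'e) \<Rightarrow> complex \<Rightarrow> ('e::banach \<Rightarrow>\<^sub>L 'e) \<Rightarrow> ('e \<Rightarrow>\<^sub>L 'e)" where
  "op_scale s c X = Blinfun (\<lambda>x. s c (X x))"

context complex_banach
begin

lemma op_scale_apply [simp]: "op_scale s c X x = s c (X x)"
  unfolding op_scale_def by (subst bounded_linear_Blinfun_apply)
    (auto intro: bounded_linear_compose[OF s.bounded_linear_right] blinfun.bounded_linear_right)

lemma op_space: "complex_banach (op_scale s)"
proof
  have le: "norm (op_scale s c X) \<le> cmod c * norm X" for c X
    by (rule norm_blinfun_bound) (auto simp: norm_s mult.assoc intro!: mult_left_mono norm_blinfun)
  have mult: "op_scale s c (op_scale s d X) = op_scale s (c * d) X" for c d X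
    by (rule blinfun_eqI) (simp add: s_mult)
  have real: "op_scale s (complex_of_real r) X = r *\<^sub>R X" for r X
    by (rule blinfun_eqI) (simp add: s_of_real blinfun.scaleR_left)
  have "norm (op_scale s c X) = cmod c * norm X" for c X
  proof (cases "c = 0")
    case True
    then show ?thesis using real[of 0 X] by simp
  next
    case False
    have "norm X \<le> cmod (inverse c) * norm (op_scale s c X)"
      using le[of "inverse c" "op_scale s c X"] False real[of 1 X] by (simp add: mult)
    then have "cmod c * norm X \<le> norm (op_scale s c X)"
      using False by (simp add: norm_inverse norm_divide field_simps)
    with le[of c X] show ?thesis by simp
  qed
  then show "normed_space_over UNIV (op_scale s)"
    unfolding normed_space_over_def using mult real
    by (auto intro!: blinfun_eqI simp: s_add_left s_add_right blinfun.add_left)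
qed

lemma has_cderiv_chain:
  assumes "(c has_field_derivative c') (at z)" "has_cderiv f f' (c z)"
  shows "has_cderiv (\<lambda>z. f (c z)) (s c' f') z"
proof -
  have "(f has_derivative (\<lambda>h. s h f')) (at (c z) within range c)"
    using assms(2) unfolding has_cderiv_def by (rule has_derivative_at_withinI)
  from has_derivative_in_compose[OF assms(1)[unfolded has_field_derivative_def] this]
  show ?thesis unfolding has_cderiv_def by (simp add: s_mult mult.commute)
qed

end

lemma (in complex_banach) has_cderiv_apply:
  assumes "complex_banach.has_cderiv (op_scale s) X X' z"
  shows "has_cderiv (\<lambda>z. X z x) (X' x) z"
  using bounded_linear.has_derivative[OF blinfun.bounded_linear_left, of X "\<lambda>h. op_scale s h X'" "at z" x] assms
  by (simp add: has_cderiv_def complex_banach.has_cderiv_def[OF op_space])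

section \<open>Inverse Laplace transform along a vertical line\<close>

lemma DERIV_inverse_power:
  fixes z :: "'a::real_normed_field"
  assumes "z \<noteq> 0"
  shows "((\<lambda>z. 1 / z ^ j) has_field_derivative - of_nat j / z ^ Suc j) (at z)"
proof -
  have "((\<lambda>z. inverse z ^ j) has_field_derivative of_nat j * (- (inverse z ^ Suc (Suc 0)) * inverse z ^ (j - Suc 0))) (at z)"
    by (rule DERIV_power[OF DERIV_inverse[OF assms]])
  moreover have "(\<lambda>z::'a. 1 / z ^ j) = (\<lambda>z. inverse z ^ j)"
    by (simp add: power_inverse divide_inverse)
  moreover have "of_nat j * (- (inverse z ^ Suc (Suc 0)) * inverse z ^ (j - Suc 0)) = - of_nat j / z ^ Suc j"
    by (cases j) (simp_all add: divide_inverse power_inverse algebra_simps)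
  ultimately show ?thesis by simp
qed

text \<open>The abstract setting of the inversion: estimates on a closed half plane only, so that
  contours are moved to the right and never to the left. Resolvents enter later, as the source of
  one such symbol.\<close>

locale half_plane_symbol = complex_banach s + op: complex_banach "op_scale s"
  for s :: "complex \<Rightarrow> 'e \<Rightarrow> 'e::banach" +
  fixes H H' :: "complex \<Rightarrow> 'e \<Rightarrow>\<^sub>L 'e" and a C :: real
  assumes a: "a > 0"
    and H: "\<And>z. a \<le> Re z \<Longrightarrow> op.has_cderiv H (H' z) z"
    and H'_cont: "continuous_on {z. a \<le> Re z} H'"
    and H_bound: "\<And>z. a \<le> Re z \<Longrightarrow> norm (H z) \<le> C / cmod z"
    and H'_bound: "\<And>z. a \<le> Re z \<Longrightarrow> norm (H' z) \<le> C / (cmod z)\<^sup>2"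
begin

lemma C_nonneg: "C \<ge> 0"
  using H_bound[of "of_real a"] a
  by (smt (verit) Re_complex_of_real divide_neg_pos norm_ge_zero norm_of_real)

lemma cmod_ge: "a \<le> Re z \<Longrightarrow> a \<le> cmod z"
  using complex_Re_le_cmod[of z] by linarith

lemma H_apply: "a \<le> Re z \<Longrightarrow> has_cderiv (\<lambda>z. H z x) (H' z x) z"
  by (rule has_cderiv_apply[OF H])

lemma H_cont: "continuous_on {z. a \<le> Re z} H"
  using op.has_cderiv_continuous[OF H] by (simp add: continuous_on_eq_continuous_within)

lemma continuous_on_half_plane:
  "continuous_on {z. a \<le> Re z} f \<Longrightarrow> continuous_on S (\<lambda>\<tau>. f (Complex a \<tau>))"
  by (rule continuous_on_compose2) (auto intro: continuous_intros)

text \<open>The limit is \<open>-(1/2\<pi>i) \<integral> e\<^sup>z\<^sup>t H'(z) dz\<close> along \<open>Re z = a\<close>. Since \<open>-H'\<close> is the Laplace transform of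
  \<open>t G(t)\<close> if \<open>H\<close> is that of \<open>G\<close>, it should be \<open>t G(t)\<close>; unlike the integral of \<open>e\<^sup>z\<^sup>t H(z)\<close>, it
  converges absolutely.\<close>

definition inverse_approx :: "real \<Rightarrow> real \<Rightarrow> 'e \<Rightarrow>\<^sub>L 'e" where
  "inverse_approx L t = (- 1 / (2 * pi)) *\<^sub>R op.line_integral a L (\<lambda>z. op_scale s (exp (z * of_real t)) (H' z))"

definition inverse_transform :: "real \<Rightarrow> 'e \<Rightarrow>\<^sub>L 'e" where
  "inverse_transform t = lim (\<lambda>n. inverse_approx (real n) t)"

lemma inverse_integrand_cont:
  "continuous_on S (\<lambda>\<tau>. op_scale s (exp (Complex a \<tau> * of_real t)) (H' (Complex a \<tau>)))"
  by (intro op.s.continuous_on continuous_on_half_plane[OF H'_cont] continuous_intros)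

lemma inverse_approx_continuous: "continuous_on {0..T} (inverse_approx L)"
proof -
  have "continuous_on ({0..T} \<times> cbox (-L) L) (\<lambda>(t, \<tau>). op_scale s (exp (Complex a \<tau> * of_real t)) (H' (Complex a \<tau>)))"
    unfolding split_beta
    by (intro op.s.continuous_on continuous_on_compose2[OF H'_cont] continuous_intros) auto
  then have "continuous_on {0..T} (\<lambda>t. integral (cbox (-L) L) (\<lambda>\<tau>. op_scale s (exp (Complex a \<tau> * of_real t)) (H' (Complex a \<tau>))))"
    by (rule integral_continuous_on_param)
  then show ?thesis
    unfolding inverse_approx_def op.line_integral_def by (intro continuous_intros) simp
qed

text \<open>Beyond height L the integrand is at most e^(a T) C / \<tau>^2, and each of the two tails
  of 1/\<tau>^2 has mass at most 1/L.\<close>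

lemma line_integral_Cauchy:
  assumes "0 < L" "L \<le> L'" "0 \<le> t" "t \<le> T"
  shows "norm (op.line_integral a L' (\<lambda>z. op_scale s (exp (z * of_real t)) (H' z)) -
    op.line_integral a L (\<lambda>z. op_scale s (exp (z * of_real t)) (H' z))) \<le> 2 * exp (a * T) * C / L"
proof -
  let ?f = "\<lambda>\<tau>. op_scale s (exp (Complex a \<tau> * of_real t)) (H' (Complex a \<tau>))"
  have int: "?f integrable_on {x..y}" for x y
    by (intro integrable_continuous_real inverse_integrand_cont)
  have bound: "norm (?f \<tau>) \<le> exp (a * T) * C * (1 / \<tau>\<^sup>2)" if "\<tau> \<noteq> 0" for \<tau>
  proof -
    have "norm (?f \<tau>) = exp (a * t) * norm (H' (Complex a \<tau>))" by (simp add: op.norm_s)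
    also have "\<dots> \<le> exp (a * T) * (C / (cmod (Complex a \<tau>))\<^sup>2)"
      using assms a by (intro mult_mono H'_bound) (auto simp: mult_left_mono)
    also have "C / (cmod (Complex a \<tau>))\<^sup>2 \<le> C / \<tau>\<^sup>2"
      using that C_nonneg by (intro divide_left_mono) (auto simp: cmod_power2 intro!: mult_pos_pos add_nonneg_pos)
    finally show ?thesis by (simp add: mult_left_mono)
  qed
  have F: "((\<lambda>\<tau>. 1 / \<tau>\<^sup>2) has_integral (- 1 / y - (- 1 / x))) {x..y}" if "x \<le> y" "0 < x \<or> y < 0" for x y :: real
    using that by (intro fundamental_theorem_of_calculus)
      (auto intro!: derivative_eq_intros simp: power2_eq_square simp flip: has_real_derivative_iff_has_vector_derivative)
  have bd: "norm (integral {x..y} ?f) \<le> exp (a * T) * C * (1 / x - 1 / y)" if "x \<le> y" "0 < x \<or> y < 0" for x y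
  proof -
    have "norm (integral {x..y} ?f) \<le> integral {x..y} (\<lambda>\<tau>. exp (a * T) * C * (1 / \<tau>\<^sup>2))"
      using that by (intro integral_norm_bound_integral int bound integrable_on_mult_right has_integral_integrable[OF F[OF that]]) auto
    also have "\<dots> = exp (a * T) * C * (1 / x - 1 / y)"
      using integral_unique[OF has_integral_mult_right[OF F[OF that], of "exp (a * T) * C"]] by simp
    finally show ?thesis .
  qed
  have "integral {-L'..L'} ?f = integral {-L'..-L} ?f + integral {-L..L} ?f + integral {L..L'} ?f"
  proof -
    have "integral {-L'..-L} ?f + integral {-L..L'} ?f = integral {-L'..L'} ?f"
      by (rule Henstock_Kurzweil_Integration.integral_combine) (use assms in \<open>auto intro: int\<close>)
    moreover have "integral {-L..L} ?f + integral {L..L'} ?f = integral {-L..L'} ?f"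
      by (rule Henstock_Kurzweil_Integration.integral_combine) (use assms in \<open>auto intro: int\<close>)
    ultimately show ?thesis by (simp add: add.assoc)
  qed
  then have "norm (integral {-L'..L'} ?f - integral {-L..L} ?f) \<le> norm (integral {-L'..-L} ?f) + norm (integral {L..L'} ?f)"
    by (simp add: norm_triangle_ineq)
  also have "\<dots> \<le> exp (a * T) * C * (1 / (- L') - 1 / (- L)) + exp (a * T) * C * (1 / L - 1 / L')"
    using assms by (intro add_mono bd) auto
  also have "\<dots> \<le> 2 * exp (a * T) * C * (1 / L - 1 / L')"
    by (simp add: algebra_simps)
  also have "\<dots> \<le> 2 * exp (a * T) * C * (1 / L)"
    using assms C_nonneg by (intro mult_left_mono) auto
  finally show ?thesis by (simp add: op.line_integral_def)
qed

text \<open>Uniformity on bounded time intervals transfers norm continuity to the limit; the limit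
  itself is defined pointwise in t and hence independent of T.\<close>

lemma inverse_approx_uniform:
  "uniform_limit {0..T} (\<lambda>n t. inverse_approx (real n) t) inverse_transform sequentially"
proof -
  have "uniformly_convergent_on {0..T} (\<lambda>n t. inverse_approx (real n) t)"
  proof (rule Cauchy_uniformly_convergent, rule uniformly_Cauchy_onI)
    fix e :: real assume e: "e > 0"
    define B where "B = 2 * exp (a * T) * C + 1"
    have B: "B > 0" using C_nonneg by (auto simp: B_def intro!: add_nonneg_pos)
    obtain N where N: "real N > B / e" "N > 0" using reals_Archimedean2[of "max 0 (B / e)"]
      by (metis max_less_iff_conj of_nat_0_less_iff)
    have le: "norm (inverse_approx (real n) t - inverse_approx (real m) t) < e"
      if "N \<le> m" "m \<le> n" "t \<in> {0..T}" for m n t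
    proof -
      have "norm (inverse_approx (real n) t - inverse_approx (real m) t) =
        1 / (2 * pi) * norm (op.line_integral a n (\<lambda>z. op_scale s (exp (z * of_real t)) (H' z)) -
          op.line_integral a m (\<lambda>z. op_scale s (exp (z * of_real t)) (H' z)))"
        unfolding inverse_approx_def scaleR_diff_right[symmetric] by simp
      also have "\<dots> \<le> 1 * (2 * exp (a * T) * C / m)"
        using that N pi_ge_two by (intro mult_mono line_integral_Cauchy) (auto simp: field_simps)
      also have "\<dots> \<le> B / N" using that N B C_nonneg by (auto simp: B_def intro!: frac_le)
      also have "\<dots> < e" using N e by (simp add: field_simps)
      finally show ?thesis .
    qed
    show "\<exists>M. \<forall>x\<in>{0..T}. \<forall>m\<ge>M. \<forall>n\<ge>M. dist (inverse_approx (real m) x) (inverse_approx (real n) x) < e"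
    proof (intro exI ballI allI impI)
      fix t m n assume "t \<in> {0..T}" "N \<le> m" "N \<le> n"
      then show "dist (inverse_approx (real m) t) (inverse_approx (real n) t) < e"
        using le[of m n t] le[of n m t] by (cases "m \<le> n") (auto simp: dist_norm norm_minus_commute)
    qed
  qed
  then show ?thesis
    unfolding uniformly_convergent_uniform_limit_iff inverse_transform_def[abs_def] .
qed

lemma inverse_transform_continuous: "continuous_on {0..T} inverse_transform"
  by (rule uniform_limit_theorem[OF _ inverse_approx_uniform]) (auto intro: always_eventually inverse_approx_continuous)

text \<open>Meant for \<open>Z\<close> the compact operators: the line integrals stay in
  \<open>Z\<close>, and their convergence in norm keeps the limit inside.\<close>

lemma inverse_transform_in_closed_subspace:
  assumes Z: "closed Z" "subspace Z" "\<And>c X. X \<in> Z \<Longrightarrow> op_scale s c X \<in> Z" "\<And>z. a \<le> Re z \<Longrightarrow> H' z \<in> Z"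
    and t: "t \<ge> 0"
  shows "inverse_transform t \<in> Z"
proof (rule closed_sequentially[OF Z(1)])
  show "inverse_approx (real n) t \<in> Z" for n
    unfolding inverse_approx_def op.line_integral_def
    by (intro subspace_scale Z integral_in_closed_subspace integrable_continuous_real inverse_integrand_cont) auto
  show "(\<lambda>n. inverse_approx (real n) t) \<longlonglongrightarrow> inverse_transform t"
    using tendsto_uniform_limitI[OF inverse_approx_uniform[of t], of t] t by simp
qed

lemma line_integral_by_parts:
  assumes w: "\<And>z. a \<le> Re z \<Longrightarrow> (w has_field_derivative w' z) (at z)" "continuous_on {z. a \<le> Re z} w'" and L: "L \<ge> 0"
  shows "line_integral a L (\<lambda>z. s (w z) (H' z x)) =
    s (- \<i>) (s (w (Complex a L)) (H (Complex a L) x) - s (w (Complex a (- L))) (H (Complex a (- L)) x))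
     - line_integral a L (\<lambda>z. s (w' z) (H z x))"
proof -
  have cw: "continuous_on {z. a \<le> Re z} w"
    using DERIV_continuous[OF w(1)] by (auto simp: continuous_on_eq_continuous_within continuous_at_imp_continuous_at_within)
  have "((\<lambda>\<tau>. s (w' (Complex a \<tau>)) (H (Complex a \<tau>) x) + s (w (Complex a \<tau>)) (H' (Complex a \<tau>) x)) has_integral
    s (- \<i>) (s (w (Complex a L)) (H (Complex a L) x) - s (w (Complex a (- L))) (H (Complex a (- L)) x))) {-L..L}"
    by (rule line_derivative_integral[OF L, where f = "\<lambda>z. s (w z) (H z x)" and f' = "\<lambda>z. s (w' z) (H z x) + s (w z) (H' z x)"])
      (intro has_cderiv_scale w H_apply, auto)
  moreover have "integral {-L..L} (\<lambda>\<tau>. s (w' (Complex a \<tau>)) (H (Complex a \<tau>) x) + s (w (Complex a \<tau>)) (H' (Complex a \<tau>) x)) =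
    line_integral a L (\<lambda>z. s (w' z) (H z x)) + line_integral a L (\<lambda>z. s (w z) (H' z x))"
    unfolding line_integral_def
    by (intro integral_add integrable_continuous_real s.continuous_on continuous_on_half_plane w cw blinfun.continuous_on H_cont H'_cont continuous_intros)
  ultimately show ?thesis by (simp add: has_integral_iff algebra_simps)
qed

text \<open>Covers the boundary values of an integration by parts at height L, where
  \<open>H\<close> is of size C / L and \<open>w\<close> has only to be bounded on the line Re z =
  a.\<close>

lemma boundary_term:
  assumes w: "\<And>z. a \<le> Re z \<Longrightarrow> Re z \<le> a \<Longrightarrow> cmod (w z) \<le> K" and L: "L > 0"
  shows "norm (s (- \<i>) (s (w (Complex a L)) (H (Complex a L) x) - s (w (Complex a (- L))) (H (Complex a (- L)) x)))
    \<le> 2 * K * C * norm x / L"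
proof -
  have K: "K \<ge> 0" using w[of "of_real a"] norm_ge_zero[of "w (of_real a)"] by (simp del: norm_ge_zero)
  have 1: "norm (s (w z) (H z x)) \<le> K * C * norm x / L" if "Re z = a" "cmod z \<ge> L" for z
  proof -
    have "norm (H z x) \<le> C / cmod z * norm x"
      using norm_blinfun[of "H z" x] H_bound[of z] that by (meson mult_right_mono norm_ge_zero order_refl order_trans)
    also have "C / cmod z \<le> C / L" using that L C_nonneg by (intro divide_left_mono mult_pos_pos) linarith+
    finally have "norm (H z x) \<le> C / L * norm x" by (simp add: mult_right_mono)
    then have "norm (s (w z) (H z x)) \<le> K * (C / L * norm x)"
      unfolding norm_s using w[of z] that K by (intro mult_mono) auto
    then show ?thesis by simp
  qed
  have "norm (s (- \<i>) (s (w (Complex a L)) (H (Complex a L) x) - s (w (Complex a (- L))) (H (Complex a (- L)) x)))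
    \<le> norm (s (w (Complex a L)) (H (Complex a L) x)) + norm (s (w (Complex a (- L))) (H (Complex a (- L)) x))"
  proof -
    have "norm (s (- \<i>) (p - q)) \<le> norm p + norm q" for p q
      using norm_triangle_ineq4[of p q] by (simp add: norm_s)
    then show ?thesis .
  qed
  also have "\<dots> \<le> K * C * norm x / L + K * C * norm x / L"
    using L abs_Im_le_cmod[of "Complex a L"] abs_Im_le_cmod[of "Complex a (- L)"] by (intro add_mono 1) auto
  finally show ?thesis by (simp add: mult_ac)
qed

text \<open>\<open>H'\<close> is exchanged for \<open>H\<close> by parts: the boundary values are
  O(1/L), and the remaining integrand is O(|z|^-(j+2)), so its line can be moved to infinity. Such
  integrals arise as polynomial terms when the inversion integral is convolved with t^2/2.\<close>

lemma line_integral_inverse_power_H':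
  assumes j: "j \<ge> 1"
  shows "((\<lambda>n. line_integral a (real n) (\<lambda>z. s (1 / z ^ j) (H' z x))) \<longlongrightarrow> 0) sequentially"
proof -
  \<comment> \<open>The first summand belongs to the boundary values, the second to the shifted line
    integral.\<close>
  define K where "K = 2 * (1 / a ^ j) * C * norm x + 4 * (real j * C * norm x / a ^ j)"
  have "norm (line_integral a L (\<lambda>z. s (1 / z ^ j) (H' z x))) \<le> K / L" if L: "L > a" for L
  proof -
    have z0: "z \<noteq> 0" if "a \<le> Re z" for z :: complex using that a by auto
    have w: "((\<lambda>z. 1 / z ^ j) has_field_derivative - of_nat j / z ^ Suc j) (at z)" if "a \<le> Re z" for z :: complex
      by (rule DERIV_inverse_power[OF z0[OF that]])
    have w': "((\<lambda>z. - of_nat j / z ^ Suc j) has_field_derivative of_nat j * of_nat (Suc j) / z ^ Suc (Suc j)) (at z)" if "a \<le> Re z" for z :: complex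
    proof -
      have "((\<lambda>z. - of_nat j * (1 / z ^ Suc j)) has_field_derivative - of_nat j * (- of_nat (Suc j) / z ^ Suc (Suc j))) (at z)"
        by (rule DERIV_cmult[OF DERIV_inverse_power[OF z0[OF that]]])
      moreover have "- of_nat j * (- of_nat (Suc j) / z ^ Suc (Suc j)) = of_nat j * of_nat (Suc j) / z ^ Suc (Suc j)"
        by (simp only: minus_mult_minus times_divide_eq_right minus_divide_left[symmetric])
      ultimately show ?thesis by simp
    qed
    have cw': "continuous_on {z. a \<le> Re z} (\<lambda>z. - of_nat j / z ^ Suc j :: complex)"
      using a by (intro continuous_intros) auto
    have 1: "norm (line_integral a L (\<lambda>z. s (- of_nat j / z ^ Suc j) (H z x))) \<le> 4 * (real j * C * norm x / a ^ j) / L"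
    proof (rule line_integral_decay[OF a L])
      fix z assume z: "a \<le> Re z"
      show "has_cderiv (\<lambda>z. s (- of_nat j / z ^ Suc j) (H z x))
        (s (of_nat j * of_nat (Suc j) / z ^ Suc (Suc j)) (H z x) + s (- of_nat j / z ^ Suc j) (H' z x)) z"
        using z by (intro has_cderiv_scale w' H_apply)
      have "norm (H z x) \<le> C / cmod z * norm x"
        using norm_blinfun[of "H z" x] H_bound[of z] z by (meson mult_right_mono norm_ge_zero order_trans)
      then have "norm (s (- of_nat j / z ^ Suc j) (H z x)) \<le> real j / cmod z ^ Suc j * (C / cmod z * norm x)"
      proof -
        have "cmod (- of_nat j / z ^ Suc j) = real j / cmod z ^ Suc j"
          by (simp add: norm_divide norm_mult norm_power)
        moreover have "real j / cmod z ^ Suc j * norm (H z x) \<le> real j / cmod z ^ Suc j * (C / cmod z * norm x)"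
          by (intro mult_left_mono \<open>norm (H z x) \<le> _\<close>) auto
        ultimately show ?thesis unfolding norm_s by simp
      qed
      also have "\<dots> = real j * C * norm x / (cmod z ^ j * (cmod z)\<^sup>2)"
        by (simp add: power2_eq_square mult_ac)
      also have "\<dots> \<le> real j * C * norm x / (a ^ j * (cmod z)\<^sup>2)"
      proof (rule divide_left_mono)
        show "a ^ j * (cmod z)\<^sup>2 \<le> cmod z ^ j * (cmod z)\<^sup>2"
          using a cmod_ge[OF z] by (intro mult_right_mono power_mono) auto
        show "0 < cmod z ^ j * (cmod z)\<^sup>2 * (a ^ j * (cmod z)\<^sup>2)"
          using a cmod_ge[OF z] by (intro mult_pos_pos zero_less_power) linarith+
      qed (use C_nonneg in auto)
      finally show "norm (s (- of_nat j / z ^ Suc j) (H z x)) \<le> real j * C * norm x / a ^ j / (cmod z)\<^sup>2" by simp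
    next
      show "continuous_on {z. a \<le> Re z} (\<lambda>z. s (of_nat j * of_nat (Suc j) / z ^ Suc (Suc j)) (H z x) + s (- of_nat j / z ^ Suc j) (H' z x))"
        using a by (intro continuous_intros s.continuous_on blinfun.continuous_on H_cont H'_cont) auto
    qed
    have 2: "norm (s (- \<i>) (s (1 / Complex a L ^ j) (H (Complex a L) x) - s (1 / Complex a (- L) ^ j) (H (Complex a (- L)) x))) \<le> 2 * (1 / a ^ j) * C * norm x / L"
    proof (rule boundary_term[where w = "\<lambda>z. 1 / z ^ j"])
      fix z assume "a \<le> Re z"
      then show "cmod (1 / z ^ j) \<le> 1 / a ^ j"
        using a cmod_ge[of z] by (auto simp: norm_divide norm_power intro!: divide_left_mono power_mono mult_pos_pos zero_less_power)
    qed (use a L in auto)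
    have "line_integral a L (\<lambda>z. s (1 / z ^ j) (H' z x)) =
      s (- \<i>) (s (1 / Complex a L ^ j) (H (Complex a L) x) - s (1 / Complex a (- L) ^ j) (H (Complex a (- L)) x))
     - line_integral a L (\<lambda>z. s (- of_nat j / z ^ Suc j) (H z x))"
      using a L by (intro line_integral_by_parts w cw') auto
    then have "norm (line_integral a L (\<lambda>z. s (1 / z ^ j) (H' z x))) \<le>
      2 * (1 / a ^ j) * C * norm x / L + 4 * (real j * C * norm x / a ^ j) / L"
      using 1 2 by (smt (verit) norm_triangle_ineq4)
    then show ?thesis by (simp add: K_def add_divide_distrib)
  qed
  note bound = this
  show ?thesis
  proof (rule Lim_null_comparison)
    show "\<forall>\<^sub>F n in sequentially. norm (line_integral a (real n) (\<lambda>z. s (1 / z ^ j) (H' z x))) \<le> K / real n"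
      using eventually_gt_at_top[of "nat \<lceil>a\<rceil>"] by eventually_elim (rule bound, linarith)
    show "(\<lambda>n. K / real n) \<longlonglongrightarrow> 0" by (rule lim_const_over_n)
  qed
qed

end

section \<open>Laplace transforms over a bounded interval\<close>

context complex_banach
begin

definition laplace_on :: "real \<Rightarrow> (real \<Rightarrow> 'e) \<Rightarrow> complex \<Rightarrow> 'e" where
  "laplace_on T g z = integral {0..T} (\<lambda>r. s (exp (- (z * of_real r))) (g r))"

text \<open>The transform over a compact interval is entire, whatever \<open>g\<close> does beyond
  T; this is what replaces an exponential bound. The linear maps in h are packed into the operators
  \<open>F\<close> because the Leibniz rule expects the derivative in that form.\<close>

lemma has_cderiv_laplace_on:
  assumes g: "continuous_on {0..T} g"
  shows "has_cderiv (laplace_on T g) (laplace_on T (\<lambda>r. (- r) *\<^sub>R g r) z) z"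
proof -
  define F where "F = (\<lambda>z r. s.prod_left (s (exp (- (z * of_real r))) ((- r) *\<^sub>R g r)))"
  have "((\<lambda>z. integral (cbox 0 T) (\<lambda>r. s (exp (- (z * of_real r))) (g r))) has_derivative
      integral (cbox 0 T) (F z)) (at z within UNIV)"
  proof (rule leibniz_rule)
    show "((\<lambda>z. s (exp (- (z * of_real r))) (g r)) has_derivative blinfun_apply (F z r)) (at z within UNIV)" for z r
    proof -
      have "((\<lambda>z. exp (- (z * of_real r))) has_field_derivative - of_real r * exp (- (z * of_real r))) (at z)"
        by (auto intro!: derivative_eq_intros)
      then have "((\<lambda>z. exp (- (z * of_real r))) has_derivative (\<lambda>h. - (h * of_real r) * exp (- (z * of_real r)))) (at z)"
        unfolding has_field_derivative_def by (rule has_derivative_eq_rhs) (simp add: fun_eq_iff)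
      from bounded_linear.has_derivative[OF s.bounded_linear_left this, of "g r"]
      have "((\<lambda>z. s (exp (- (z * of_real r))) (g r)) has_derivative (\<lambda>h. s (- (h * of_real r) * exp (- (z * of_real r))) (g r))) (at z)" .
      moreover have "(\<lambda>h. s (- (h * of_real r) * exp (- (z * of_real r))) (g r)) = blinfun_apply (F z r)"
      proof
        fix h
        have "blinfun_apply (F z r) h = s h (s (exp (- (z * of_real r))) (s (of_real (- r)) (g r)))"
          unfolding F_def s.prod_left.rep_eq s_of_real ..
        then show "s (- (h * of_real r) * exp (- (z * of_real r))) (g r) = blinfun_apply (F z r) h"
          by (simp add: s_mult mult_ac)
      qed
      ultimately show ?thesis by simp
    qed
    show "(\<lambda>r. s (exp (- (z * of_real r))) (g r)) integrable_on cbox 0 T" for z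
      using g by (intro integrable_continuous s.continuous_on continuous_intros) auto
    show "continuous_on (UNIV \<times> cbox 0 T) (\<lambda>(z, r). F z r)"
      unfolding split_beta F_def using g
      by (intro bounded_linear.continuous_on[OF s.bounded_linear_prod_left] s.continuous_on continuous_intros continuous_on_compose2[OF g]) auto
  qed auto
  moreover have "(\<lambda>h. blinfun_apply (integral (cbox 0 T) (F z)) h) = (\<lambda>h. s h (laplace_on T (\<lambda>r. (- r) *\<^sub>R g r) z))"
  proof
    fix h
    have c: "continuous_on {0..T} (\<lambda>r. s (exp (- (z * of_real r))) ((- r) *\<^sub>R g r))"
      by (intro s.continuous_on continuous_intros g)
    then have cF: "F z integrable_on cbox 0 T"
      unfolding F_def by (intro integrable_continuous bounded_linear.continuous_on[OF s.bounded_linear_prod_left]) simp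
    have "blinfun_apply (integral (cbox 0 T) (F z)) h = integral (cbox 0 T) (\<lambda>r. F z r h)"
      using integral_linear[OF cF blinfun.bounded_linear_left[of h]] by (simp add: o_def)
    also have "\<dots> = s h (integral {0..T} (\<lambda>r. s (exp (- (z * of_real r))) ((- r) *\<^sub>R g r)))"
      using integral_linear[OF integrable_continuous_real[OF c] s.bounded_linear_right[of h]]
      by (simp add: o_def F_def s.prod_left.rep_eq)
    finally show "blinfun_apply (integral (cbox 0 T) (F z)) h = s h (laplace_on T (\<lambda>r. (- r) *\<^sub>R g r) z)"
      by (simp add: laplace_on_def)
  qed
  ultimately show ?thesis
    unfolding has_cderiv_def laplace_on_def[abs_def] by simp
qed

lemma continuous_on_laplace_on: "continuous_on {0..T} g \<Longrightarrow> continuous_on S (laplace_on T g)"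
  using has_cderiv_continuous[OF has_cderiv_laplace_on] by (simp add: continuous_on_eq_continuous_within)

end

text \<open>By parts twice. The lower end point contributes the terms -1/z^3 - t/z^2 - t^2/(2z),
  which \<open>line_integral_inverse_power_H'\<close> disposes of.\<close>

lemma integral_square_exp:
  fixes z :: complex
  assumes t: "t \<ge> 0" and z: "z \<noteq> 0"
  shows "((\<lambda>r. of_real ((t - r)\<^sup>2 / 2) * exp (z * of_real r)) has_integral
    exp (z * of_real t) / z ^ 3 - 1 / z ^ 3 - of_real t / z ^ 2 - of_real (t\<^sup>2 / 2) / z) {0..t}"
proof -
  define F where "F r = exp (z * of_real r) * (of_real ((t - r)\<^sup>2 / 2) / z + of_real (t - r) / z ^ 2 + 1 / z ^ 3)" for r
  have "((\<lambda>r. of_real ((t - r)\<^sup>2 / 2) * exp (z * of_real r)) has_integral F t - F 0) {0..t}"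
  proof (rule fundamental_theorem_of_calculus[OF t])
    fix r
    have "((\<lambda>r. exp (z * r) * ((of_real t - r)\<^sup>2 / 2 / z + (of_real t - r) / z ^ 2 + 1 / z ^ 3)) has_field_derivative
       (of_real t - of_real r)\<^sup>2 / 2 * exp (z * of_real r)) (at (complex_of_real r))"
      using z by (auto intro!: derivative_eq_intros simp: field_simps power2_eq_square power3_eq_cube)
    from has_vector_derivative_real_field[OF this]
    show "(F has_vector_derivative of_real ((t - r)\<^sup>2 / 2) * exp (z * of_real r)) (at r within {0..t})"
      unfolding F_def by (simp add: has_vector_derivative_at_within)
  qed
  then show ?thesis by (simp add: F_def algebra_simps)
qed

context half_plane_symbol
begin

text \<open>Fubini on a rectangle: the convolution is carried out under the line integral, where it
  acts on the exponential alone.\<close>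

lemma inverse_approx_convolution:
  assumes t: "t \<ge> 0"
  shows "integral {0..t} (\<lambda>r. ((t - r)\<^sup>2 / 2) *\<^sub>R inverse_approx L r x) =
    (- 1 / (2 * pi)) *\<^sub>R (line_integral a L (\<lambda>z. s (exp (z * of_real t) / z ^ 3) (H' z x))
      - line_integral a L (\<lambda>z. s (1 / z ^ 3) (H' z x)) - t *\<^sub>R line_integral a L (\<lambda>z. s (1 / z ^ 2) (H' z x))
      - (t\<^sup>2 / 2) *\<^sub>R line_integral a L (\<lambda>z. s (1 / z ^ 1) (H' z x)))"
proof -
  let ?z = "\<lambda>\<tau>. Complex a \<tau>"
  have z0: "?z \<tau> \<noteq> 0" for \<tau> using a by (auto simp: complex_eq_iff)
  have app: "inverse_approx L r x = (- 1 / (2 * pi)) *\<^sub>R integral {-L..L} (\<lambda>\<tau>. s (exp (?z \<tau> * of_real r)) (H' (?z \<tau>) x))" for r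
  proof -
    have "integral {-L..L} (\<lambda>\<tau>. op_scale s (exp (?z \<tau> * of_real r)) (H' (?z \<tau>))) x =
      integral {-L..L} (\<lambda>\<tau>. op_scale s (exp (?z \<tau> * of_real r)) (H' (?z \<tau>)) x)"
      using integral_linear[OF integrable_continuous_real[OF inverse_integrand_cont] blinfun.bounded_linear_left[of x]]
      by (simp add: o_def)
    then show ?thesis
      unfolding inverse_approx_def op.line_integral_def by (simp add: blinfun.scaleR_left blinfun.minus_left)
  qed
  have "integral {0..t} (\<lambda>r. ((t - r)\<^sup>2 / 2) *\<^sub>R inverse_approx L r x) =
    (- 1 / (2 * pi)) *\<^sub>R integral {0..t} (\<lambda>r. integral {-L..L} (\<lambda>\<tau>. s (of_real ((t - r)\<^sup>2 / 2) * exp (?z \<tau> * of_real r)) (H' (?z \<tau>) x)))"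
  proof -
    have "((t - r)\<^sup>2 / 2) *\<^sub>R inverse_approx L r x =
      (- 1 / (2 * pi)) *\<^sub>R integral {-L..L} (\<lambda>\<tau>. s (of_real ((t - r)\<^sup>2 / 2) * exp (?z \<tau> * of_real r)) (H' (?z \<tau>) x))" for r
      unfolding app s_mult[symmetric] s_of_real integral_cmul by (simp add: mult.commute)
    then show ?thesis by (simp only: integral_cmul)
  qed
  also have "integral {0..t} (\<lambda>r. integral {-L..L} (\<lambda>\<tau>. s (of_real ((t - r)\<^sup>2 / 2) * exp (?z \<tau> * of_real r)) (H' (?z \<tau>) x))) =
    integral {-L..L} (\<lambda>\<tau>. integral {0..t} (\<lambda>r. s (of_real ((t - r)\<^sup>2 / 2) * exp (?z \<tau> * of_real r)) (H' (?z \<tau>) x)))"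
  proof -
    have "continuous_on (cbox (0, - L) (t, L)) (\<lambda>(r, \<tau>). s (of_real ((t - r)\<^sup>2 / 2) * exp (?z \<tau> * of_real r)) (H' (?z \<tau>) x))"
      unfolding split_beta by (intro s.continuous_on blinfun.continuous_on continuous_on_compose2[OF H'_cont] continuous_intros) auto
    from integral_swap_continuous[OF this] show ?thesis by simp
  qed
  also have "\<dots> = integral {-L..L} (\<lambda>\<tau>. s (exp (?z \<tau> * of_real t) / ?z \<tau> ^ 3) (H' (?z \<tau>) x) - s (1 / ?z \<tau> ^ 3) (H' (?z \<tau>) x)
     - t *\<^sub>R s (1 / ?z \<tau> ^ 2) (H' (?z \<tau>) x) - (t\<^sup>2 / 2) *\<^sub>R s (1 / ?z \<tau> ^ 1) (H' (?z \<tau>) x))"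
  proof (rule integral_cong)
    fix \<tau>
    have "integral {0..t} (\<lambda>r. s (of_real ((t - r)\<^sup>2 / 2) * exp (?z \<tau> * of_real r)) (H' (?z \<tau>) x)) =
      s (exp (?z \<tau> * of_real t) / ?z \<tau> ^ 3 - 1 / ?z \<tau> ^ 3 - of_real t * (1 / ?z \<tau> ^ 2) - of_real (t\<^sup>2 / 2) * (1 / ?z \<tau> ^ 1)) (H' (?z \<tau>) x)"
      using has_integral_linear[OF integral_square_exp[OF t z0] s.bounded_linear_left]
      by (intro integral_unique) (simp add: o_def)
    then show "integral {0..t} (\<lambda>r. s (of_real ((t - r)\<^sup>2 / 2) * exp (?z \<tau> * of_real r)) (H' (?z \<tau>) x)) =
      s (exp (?z \<tau> * of_real t) / ?z \<tau> ^ 3) (H' (?z \<tau>) x) - s (1 / ?z \<tau> ^ 3) (H' (?z \<tau>) x)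
     - t *\<^sub>R s (1 / ?z \<tau> ^ 2) (H' (?z \<tau>) x) - (t\<^sup>2 / 2) *\<^sub>R s (1 / ?z \<tau> ^ 1) (H' (?z \<tau>) x)"
      unfolding s.diff_left s_of_real[symmetric] s_mult .
  qed
  also have "\<dots> = line_integral a L (\<lambda>z. s (exp (z * of_real t) / z ^ 3) (H' z x))
      - line_integral a L (\<lambda>z. s (1 / z ^ 3) (H' z x)) - t *\<^sub>R line_integral a L (\<lambda>z. s (1 / z ^ 2) (H' z x))
      - (t\<^sup>2 / 2) *\<^sub>R line_integral a L (\<lambda>z. s (1 / z ^ 1) (H' z x))"
  proof -
    have i: "(\<lambda>\<tau>. s (exp (?z \<tau> * of_real t) / ?z \<tau> ^ j) (H' (?z \<tau>) x)) integrable_on {-L..L}" for t j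
      by (intro integrable_continuous_real s.continuous_on blinfun.continuous_on continuous_on_half_plane[OF H'_cont] continuous_intros)
        (use z0 in auto)
    have i0: "(\<lambda>\<tau>. s (1 / ?z \<tau> ^ j) (H' (?z \<tau>) x)) integrable_on {-L..L}" for j
      using i[of 0 j] by simp
    show ?thesis
      unfolding line_integral_def
      by (subst integral_diff; (intro integrable_diff integrable_cmul i i0)?)+ (simp only: integral_cmul)
  qed
  finally show ?thesis .
qed

text \<open>Only the term with e^(zt)/z^3 survives in the limit; uniform convergence of
  \<open>inverse_approx\<close> allows the limit under the time integral.\<close>

lemma inverse_convolution_limit:
  assumes t: "t \<ge> 0"
  shows "(\<lambda>n. (- 1 / (2 * pi)) *\<^sub>R line_integral a (real n) (\<lambda>z. s (exp (z * of_real t) / z ^ 3) (H' z x)))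
    \<longlonglongrightarrow> integral {0..t} (\<lambda>r. ((t - r)\<^sup>2 / 2) *\<^sub>R inverse_transform r x)"
proof -
  let ?P = "\<lambda>j n. line_integral a (real n) (\<lambda>z. s (1 / z ^ j) (H' z x))"
  have 1: "(\<lambda>n. integral {0..t} (\<lambda>r. ((t - r)\<^sup>2 / 2) *\<^sub>R inverse_approx (real n) r x)) \<longlonglongrightarrow>
    integral {0..t} (\<lambda>r. ((t - r)\<^sup>2 / 2) *\<^sub>R inverse_transform r x)"
  proof -
    have "uniform_limit {0..t} (\<lambda>n r. ((t - r)\<^sup>2 / 2) *\<^sub>R inverse_approx (real n) r x) (\<lambda>r. ((t - r)\<^sup>2 / 2) *\<^sub>R inverse_transform r x) sequentially"
    proof (rule bounded_bilinear.bounded_uniform_limit[OF bounded_bilinear_scaleR uniform_limit_const])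
      show "uniform_limit {0..t} (\<lambda>n r. inverse_approx (real n) r x) (\<lambda>r. inverse_transform r x) sequentially"
        by (rule bounded_linear.uniform_limit[OF blinfun.bounded_linear_left inverse_approx_uniform])
      show "bounded ((\<lambda>r. (t - r)\<^sup>2 / 2) ` {0..t})"
        by (intro compact_imp_bounded compact_continuous_image continuous_intros) auto
      show "bounded ((\<lambda>r. inverse_transform r x) ` {0..t})"
        by (intro compact_imp_bounded compact_continuous_image blinfun.continuous_on inverse_transform_continuous continuous_intros) auto
    qed
    moreover have "continuous_on {0..t} (\<lambda>r. ((t - r)\<^sup>2 / 2) *\<^sub>R inverse_approx (real n) r x)" for n
      by (intro continuous_intros blinfun.continuous_on inverse_approx_continuous) auto
    ultimately obtain I J where IJ: "\<And>n. ((\<lambda>r. ((t - r)\<^sup>2 / 2) *\<^sub>R inverse_approx (real n) r x) has_integral I n) {0..t}"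
      "((\<lambda>r. ((t - r)\<^sup>2 / 2) *\<^sub>R inverse_transform r x) has_integral J) {0..t}" "I \<longlonglongrightarrow> J"
      by (rule uniform_limit_integral) auto
    then show ?thesis by (simp only: integral_unique[OF IJ(1)] integral_unique[OF IJ(2)])
  qed
  have 2: "(\<lambda>n. (- 1 / (2 * pi)) *\<^sub>R (?P 3 n + t *\<^sub>R ?P 2 n + (t\<^sup>2 / 2) *\<^sub>R ?P 1 n)) \<longlonglongrightarrow>
    (- 1 / (2 * pi)) *\<^sub>R (0 + t *\<^sub>R 0 + (t\<^sup>2 / 2) *\<^sub>R 0)"
    by (intro tendsto_intros line_integral_inverse_power_H') auto
  have "(- 1 / (2 * pi)) *\<^sub>R line_integral a (real n) (\<lambda>z. s (exp (z * of_real t) / z ^ 3) (H' z x)) =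
    integral {0..t} (\<lambda>r. ((t - r)\<^sup>2 / 2) *\<^sub>R inverse_approx (real n) r x) +
    (- 1 / (2 * pi)) *\<^sub>R (?P 3 n + t *\<^sub>R ?P 2 n + (t\<^sup>2 / 2) *\<^sub>R ?P 1 n)" for n
    unfolding inverse_approx_convolution[OF t] by (simp only: scaleR_add_right[symmetric]) (simp add: algebra_simps)
  then show ?thesis using tendsto_add[OF 1 2] by simp
qed

end

text \<open>Convolution with \<open>t\<^sup>2/2\<close> multiplies the transform by \<open>z\<^sup>-\<^sup>3\<close>. After integration by parts, \<open>H'\<close> is
  replaced by \<open>H\<close> and \<open>e\<^sup>z\<^sup>t / z\<^sup>3\<close> by its derivative.\<close>

definition weight :: "real \<Rightarrow> complex \<Rightarrow> complex" where
  "weight t z = exp (z * of_real t) * (of_real t / z ^ 3 - 3 / z ^ 4)"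

definition weight' :: "real \<Rightarrow> complex \<Rightarrow> complex" where
  "weight' t z = exp (z * of_real t) * ((of_real t)\<^sup>2 / z ^ 3 - 6 * of_real t / z ^ 4 + 12 / z ^ 5)"

lemma DERIV_exp_over_cube:
  assumes "z \<noteq> 0"
  shows "((\<lambda>z. exp (z * of_real t) / z ^ 3) has_field_derivative weight t z) (at z)"
proof -
  have "((\<lambda>z. exp (z * of_real t) * (1 / z ^ 3)) has_field_derivative
    exp (z * of_real t) * of_real t * (1 / z ^ 3) + (- of_nat 3 / z ^ Suc 3) * exp (z * of_real t)) (at z)"
    by (intro DERIV_mult DERIV_inverse_power assms) (auto intro!: derivative_eq_intros)
  moreover have "exp (z * of_real t) * of_real t * (1 / z ^ 3) + (- of_nat 3 / z ^ Suc 3) * exp (z * of_real t) = weight t z"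
    by (simp add: weight_def algebra_simps)
  ultimately show ?thesis by simp
qed

lemma DERIV_weight:
  assumes "z \<noteq> 0"
  shows "(weight t has_field_derivative weight' t z) (at z)"
proof -
  have "((\<lambda>z. exp (z * of_real t) * (of_real t * (1 / z ^ 3) - 3 * (1 / z ^ 4))) has_field_derivative
    exp (z * of_real t) * of_real t * (of_real t * (1 / z ^ 3) - 3 * (1 / z ^ 4)) +
    (of_real t * (- of_nat 3 / z ^ Suc 3) - 3 * (- of_nat 4 / z ^ Suc 4)) * exp (z * of_real t)) (at z)"
    by (intro DERIV_mult DERIV_diff DERIV_cmult DERIV_inverse_power assms) (auto intro!: derivative_eq_intros)
  moreover have "exp (z * of_real t) * of_real t * (of_real t * (1 / z ^ 3) - 3 * (1 / z ^ 4)) +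
    (of_real t * (- of_nat 3 / z ^ Suc 3) - 3 * (- of_nat 4 / z ^ Suc 4)) * exp (z * of_real t) = weight' t z"
    by (simp add: weight'_def power2_eq_square eval_nat_numeral algebra_simps)
  ultimately show ?thesis by (simp add: weight_def[abs_def])
qed

text \<open>Of the four powers of 1/|z| in the second term one is given up for 1/a, so that both
  terms have order |z|^-3.\<close>

lemma norm_weight_le:
  assumes "a > 0" "a \<le> Re z" "t \<ge> 0"
  shows "cmod (weight t z) \<le> (t + 3 / a) * exp (Re z * t) / cmod z ^ 3"
proof -
  have z: "a \<le> cmod z" "cmod z > 0" using assms complex_Re_le_cmod[of z] by linarith+
  have "cmod (of_real t / z ^ 3 - 3 / z ^ 4) \<le> t / cmod z ^ 3 + 3 / cmod z ^ 4"
    using norm_triangle_ineq4[of "of_real t / z ^ 3" "3 / z ^ 4"] assms by (simp add: norm_divide norm_power)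
  also have "3 / cmod z ^ 4 = 3 / cmod z / cmod z ^ 3" by (simp add: eval_nat_numeral)
  also have "3 / cmod z / cmod z ^ 3 \<le> 3 / a / cmod z ^ 3"
    using z assms by (intro divide_right_mono divide_left_mono) auto
  finally have "cmod (of_real t / z ^ 3 - 3 / z ^ 4) \<le> (t + 3 / a) / cmod z ^ 3"
    by (simp add: add_divide_distrib)
  then have "exp (Re z * t) * cmod (of_real t / z ^ 3 - 3 / z ^ 4) \<le> exp (Re z * t) * ((t + 3 / a) / cmod z ^ 3)"
    by (intro mult_left_mono) auto
  then show ?thesis by (simp add: weight_def norm_mult mult_ac)
qed

text \<open>Inverting \<open>weight t z\<close> times e^(-zr) termwise gives t (t-r)^2/2 - 3
  (t-r)^3/6, which is r (t-r)^2/2 if r \<le> t, and 0 otherwise. The factor r is the one gained by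
  passing from \<open>H\<close> to \<open>H'\<close>. The two cases close the contour to the left
  and to the right.\<close>

lemma weight_inversion:
  assumes a: "a > 0" and t: "0 \<le> t" "t \<le> T" and r: "0 \<le> r" "r \<le> T" and L: "L > a" "L \<ge> 1"
  shows "cmod (complex.line_integral a L (\<lambda>z. weight t z * exp (- (z * of_real r)))
    - 2 * pi * (if r \<le> t then (t - r)\<^sup>2 / 2 * r else 0))
    \<le> (T * (6 * exp (a * T) + 4 / a) + 3 * (6 * exp (a * T) + 4 / a\<^sup>2)) / L"
proof -
  let ?J = "\<lambda>n. complex.line_integral a L (\<lambda>z. exp (z * of_real (t - r)) / z ^ n)"
  have z0: "Complex a \<tau> \<noteq> 0" for \<tau> using a by (auto simp: complex_eq_iff)
  have int: "(\<lambda>\<tau>. exp (Complex a \<tau> * of_real (t - r)) / Complex a \<tau> ^ n) integrable_on {-L..L}" for n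
    using z0 by (intro integrable_continuous_real continuous_intros) auto
  have "complex.line_integral a L (\<lambda>z. weight t z * exp (- (z * of_real r))) = of_real t * ?J 3 - 3 * ?J 4"
  proof -
    have "weight t z * exp (- (z * of_real r)) = of_real t * (exp (z * of_real (t - r)) / z ^ 3) - 3 * (exp (z * of_real (t - r)) / z ^ 4)" for z
    proof -
      have "exp (z * of_real (t - r)) = exp (z * of_real t) * exp (- (z * of_real r))"
        by (simp add: exp_add[symmetric] algebra_simps)
      then show ?thesis by (simp add: weight_def algebra_simps)
    qed
    then show ?thesis
      unfolding complex.line_integral_def
      by (simp only:) (subst integral_diff; (intro integrable_on_mult_right int)?; simp only: integral_mult_right)
  qed
  then have eq: "complex.line_integral a L (\<lambda>z. weight t z * exp (- (z * of_real r))) - 2 * pi * (if r \<le> t then (t - r)\<^sup>2 / 2 * r else 0) =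
    of_real t * (?J 3 - 2 * pi * (if r \<le> t then (t - r)\<^sup>2 / 2 else 0)) - 3 * (?J 4 - 2 * pi * (if r \<le> t then (t - r) ^ 3 / 6 else 0))"
  proof -
    have "(if r \<le> t then (t - r)\<^sup>2 / 2 * r else 0) = t * (if r \<le> t then (t - r)\<^sup>2 / 2 else 0) - 3 * (if r \<le> t then (t - r) ^ 3 / 6 else 0)"
      by (simp add: power2_eq_square power3_eq_cube field_simps)
    then show ?thesis
      unfolding \<open>complex.line_integral a L _ = _\<close> by (simp only: of_real_diff of_real_mult of_real_numeral) (simp only: algebra_simps)
  qed
  have E: "exp (a * (t - r)) \<le> exp (a * T)" using a t r by (auto intro!: mult_left_mono)
  have L0: "L > 0" using L by simp
  have 3: "cmod (?J 3 - 2 * pi * (if r \<le> t then (t - r)\<^sup>2 / 2 else 0)) \<le> (6 * exp (a * T) + 4 / a) / L"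
  proof (cases "r \<le> t")
    case True
    have "cmod (?J 3 - 2 * pi * (if r \<le> t then (t - r)\<^sup>2 / 2 else 0)) \<le> 6 * exp (a * (t - r)) / L"
      using inverse_laplace_power_pos[OF a, of 3 L "t - r"] L True by (simp add: fact_numeral)
    also have "\<dots> \<le> (6 * exp (a * T) + 4 / a) / L"
      using E a L0 by (intro divide_right_mono) (auto intro!: add_increasing2)
    finally show ?thesis .
  next
    case False
    then have "cmod (?J 3 - 2 * pi * (if r \<le> t then (t - r)\<^sup>2 / 2 else 0)) \<le> 4 / a / L"
      using inverse_laplace_power_neg[OF a, of 3 L "t - r"] L by simp
    also have "\<dots> \<le> (6 * exp (a * T) + 4 / a) / L"
      using L0 by (intro divide_right_mono) auto
    finally show ?thesis .
  qed
  have 4: "cmod (?J 4 - 2 * pi * (if r \<le> t then (t - r) ^ 3 / 6 else 0)) \<le> (6 * exp (a * T) + 4 / a\<^sup>2) / L"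
  proof (cases "r \<le> t")
    case True
    have "cmod (?J 4 - 2 * pi * (if r \<le> t then (t - r) ^ 3 / 6 else 0)) \<le> 6 * exp (a * (t - r)) / L"
      using inverse_laplace_power_pos[OF a, of 4 L "t - r"] L True by (simp add: fact_numeral)
    also have "\<dots> \<le> (6 * exp (a * T) + 4 / a\<^sup>2) / L"
      using E a L0 by (intro divide_right_mono) (auto intro!: add_increasing2)
    finally show ?thesis .
  next
    case False
    then have "cmod (?J 4 - 2 * pi * (if r \<le> t then (t - r) ^ 3 / 6 else 0)) \<le> 4 / a\<^sup>2 / L"
      using inverse_laplace_power_neg[OF a, of 4 L "t - r"] L by simp
    also have "\<dots> \<le> (6 * exp (a * T) + 4 / a\<^sup>2) / L"
      using L0 by (intro divide_right_mono) auto
    finally show ?thesis .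
  qed
  have "cmod (of_real t * (?J 3 - 2 * pi * (if r \<le> t then (t - r)\<^sup>2 / 2 else 0)) - 3 * (?J 4 - 2 * pi * (if r \<le> t then (t - r) ^ 3 / 6 else 0)))
    \<le> t * cmod (?J 3 - 2 * pi * (if r \<le> t then (t - r)\<^sup>2 / 2 else 0)) + 3 * cmod (?J 4 - 2 * pi * (if r \<le> t then (t - r) ^ 3 / 6 else 0))"
  proof -
    have "cmod (of_real t * X - 3 * Y) \<le> t * cmod X + 3 * cmod Y" for X Y
      using norm_triangle_ineq4[of "of_real t * X" "3 * Y"] t by (simp add: norm_mult)
    then show ?thesis .
  qed
  also have "\<dots> \<le> T * ((6 * exp (a * T) + 4 / a) / L) + 3 * ((6 * exp (a * T) + 4 / a\<^sup>2) / L)"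
    using t by (intro add_mono mult_mono 3 4) auto
  also have "\<dots> = (T * (6 * exp (a * T) + 4 / a) + 3 * (6 * exp (a * T) + 4 / a\<^sup>2)) / L"
  proof -
    have "T * (X / L) + 3 * (Y / L) = (T * X + 3 * Y) / L" for X Y
      by (simp add: add_divide_distrib)
    then show ?thesis .
  qed
  finally show ?thesis unfolding eq .
qed

context half_plane_symbol
begin

text \<open>The transform over \<open>[0, T]\<close> suffices: multiplied by the weight, the deviation from \<open>H\<close> is
  \<open>O(|z|\<^sup>-\<^sup>2)\<close> on \<open>Re z \<ge> a\<close> for \<open>t \<le> T\<close>, so its integral vanishes when the line is moved to the right.\<close>

theorem inverse_transform_eq:
  assumes T: "T > 0" and g: "continuous_on {0..T} g"
    and \<Delta>: "\<And>z. a \<le> Re z \<Longrightarrow> norm (H z x - laplace_on T g z) \<le> K * cmod z * exp (- T * Re z)"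
    and t: "t \<in> {0..T}"
  shows "inverse_transform t x = t *\<^sub>R g t"
proof -
  \<comment> \<open>Equality is shown after convolution with t^2/2, where the integrands decay fast
    enough for the contour to be moved; the convolution is inverted at the very end.\<close>
  have half: "integral {0..t} (\<lambda>r. ((t - r)\<^sup>2 / 2) *\<^sub>R inverse_transform r x) = integral {0..t} (\<lambda>r. ((t - r)\<^sup>2 / 2) *\<^sub>R (r *\<^sub>R g r))"
    if t: "t \<in> {0..T}" for t
  proof -
    let ?p = "\<lambda>r. if r \<le> t then (t - r)\<^sup>2 / 2 * r else 0"
    have t0: "t \<ge> 0" "t \<le> T" using t by auto
    obtain G where "G > 0" "\<forall>x\<in>g ` {0..T}. norm x \<le> G"
      using compact_imp_bounded[OF compact_continuous_image[OF g compact_Icc]] unfolding bounded_pos by blast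
    then have G: "\<And>r. r \<in> {0..T} \<Longrightarrow> norm (g r) \<le> G" "G > 0" by auto
    have K0: "K \<ge> 0"
    proof -
      have "0 \<le> K * (cmod (of_real a) * exp (- T * a))"
        using order_trans[OF norm_ge_zero \<Delta>[of "of_real a"]] by (simp add: mult.assoc)
      moreover have "0 < cmod (of_real a) * exp (- T * a)" using a by simp
      ultimately show ?thesis by (smt (verit) mult_neg_pos)
    qed
    have z0: "z \<noteq> 0" if "a \<le> Re z" for z :: complex using that a by auto
    have z0': "Complex a \<tau> \<noteq> 0" for \<tau> using a by (auto simp: complex_eq_iff)
    have cw: "continuous_on {z. a \<le> Re z} (weight t)" "continuous_on {z. a \<le> Re z} (weight' t)"
      unfolding weight_def weight'_def using z0 by (auto intro!: continuous_intros)
    \<comment> \<open>Each constant bounds one error by a multiple of 1/L: \<open>B1\<close> the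
      deviation of \<open>H\<close> from the truncated transform, \<open>B2\<close> the inversion of
      the truncated transform, \<open>B3\<close> the boundary values of the integration by
      parts.\<close>
    define B1 where "B1 = 4 * (K * (t + 3 / a))"
    define B2 where "B2 = (T * (6 * exp (a * T) + 4 / a) + 3 * (6 * exp (a * T) + 4 / a\<^sup>2)) * G * T"
    define B3 where "B3 = 2 * (exp (a * t) / a ^ 3) * C * norm x"
    let ?D = "\<lambda>z. H z x - laplace_on T g z"
    have est1: "norm (line_integral a L (\<lambda>z. s (weight t z) (?D z))) \<le> B1 / L" if L: "L > a" for L
      unfolding B1_def
    proof (rule line_integral_decay[OF a L])
      fix z assume z: "a \<le> Re z"
      show "has_cderiv (\<lambda>z. s (weight t z) (?D z))
        (s (weight' t z) (?D z) + s (weight t z) (H' z x - laplace_on T (\<lambda>r. (- r) *\<^sub>R g r) z)) z"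
        by (intro has_cderiv_scale DERIV_weight has_cderiv_diff H_apply has_cderiv_laplace_on g z0 z)
      have cz: "cmod z > 0" using z0[OF z] by simp
      have "norm (s (weight t z) (?D z)) \<le> ((t + 3 / a) * exp (Re z * t) / cmod z ^ 3) * (K * cmod z * exp (- T * Re z))"
        unfolding norm_s using norm_weight_le[OF a z t0(1)] \<Delta>[OF z] a t0 by (intro mult_mono) auto
      also have "\<dots> = K * (t + 3 / a) / (cmod z)\<^sup>2 * exp (Re z * (t - T))"
        using cz by (simp add: power2_eq_square power3_eq_cube algebra_simps exp_diff exp_minus field_simps)
      \<comment> \<open>This is where t \<le> T enters: the decay of the truncation error outweighs
        e^(t Re z).\<close>
      also have "\<dots> \<le> K * (t + 3 / a) / (cmod z)\<^sup>2 * 1"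
        using z a t0 K0 by (intro mult_left_mono) (auto simp: mult_nonneg_nonpos)
      finally show "norm (s (weight t z) (?D z)) \<le> K * (t + 3 / a) / (cmod z)\<^sup>2" by simp
    next
      show "continuous_on {z. a \<le> Re z} (\<lambda>z. s (weight' t z) (?D z) + s (weight t z) (H' z x - laplace_on T (\<lambda>r. (- r) *\<^sub>R g r) z))"
        by (intro continuous_intros s.continuous_on cw blinfun.continuous_on H_cont H'_cont continuous_on_laplace_on g)
    qed
    have est2: "norm (line_integral a L (\<lambda>z. s (weight t z) (laplace_on T g z)) - (2 * pi) *\<^sub>R integral {0..T} (\<lambda>r. ?p r *\<^sub>R g r)) \<le> B2 / L"
      if L: "L > a" "L \<ge> 1" for L
    proof -
      let ?z = "\<lambda>\<tau>. Complex a \<tau>"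
      let ?E = "\<lambda>z r. weight t z * exp (- (z * of_real r))"
      have cE: "continuous_on S (\<lambda>x. weight t (?z (f x)) * exp (- (?z (f x) * of_real (h x))))"
        if "continuous_on S f" "continuous_on S h" for S :: "'x::topological_space set" and f h
        unfolding weight_def using that z0' by (intro continuous_intros) auto
      have p_cont: "continuous_on {0..T} ?p"
      proof -
        have "?p = (\<lambda>r. (max 0 (t - r))\<^sup>2 / 2 * r)" by (auto simp: fun_eq_iff max_def)
        then show ?thesis by (simp only:) (intro continuous_intros; simp)
      qed
      have "line_integral a L (\<lambda>z. s (weight t z) (laplace_on T g z)) =
        integral {-L..L} (\<lambda>\<tau>. integral {0..T} (\<lambda>r. s (?E (?z \<tau>) r) (g r)))"
        unfolding line_integral_def laplace_on_def
      proof (rule integral_cong)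
        fix \<tau>
        have "continuous_on {0..T} (\<lambda>r. s (exp (- (?z \<tau> * of_real r))) (g r))"
          by (intro s.continuous_on continuous_intros g)
        from integral_linear[OF integrable_continuous_real[OF this] s.bounded_linear_right[of "weight t (?z \<tau>)"]]
        show "s (weight t (?z \<tau>)) (integral {0..T} (\<lambda>r. s (exp (- (?z \<tau> * of_real r))) (g r))) =
          integral {0..T} (\<lambda>r. s (?E (?z \<tau>) r) (g r))" by (simp add: o_def s_mult)
      qed
      also have "\<dots> = integral {0..T} (\<lambda>r. integral {-L..L} (\<lambda>\<tau>. s (?E (?z \<tau>) r) (g r)))"
      proof -
        have "continuous_on (cbox (- L, 0) (L, T)) (\<lambda>(\<tau>, r). s (?E (?z \<tau>) r) (g r))"
          unfolding split_beta by (intro s.continuous_on cE continuous_on_compose2[OF g] continuous_intros) auto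
        from integral_swap_continuous[OF this] show ?thesis by simp
      qed
      also have "\<dots> = integral {0..T} (\<lambda>r. s (complex.line_integral a L (\<lambda>z. ?E z r)) (g r))"
      proof (rule integral_cong)
        fix r
        have "continuous_on {-L..L} (\<lambda>\<tau>. ?E (?z \<tau>) r)" by (intro cE continuous_intros)
        from integral_linear[OF integrable_continuous_real[OF this] s.bounded_linear_left[of "g r"]]
        show "integral {-L..L} (\<lambda>\<tau>. s (?E (?z \<tau>) r) (g r)) = s (complex.line_integral a L (\<lambda>z. ?E z r)) (g r)"
          by (simp add: o_def complex.line_integral_def)
      qed
      finally have E1: "line_integral a L (\<lambda>z. s (weight t z) (laplace_on T g z)) =
        integral {0..T} (\<lambda>r. s (complex.line_integral a L (\<lambda>z. ?E z r)) (g r))" .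
      have E2: "line_integral a L (\<lambda>z. s (weight t z) (laplace_on T g z)) - (2 * pi) *\<^sub>R integral {0..T} (\<lambda>r. ?p r *\<^sub>R g r) =
        integral {0..T} (\<lambda>r. s (complex.line_integral a L (\<lambda>z. ?E z r) - 2 * pi * ?p r) (g r))"
      proof -
        have "continuous_on {0..T} (\<lambda>r. complex.line_integral a L (\<lambda>z. ?E z r))"
        proof -
          have "continuous_on ({0..T} \<times> cbox (- L) L) (\<lambda>(r, \<tau>). ?E (?z \<tau>) r)"
            unfolding split_beta by (intro cE continuous_intros)
          from integral_continuous_on_param[OF this] show ?thesis
            unfolding complex.line_integral_def by simp
        qed
        then have 1: "(\<lambda>r. s (complex.line_integral a L (\<lambda>z. ?E z r)) (g r)) integrable_on {0..T}"
          by (intro integrable_continuous_real s.continuous_on g)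
        define b where "b r = ?p r *\<^sub>R g r" for r
        have 2: "(\<lambda>r. (2 * pi) *\<^sub>R b r) integrable_on {0..T}"
          unfolding b_def by (intro integrable_continuous_real continuous_intros g p_cont)
        have 3: "s (complex.line_integral a L (\<lambda>z. ?E z r)) (g r) - (2 * pi) *\<^sub>R b r =
          s (complex.line_integral a L (\<lambda>z. ?E z r) - 2 * pi * ?p r) (g r)" for r
          by (simp add: b_def s.diff_left flip: s_of_real s_mult)
        let ?A = "\<lambda>r. s (complex.line_integral a L (\<lambda>z. ?E z r)) (g r)"
        have "line_integral a L (\<lambda>z. s (weight t z) (laplace_on T g z)) - (2 * pi) *\<^sub>R integral {0..T} b = integral {0..T} ?A - integral {0..T} (\<lambda>r. (2 * pi) *\<^sub>R b r)"
          unfolding E1 by (simp only: integral_cmul)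
        also have "\<dots> = integral {0..T} (\<lambda>r. ?A r - (2 * pi) *\<^sub>R b r)"
          by (rule integral_diff[OF 1 2, symmetric])
        also have "\<dots> = integral {0..T} (\<lambda>r. s (complex.line_integral a L (\<lambda>z. ?E z r) - 2 * pi * ?p r) (g r))"
          by (rule integral_cong) (rule 3)
        finally show ?thesis unfolding b_def .
      qed
      have "norm (integral {0..T} (\<lambda>r. s (complex.line_integral a L (\<lambda>z. ?E z r) - 2 * pi * ?p r) (g r)))
        \<le> integral {0..T} (\<lambda>r. (T * (6 * exp (a * T) + 4 / a) + 3 * (6 * exp (a * T) + 4 / a\<^sup>2)) / L * G)"
      proof (rule integral_norm_bound_integral)
        have "continuous_on ({0..T} \<times> cbox (- L) L) (\<lambda>(r, \<tau>). ?E (?z \<tau>) r)"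
          unfolding split_beta by (intro cE continuous_intros)
        from integral_continuous_on_param[OF this]
        have "continuous_on {0..T} (\<lambda>r. complex.line_integral a L (\<lambda>z. ?E z r))"
          unfolding complex.line_integral_def by simp
        then show "(\<lambda>r. s (complex.line_integral a L (\<lambda>z. ?E z r) - 2 * pi * ?p r) (g r)) integrable_on {0..T}"
          by (intro integrable_continuous_real s.continuous_on g p_cont continuous_intros)
        fix r assume r: "r \<in> {0..T}"
        show "norm (s (complex.line_integral a L (\<lambda>z. ?E z r) - 2 * pi * ?p r) (g r)) \<le>
          (T * (6 * exp (a * T) + 4 / a) + 3 * (6 * exp (a * T) + 4 / a\<^sup>2)) / L * G"
          unfolding norm_s using weight_inversion[OF a t0, of r L] r L G a T by (intro mult_mono) auto
      qed auto
      also have "\<dots> = B2 / L" using T by (simp add: B2_def)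
      finally show ?thesis unfolding E2 .
    qed
    have est3: "norm (line_integral a L (\<lambda>z. s (exp (z * of_real t) / z ^ 3) (H' z x)) + line_integral a L (\<lambda>z. s (weight t z) (H z x))) \<le> B3 / L"
      if L: "L > 0" for L
    proof -
      have "norm (s (- \<i>) (s (exp (Complex a L * of_real t) / Complex a L ^ 3) (H (Complex a L) x)
        - s (exp (Complex a (- L) * of_real t) / Complex a (- L) ^ 3) (H (Complex a (- L)) x))) \<le> B3 / L"
        unfolding B3_def
      proof (rule boundary_term[where w = "\<lambda>z. exp (z * of_real t) / z ^ 3", OF _ L])
        fix z assume "a \<le> Re z" "Re z \<le> a"
        then show "cmod (exp (z * of_real t) / z ^ 3) \<le> exp (a * t) / a ^ 3"
          using cmod_ge[of z] a by (auto simp: norm_divide norm_power intro!: frac_le power_mono)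
      qed
      moreover have "line_integral a L (\<lambda>z. s (exp (z * of_real t) / z ^ 3) (H' z x)) =
        s (- \<i>) (s (exp (Complex a L * of_real t) / Complex a L ^ 3) (H (Complex a L) x)
          - s (exp (Complex a (- L) * of_real t) / Complex a (- L) ^ 3) (H (Complex a (- L)) x))
        - line_integral a L (\<lambda>z. s (weight t z) (H z x))"
        using L by (intro line_integral_by_parts DERIV_exp_over_cube z0 cw) auto
      ultimately show ?thesis by simp
    qed
    let ?I = "integral {0..T} (\<lambda>r. ?p r *\<^sub>R g r)"
    have lim: "(\<lambda>n. (- 1 / (2 * pi)) *\<^sub>R line_integral a (real n) (\<lambda>z. s (exp (z * of_real t) / z ^ 3) (H' z x))) \<longlonglongrightarrow> ?I"
    proof (rule LIM_zero_cancel, rule Lim_null_comparison)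
      show "(\<lambda>n. (B1 + B2 + B3) / real n) \<longlonglongrightarrow> 0" by (rule lim_const_over_n)
      show "\<forall>\<^sub>F n in sequentially. norm ((- 1 / (2 * pi)) *\<^sub>R line_integral a (real n) (\<lambda>z. s (exp (z * of_real t) / z ^ 3) (H' z x)) - ?I)
        \<le> (B1 + B2 + B3) / real n"
        using eventually_gt_at_top[of "nat \<lceil>a\<rceil>"]
      proof eventually_elim
        case (elim n)
        then have n: "real n > a" "real n \<ge> 1" "real n > 0" by linarith+
        let ?X = "line_integral a (real n) (\<lambda>z. s (exp (z * of_real t) / z ^ 3) (H' z x))"
        let ?Y = "line_integral a (real n) (\<lambda>z. s (weight t z) (H z x))"
        let ?Z = "line_integral a (real n) (\<lambda>z. s (weight t z) (laplace_on T g z))"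
        let ?W = "line_integral a (real n) (\<lambda>z. s (weight t z) (?D z))"
        have "?W = ?Y - ?Z"
          unfolding line_integral_def s.diff_right
          by (intro integral_diff integrable_continuous_real s.continuous_on blinfun.continuous_on continuous_on_half_plane H_cont cw
              continuous_on_laplace_on g continuous_intros)
        \<comment> \<open>As \<open>?X + ?Y\<close> and \<open>?W\<close> are negligible,
          \<open>?X\<close> is close to \<open>- ?Z\<close>, and \<open>?Z\<close> is close to 2
          \<pi> times \<open>?I\<close>; the identity isolates exactly these three errors.\<close>
        then have "(- 1 / (2 * pi)) *\<^sub>R ?X - ?I = (- 1 / (2 * pi)) *\<^sub>R ((?X + ?Y) - ?W - (?Z - (2 * pi) *\<^sub>R ?I))"
          by (simp add: scaleR_diff_right scaleR_add_right)
        then have "norm ((- 1 / (2 * pi)) *\<^sub>R ?X - ?I) = 1 / (2 * pi) * norm ((?X + ?Y) - ?W - (?Z - (2 * pi) *\<^sub>R ?I))"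
          by simp
        also have "\<dots> \<le> 1 * (B3 / real n + B1 / real n + B2 / real n)"
        proof (rule mult_mono)
          show "norm ((?X + ?Y) - ?W - (?Z - (2 * pi) *\<^sub>R ?I)) \<le> B3 / real n + B1 / real n + B2 / real n"
            using est1[OF n(1)] est2[OF n(1,2)] est3[OF n(3)]
              norm_triangle_ineq4[of "(?X + ?Y) - ?W" "?Z - (2 * pi) *\<^sub>R ?I"] norm_triangle_ineq4[of "?X + ?Y" ?W]
            by linarith
          show "1 / (2 * pi) \<le> 1" using pi_ge_two by (simp add: field_simps)
        qed auto
        finally show ?case by (simp add: add_divide_distrib)
      qed
    qed
    have "?I = integral {0..t} (\<lambda>r. ((t - r)\<^sup>2 / 2) *\<^sub>R (r *\<^sub>R g r))"
    proof -
      have "?I = integral {0..T} (\<lambda>r. if r \<in> {0..t} then ((t - r)\<^sup>2 / 2) *\<^sub>R (r *\<^sub>R g r) else 0)"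
        by (rule integral_cong) auto
      also have "\<dots> = integral {0..t} (\<lambda>r. ((t - r)\<^sup>2 / 2) *\<^sub>R (r *\<^sub>R g r))"
        using integral_restrict_Int[of "{0..T}" "{0..t}" "\<lambda>r. ((t - r)\<^sup>2 / 2) *\<^sub>R (r *\<^sub>R g r)"] t0 by simp
      finally show ?thesis .
    qed
    then show ?thesis using LIMSEQ_unique[OF lim inverse_convolution_limit[OF t0(1)]] by simp
  qed
  have "inverse_transform t x - t *\<^sub>R g t = 0"
  proof (rule inverse_convolution_square_eq_0[OF T _ _ t])
    show c: "continuous_on {0..T} (\<lambda>t. inverse_transform t x - t *\<^sub>R g t)"
      by (intro continuous_intros blinfun.continuous_on inverse_transform_continuous g)
    fix t assume t: "t \<in> {0..T}"
    have "continuous_on {0..t} (\<lambda>r. ((t - r)\<^sup>2 / 2) *\<^sub>R inverse_transform r x)"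
      "continuous_on {0..t} (\<lambda>r. ((t - r)\<^sup>2 / 2) *\<^sub>R (r *\<^sub>R g r))"
      using t by (auto intro!: continuous_intros blinfun.continuous_on inverse_transform_continuous continuous_on_subset[OF g])
    from integral_diff[OF this[THEN integrable_continuous_real]]
    show "integral {0..t} (\<lambda>r. ((t - r)\<^sup>2 / 2) *\<^sub>R (inverse_transform r x - r *\<^sub>R g r)) = 0"
      by (simp add: scaleR_diff_right half[OF t])
  qed
  then show ?thesis by simp
qed

end

section \<open>Compact operators and sectorial resolvents\<close>

text \<open>Total boundedness rather than compactness of the closure: it passes to subsets, sums,
  images and uniform limits by choosing finite nets, without computing closures.\<close>

definition precompact :: "'a::metric_space set \<Rightarrow> bool" where
  "precompact X \<longleftrightarrow> (\<forall>e>0. \<exists>k. finite k \<and> X \<subseteq> (\<Union>x\<in>k. ball x e))"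

text \<open>A finite net of radius e/2 for \<open>X\<close> covers the closure as well once open
  balls are replaced by closed ones.\<close>

lemma precompact_iff_compact_closure:
  fixes X :: "'a::complete_space set"
  shows "precompact X \<longleftrightarrow> compact (closure X)"
proof
  assume X: "precompact X"
  show "compact (closure X)"
    unfolding compact_eq_totally_bounded
  proof (intro conjI allI impI)
    show "complete (closure X)" by (simp add: complete_eq_closed)
    fix e :: real assume e: "e > 0"
    then obtain k where k: "finite k" "X \<subseteq> (\<Union>x\<in>k. ball x (e / 2))"
      using X half_gt_zero unfolding precompact_def by meson
    have "closure X \<subseteq> (\<Union>x\<in>k. cball x (e / 2))"
      using k(1) by (intro closure_minimal closed_UN order_trans[OF k(2)] UN_mono ball_subset_cball) auto
    also have "\<dots> \<subseteq> (\<Union>x\<in>k. ball x e)" using e by auto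
    finally show "\<exists>k. finite k \<and> closure X \<subseteq> (\<Union>x\<in>k. ball x e)" using k(1) by blast
  qed
next
  assume "compact (closure X)"
  then show "precompact X"
    unfolding compact_eq_totally_bounded precompact_def by (meson closure_subset order_trans)
qed

lemma precompact_subset: "precompact Y \<Longrightarrow> X \<subseteq> Y \<Longrightarrow> precompact X"
  unfolding precompact_def by (meson order_trans)

lemma precompact_approx:
  assumes "\<And>e. e > 0 \<Longrightarrow> \<exists>Y. precompact Y \<and> (\<forall>x\<in>X. \<exists>y\<in>Y. dist x y < e)"
  shows "precompact X"
  unfolding precompact_def
proof (intro allI impI)
  fix e :: real assume e: "e > 0"
  then obtain Y where Y: "precompact Y" "\<forall>x\<in>X. \<exists>y\<in>Y. dist x y < e / 2" using assms[of "e / 2"] by auto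
  then obtain k where k: "finite k" "Y \<subseteq> (\<Union>x\<in>k. ball x (e / 2))"
    using e half_gt_zero unfolding precompact_def by meson
  have "X \<subseteq> (\<Union>x\<in>k. ball x e)"
  proof
    fix x assume "x \<in> X"
    then obtain y where y: "y \<in> Y" "dist x y < e / 2" using Y(2) by blast
    then obtain z where z: "z \<in> k" "dist z y < e / 2" using k(2) by auto
    have "dist z x < e" using y(2) z(2) dist_triangle2[of z x y] by simp
    then show "x \<in> (\<Union>x\<in>k. ball x e)" using z(1) by auto
  qed
  then show "\<exists>k. finite k \<and> X \<subseteq> (\<Union>x\<in>k. ball x e)" using k(1) by blast
qed

lemma precompact_sum:
  fixes X Y :: "'a::real_normed_vector set"
  assumes "precompact X" "precompact Y"
  shows "precompact {x + y |x y. x \<in> X \<and> y \<in> Y}"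
  unfolding precompact_def
proof (intro allI impI)
  fix e :: real assume "e > 0"
  then have e: "e / 2 > 0" by simp
  obtain k where k: "finite k" "X \<subseteq> (\<Union>x\<in>k. ball x (e / 2))" using assms(1) e unfolding precompact_def by meson
  obtain l where l: "finite l" "Y \<subseteq> (\<Union>x\<in>l. ball x (e / 2))" using assms(2) e unfolding precompact_def by meson
  have "{x + y |x y. x \<in> X \<and> y \<in> Y} \<subseteq> (\<Union>x\<in>(\<lambda>(x, y). x + y) ` (k \<times> l). ball x e)"
  proof safe
    fix x y assume "x \<in> X" "y \<in> Y"
    then obtain x' y' where "x' \<in> k" "dist x' x < e / 2" "y' \<in> l" "dist y' y < e / 2" using k(2) l(2) by fastforce
    moreover from this have "dist (x' + y') (x + y) < e"
      using dist_triangle_add[of x' y' x y] by simp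
    ultimately show "x + y \<in> (\<Union>x\<in>(\<lambda>(x, y). x + y) ` (k \<times> l). ball x e)"
      by (auto intro!: bexI[of _ "(x', y')"])
  qed
  then show "\<exists>k. finite k \<and> {x + y |x y. x \<in> X \<and> y \<in> Y} \<subseteq> (\<Union>x\<in>k. ball x e)"
    using k(1) l(1) by (intro exI[of _ "(\<lambda>(x, y). x + y) ` (k \<times> l)"]) auto
qed

lemma precompact_bounded_linear_image:
  assumes F: "bounded_linear F" and X: "precompact X"
  shows "precompact (F ` X)"
  unfolding precompact_def
proof (intro allI impI)
  fix e :: real assume e: "e > 0"
  obtain B where B: "B > 0" "\<And>x. norm (F x) \<le> norm x * B" using bounded_linear.pos_bounded[OF F] by auto
  obtain k where k: "finite k" "X \<subseteq> (\<Union>x\<in>k. ball x (e / B))"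
    using X e B(1) unfolding precompact_def by (meson divide_pos_pos)
  have "F ` X \<subseteq> (\<Union>x\<in>F ` k. ball x e)"
  proof safe
    fix x assume "x \<in> X"
    then obtain z where z: "z \<in> k" "norm (z - x) < e / B" using k(2) by (force simp: dist_norm)
    have "norm (F z - F x) \<le> norm (z - x) * B" using B(2)[of "z - x"] bounded_linear.linear[OF F] by (simp add: linear_diff)
    also have "\<dots> < e" using z(2) B(1) by (simp add: field_simps)
    finally show "F x \<in> (\<Union>x\<in>F ` k. ball x e)" using z(1) by (auto simp: dist_norm)
  qed
  then show "\<exists>k. finite k \<and> F ` X \<subseteq> (\<Union>x\<in>k. ball x e)" using k(1) by blast
qed

lemma compact_operator_iff_precompact:
  fixes X :: "'a::real_normed_vector \<Rightarrow>\<^sub>L 'b::banach"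
  shows "compact_operator X \<longleftrightarrow> (\<forall>S. bounded S \<longrightarrow> precompact (blinfun_apply X ` S))"
  unfolding compact_operator_def precompact_iff_compact_closure by (simp add: blinfun.bounded_linear_right)

definition compact_ops :: "('a::real_normed_vector \<Rightarrow>\<^sub>L 'b::banach) set" where
  "compact_ops = {X. compact_operator (blinfun_apply X)}"

text \<open>The product is described pointwise through a bounded linear function \<open>Y\<close>,
  so that one lemma serves compositions, real multiples and the complex multiples
  \<open>op_scale\<close>.\<close>

lemma compact_ops_compose_left:
  assumes "X \<in> compact_ops" and Y: "bounded_linear Y" and Z: "\<And>x. blinfun_apply Z x = Y (X x)"
  shows "Z \<in> compact_ops"
proof -
  have "precompact (blinfun_apply Z ` S)" if "bounded S" for S
  proof -
    have "blinfun_apply Z ` S = Y ` (blinfun_apply X ` S)" by (auto simp: Z)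
    then show ?thesis
      using assms(1) that precompact_bounded_linear_image[OF Y] by (auto simp: compact_ops_def compact_operator_iff_precompact)
  qed
  then show ?thesis by (auto simp: compact_ops_def compact_operator_iff_precompact)
qed

lemma compact_ops_compose_right:
  assumes "X \<in> compact_ops"
  shows "X o\<^sub>L Y \<in> compact_ops"
proof -
  have "precompact (blinfun_apply (X o\<^sub>L Y) ` S)" if "bounded S" for S
  proof -
    have "precompact (blinfun_apply X ` (blinfun_apply Y ` S))"
      using assms bounded_linear_image[OF that blinfun.bounded_linear_right[of Y]]
      unfolding compact_ops_def compact_operator_iff_precompact by blast
    then show ?thesis by (simp add: image_image)
  qed
  then show ?thesis by (auto simp: compact_ops_def compact_operator_iff_precompact)
qed

lemma subspace_compact_ops: "subspace (compact_ops :: ('a::real_normed_vector \<Rightarrow>\<^sub>L 'b::banach) set)"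
proof (rule subspaceI)
  have "precompact (blinfun_apply (0 :: 'a \<Rightarrow>\<^sub>L 'b) ` S)" for S
    by (rule precompact_subset[of "{0}"]) (auto simp: precompact_def intro!: exI[of _ "{0}"])
  then show "(0 :: 'a \<Rightarrow>\<^sub>L 'b) \<in> compact_ops" by (simp add: compact_ops_def compact_operator_iff_precompact)
  fix X Y :: "'a \<Rightarrow>\<^sub>L 'b" assume XY: "X \<in> compact_ops" "Y \<in> compact_ops"
  have "precompact (blinfun_apply (X + Y) ` S)" if S: "bounded S" for S
  proof (rule precompact_subset)
    show "precompact {x + y |x y. x \<in> blinfun_apply X ` S \<and> y \<in> blinfun_apply Y ` S}"
      using XY S by (intro precompact_sum) (auto simp: compact_ops_def compact_operator_iff_precompact)
    show "blinfun_apply (X + Y) ` S \<subseteq> {x + y |x y. x \<in> blinfun_apply X ` S \<and> y \<in> blinfun_apply Y ` S}"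
      by (auto simp: blinfun.add_left)
  qed
  then show "X + Y \<in> compact_ops" by (auto simp: compact_ops_def compact_operator_iff_precompact)
next
  fix c and X :: "'a \<Rightarrow>\<^sub>L 'b" assume "X \<in> compact_ops"
  then show "c *\<^sub>R X \<in> compact_ops"
    by (rule compact_ops_compose_left[OF _ bounded_linear_scaleR_right[of c]]) (simp add: blinfun.scaleR_left)
qed

lemma closed_compact_ops: "closed (compact_ops :: ('a::real_normed_vector \<Rightarrow>\<^sub>L 'b::banach) set)"
proof -
  have "X \<in> compact_ops" if X: "X \<in> closure compact_ops" for X :: "'a \<Rightarrow>\<^sub>L 'b"
  proof -
    have "precompact (blinfun_apply X ` S)" if S: "bounded S" for S
    proof (rule precompact_approx)
      fix e :: real assume e: "e > 0"
      obtain B where B: "B > 0" "\<And>x. x \<in> S \<Longrightarrow> norm x \<le> B" using S unfolding bounded_pos by blast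
      obtain Y where Y: "Y \<in> compact_ops" "norm (Y - X) < e / B"
        using X e B unfolding closure_approachable dist_norm by (meson divide_pos_pos)
      have "dist (X x) (Y x) < e" if "x \<in> S" for x
      proof -
        have "dist (X x) (Y x) = norm ((Y - X) x)" by (simp add: dist_norm blinfun.diff_left norm_minus_commute)
        also have "\<dots> \<le> norm (Y - X) * B" using norm_blinfun[of "Y - X" x] B(2)[OF that] by (meson mult_left_mono norm_ge_zero order_trans)
        also have "\<dots> < e" using Y(2) B(1) by (simp add: field_simps)
        finally show ?thesis .
      qed
      then show "\<exists>Z. precompact Z \<and> (\<forall>x\<in>blinfun_apply X ` S. \<exists>y\<in>Z. dist x y < e)"
        using Y(1) S by (intro exI[of _ "blinfun_apply Y ` S"]) (auto simp: compact_ops_def compact_operator_iff_precompact)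
    qed
    then show ?thesis by (auto simp: compact_ops_def compact_operator_iff_precompact)
  qed
  then have "closure (compact_ops :: ('a \<Rightarrow>\<^sub>L 'b) set) \<subseteq> compact_ops" by blast
  then show ?thesis by (simp only: closure_subset_eq)
qed

text \<open>The set \<open>Re \<mu> > -\<epsilon> |\<mu>|\<close> is a sector of half-angle \<open>\<pi>/2 + arcsin \<epsilon>\<close>.\<close>

locale sectorial_operator = complex_banach s
  for s :: "complex \<Rightarrow> 'e \<Rightarrow> 'e::banach" +
  fixes D :: "'e set" and A :: "'e \<Rightarrow> 'e" and \<epsilon> C :: real
  assumes linear: "linear_operator_on UNIV s D A" and \<epsilon>: "\<epsilon> > 0" and C: "C \<ge> 1"
    and sector_bound: "\<And>\<mu>. - \<epsilon> * cmod \<mu> < Re \<mu> \<Longrightarrow> \<mu> \<in> resolvent_set s D A \<and> onorm (resolvent s D A \<mu>) \<le> C / cmod \<mu>"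
begin

text \<open>Off the resolvent set the value carries no information, which is why the algebraic
  lemmas below are restricted to it.\<close>

definition res :: "complex \<Rightarrow> 'e \<Rightarrow>\<^sub>L 'e" where
  "res \<mu> = Blinfun (resolvent s D A \<mu>)"

abbreviation "\<Omega> \<equiv> {\<mu>. - \<epsilon> * cmod \<mu> < Re \<mu>}"

lemma open_\<Omega>: "open \<Omega>"
  by (intro open_Collect_less continuous_intros)

lemma res_apply: "\<mu> \<in> resolvent_set s D A \<Longrightarrow> res \<mu> x = resolvent s D A \<mu> x"
  unfolding res_def resolvent_set_def by (auto simp: bounded_linear_Blinfun_apply)

lemma res_eq: "\<mu> \<in> resolvent_set s D A \<Longrightarrow> blinfun_apply (res \<mu>) = resolvent s D A \<mu>"
  by (rule ext) (rule res_apply)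

lemma res_dom: "\<mu> \<in> resolvent_set s D A \<Longrightarrow> res \<mu> x \<in> D"
  and res_right: "\<mu> \<in> resolvent_set s D A \<Longrightarrow> s \<mu> (res \<mu> x) - A (res \<mu> x) = x"
proof -
  assume \<mu>: "\<mu> \<in> resolvent_set s D A"
  then have "x \<in> (\<lambda>x. s \<mu> x - A x) ` D" by (auto simp: resolvent_set_def bij_betw_def)
  from inv_into_into[OF this] f_inv_into_f[OF this]
  show "res \<mu> x \<in> D" "s \<mu> (res \<mu> x) - A (res \<mu> x) = x"
    unfolding res_apply[OF \<mu>] resolvent_def by auto
qed

lemma res_left: "\<mu> \<in> resolvent_set s D A \<Longrightarrow> x \<in> D \<Longrightarrow> res \<mu> (s \<mu> x - A x) = x"
  unfolding res_apply resolvent_def by (intro inv_into_f_f) (auto simp: resolvent_set_def bij_betw_def)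

text \<open>The operator type records real linearity only; complex homogeneity of the resolvent
  comes from that of \<open>A\<close>, by applying \<mu> - A to the right-hand side.\<close>

lemma res_s: "\<mu> \<in> resolvent_set s D A \<Longrightarrow> res \<mu> (s c x) = s c (res \<mu> x)"
proof -
  assume \<mu>: "\<mu> \<in> resolvent_set s D A"
  have d: "s c (res \<mu> x) \<in> D" "A (s c (res \<mu> x)) = s c (A (res \<mu> x))"
    using linear res_dom[OF \<mu>] by (auto simp: linear_operator_on_def)
  have "s \<mu> (s c (res \<mu> x)) - A (s c (res \<mu> x)) = s c (s \<mu> (res \<mu> x) - A (res \<mu> x))"
    unfolding d(2) s.diff_right s_mult by (simp add: mult.commute)
  then show ?thesis using res_left[OF \<mu> d(1)] res_right[OF \<mu>] by simp
qed

lemma res_identity: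
  assumes "\<mu> \<in> resolvent_set s D A" "\<xi> \<in> resolvent_set s D A"
  shows "res \<mu> - res \<xi> = op_scale s (\<xi> - \<mu>) (res \<mu> o\<^sub>L res \<xi>)"
proof (rule blinfun_eqI)
  fix x
  have "s \<mu> (res \<xi> x) - A (res \<xi> x) = s (\<mu> - \<xi>) (res \<xi> x) + x"
    using res_right[OF assms(2), of x] by (simp add: s.diff_left algebra_simps)
  then have "res \<xi> x = s (\<mu> - \<xi>) (res \<mu> (res \<xi> x)) + res \<mu> x"
    using res_left[OF assms(1) res_dom[OF assms(2), of x]] by (simp add: blinfun.add_right res_s[OF assms(1)])
  then show "(res \<mu> - res \<xi>) x = op_scale s (\<xi> - \<mu>) (res \<mu> o\<^sub>L res \<xi>) x"
    by (simp add: blinfun.diff_left s.diff_left algebra_simps)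
qed

lemma norm_res: "\<mu> \<in> \<Omega> \<Longrightarrow> norm (res \<mu>) \<le> C / cmod \<mu>"
  using sector_bound[of \<mu>] res_eq[of \<mu>] unfolding norm_blinfun.rep_eq by simp

interpretation op: complex_banach "op_scale s" by (rule op_space)

text \<open>Two applications of the resolvent identity write the remainder as the square of \<xi> -
  \<mu> times a product of three resolvents, each bounded by \<open>B\<close> near \<mu>.\<close>

lemma has_cderiv_res:
  assumes \<mu>: "\<mu> \<in> \<Omega>"
  shows "op.has_cderiv res (- (res \<mu> o\<^sub>L res \<mu>)) \<mu>"
proof -
  have m0: "\<mu> \<noteq> 0" using \<mu> by auto
  obtain d where d: "d > 0" "ball \<mu> d \<subseteq> \<Omega>" using open_\<Omega> \<mu> open_contains_ball by blast
  \<comment> \<open>Twice the bound at \<mu>, since |\<xi>| \<ge> |\<mu>|/2 once \<xi> is within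
    |\<mu>|/2 of \<mu>.\<close>
  define B where "B = 2 * C / cmod \<mu>"
  have B: "B > 0" "norm (res \<mu>) \<le> B" using m0 C norm_res[OF \<mu>] by (auto simp: B_def field_simps)
  define d' where "d' = min d (cmod \<mu> / 2)"
  have d': "d' > 0" using d m0 by (simp add: d'_def)
  have in\<Omega>: "\<xi> \<in> \<Omega>" "norm (res \<xi>) \<le> B" if "cmod (\<xi> - \<mu>) < d'" for \<xi>
  proof -
    show "\<xi> \<in> \<Omega>" using d(2) that by (auto simp: d'_def dist_norm norm_minus_commute)
    have "cmod \<xi> \<ge> cmod \<mu> / 2" using that norm_triangle_ineq2[of \<mu> \<xi>] by (simp add: d'_def norm_minus_commute)
    then have "C / cmod \<xi> \<le> C / (cmod \<mu> / 2)" using m0 C by (intro divide_left_mono mult_pos_pos) auto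
    then show "norm (res \<xi>) \<le> B" using norm_res[OF \<open>\<xi> \<in> \<Omega>\<close>] by (simp add: B_def mult.commute)
  qed
  have rs: "\<xi> \<in> resolvent_set s D A" if "\<xi> \<in> \<Omega>" for \<xi> using sector_bound that by auto
  have est: "norm (res \<xi> - res \<mu> - op_scale s (\<xi> - \<mu>) (- (res \<mu> o\<^sub>L res \<mu>))) \<le> (cmod (\<xi> - \<mu>))\<^sup>2 * B ^ 3"
    if "cmod (\<xi> - \<mu>) < d'" for \<xi>
  proof -
    note i = in\<Omega>[OF that]
    have e: "res \<xi> - res \<mu> = op_scale s (\<mu> - \<xi>) (res \<xi> o\<^sub>L res \<mu>)" by (rule res_identity[OF rs[OF i(1)] rs[OF \<mu>]])
    have "res \<xi> - res \<mu> - op_scale s (\<xi> - \<mu>) (- (res \<mu> o\<^sub>L res \<mu>)) = op_scale s (\<mu> - \<xi>) ((res \<xi> - res \<mu>) o\<^sub>L res \<mu>)"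
    proof (rule blinfun_eqI)
      fix x
      have "res \<xi> x - res \<mu> x = s (\<mu> - \<xi>) (res \<xi> (res \<mu> x))"
        using arg_cong[OF e, of "\<lambda>X. blinfun_apply X x"] by (simp add: blinfun.diff_left)
      then show "(res \<xi> - res \<mu> - op_scale s (\<xi> - \<mu>) (- (res \<mu> o\<^sub>L res \<mu>))) x = op_scale s (\<mu> - \<xi>) ((res \<xi> - res \<mu>) o\<^sub>L res \<mu>) x"
        by (simp add: blinfun.diff_left blinfun.minus_left s.diff_left s.diff_right s.minus_right)
    qed
    then have "norm (res \<xi> - res \<mu> - op_scale s (\<xi> - \<mu>) (- (res \<mu> o\<^sub>L res \<mu>))) = cmod (\<xi> - \<mu>) * norm ((res \<xi> - res \<mu>) o\<^sub>L res \<mu>)"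
      by (simp add: op.norm_s norm_minus_commute)
    also have "\<dots> \<le> cmod (\<xi> - \<mu>) * (norm (res \<xi> - res \<mu>) * B)"
      using B by (intro mult_left_mono order_trans[OF norm_blinfun_compose] mult_left_mono) auto
    also have "norm (res \<xi> - res \<mu>) \<le> cmod (\<xi> - \<mu>) * (B * B)"
      unfolding e op.norm_s norm_minus_commute[of \<mu>]
      using B i by (intro mult_left_mono order_trans[OF norm_blinfun_compose] mult_mono) auto
    finally show ?thesis using B by (simp add: power2_eq_square power3_eq_cube mult_ac mult_left_mono mult_right_mono)
  qed
  show ?thesis
    unfolding op.has_cderiv_def has_derivative_at_alt
  proof (intro conjI allI impI)
    show "bounded_linear (\<lambda>h. op_scale s h (- (res \<mu> o\<^sub>L res \<mu>)))" by (rule op.s.bounded_linear_left)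
    fix e :: real assume e: "e > 0"
    show "\<exists>d>0. \<forall>y. norm (y - \<mu>) < d \<longrightarrow> norm (res y - res \<mu> - op_scale s (y - \<mu>) (- (res \<mu> o\<^sub>L res \<mu>))) \<le> e * norm (y - \<mu>)"
    proof (intro exI[of _ "min d' (e / B ^ 3)"] conjI allI impI)
      show "min d' (e / B ^ 3) > 0" using d' e B by simp
      fix y assume y: "norm (y - \<mu>) < min d' (e / B ^ 3)"
      then have "norm (y - \<mu>) * B ^ 3 \<le> e" using B by (simp add: field_simps)
      then have "norm (y - \<mu>) * (norm (y - \<mu>) * B ^ 3) \<le> norm (y - \<mu>) * e" by (intro mult_left_mono) auto
      then show "norm (res y - res \<mu> - op_scale s (y - \<mu>) (- (res \<mu> o\<^sub>L res \<mu>))) \<le> e * norm (y - \<mu>)"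
        using est[of y] y by (simp add: power2_eq_square mult_ac)
    qed
  qed
qed

lemma continuous_on_res: "continuous_on \<Omega> res"
  using op.has_cderiv_continuous[OF has_cderiv_res] by (simp add: continuous_on_eq_continuous_within)

text \<open>By the resolvent identity every resolvent differs from the compact one by an operator
  with a compact factor.\<close>

lemma res_compact:
  assumes "complex_compact_resolvent s D A" "\<mu> \<in> resolvent_set s D A"
  shows "res \<mu> \<in> compact_ops"
proof -
  obtain \<mu>0 where \<mu>0: "\<mu>0 \<in> resolvent_set s D A" "compact_operator (resolvent s D A \<mu>0)"
    using assms(1) by (auto simp: complex_compact_resolvent_def)
  then have 0: "res \<mu>0 \<in> compact_ops"
    using res_eq[OF \<mu>0(1)] by (simp add: compact_ops_def)
  have 1: "res \<mu>0 o\<^sub>L res \<mu> \<in> compact_ops" by (rule compact_ops_compose_right[OF 0])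
  have "op_scale s (\<mu> - \<mu>0) (res \<mu>0 o\<^sub>L res \<mu>) \<in> compact_ops"
    by (rule compact_ops_compose_left[OF 1 s.bounded_linear_right]) simp
  from subspace_diff[OF subspace_compact_ops 0 this] show ?thesis
    unfolding res_identity[OF \<mu>0(1) assms(2), symmetric] by simp
qed

end

text \<open>The resolvent estimate is uniform only on strictly smaller sectors, so half of the angle
  is given away.\<close>

lemma sectorial_operatorI:
  assumes s: "complex_banach s" and lin: "linear_operator_on UNIV s D A" and sec: "complex_sectorial s D A \<theta>"
  shows "\<exists>\<epsilon> C. sectorial_operator s D A \<epsilon> C"
proof -
  have \<theta>: "0 < \<theta>" "\<theta> \<le> pi / 2" and sub: "sector \<theta> \<subseteq> resolvent_set s D A"
    using sec by (auto simp: complex_sectorial_def)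
  obtain C where C: "C \<ge> 1" "\<forall>\<mu>\<in>closure (sector (\<theta> - \<theta> / 2)). \<mu> \<noteq> 0 \<longrightarrow> onorm (resolvent s D A \<mu>) \<le> C / cmod \<mu>"
  proof -
    have "0 < \<theta> / 2 \<and> \<theta> / 2 < \<theta>" using \<theta> by simp
    then show ?thesis using sec that unfolding complex_sectorial_def by blast
  qed
  \<comment> \<open>Since cos(\<theta>/2 + \<pi>/2) = -sin(\<theta>/2), the condition Re \<mu> >
    -\<epsilon> |\<mu>| forces |Arg \<mu>| below \<theta>/2 + \<pi>/2.\<close>
  define \<epsilon> where "\<epsilon> = sin (\<theta> / 2)"
  have mem: "\<mu> \<in> sector (\<theta> - \<theta> / 2) \<and> \<mu> \<in> sector \<theta> \<and> \<mu> \<noteq> 0" if \<mu>: "- \<epsilon> * cmod \<mu> < Re \<mu>" for \<mu>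
  proof -
    have m0: "\<mu> \<noteq> 0" using \<mu> by auto
    have "Re \<mu> = cmod \<mu> * cos \<bar>Arg \<mu>\<bar>"
      using arg_cong[OF rcis_cmod_Arg[of \<mu>], of Re] by simp
    then have "cmod \<mu> * (- \<epsilon>) < cmod \<mu> * cos \<bar>Arg \<mu>\<bar>" using \<mu> by (simp add: mult.commute)
    then have "- sin (\<theta> / 2) < cos \<bar>Arg \<mu>\<bar>"
      unfolding \<epsilon>_def by (rule mult_left_less_imp_less) simp
    then have c: "cos (\<theta> / 2 + pi / 2) < cos \<bar>Arg \<mu>\<bar>" by (simp add: cos_add)
    have "\<bar>Arg \<mu>\<bar> < \<theta> / 2 + pi / 2"
    proof (rule ccontr)
      assume "\<not> \<bar>Arg \<mu>\<bar> < \<theta> / 2 + pi / 2"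
      then have "cos \<bar>Arg \<mu>\<bar> \<le> cos (\<theta> / 2 + pi / 2)"
        using Arg_bounded[of \<mu>] \<theta> by (intro cos_monotone_0_pi_le) auto
      then show False using c by simp
    qed
    then show ?thesis using m0 \<theta> by (auto simp: sector_def)
  qed
  have "sectorial_operator s D A \<epsilon> C"
  proof (rule sectorial_operator.intro[OF s], rule sectorial_operator_axioms.intro)
    show "0 < \<epsilon>" using \<theta> by (auto simp: \<epsilon>_def intro!: sin_gt_zero)
    fix \<mu> assume "- \<epsilon> * cmod \<mu> < Re \<mu>"
    note \<mu> = mem[OF this]
    show "\<mu> \<in> resolvent_set s D A \<and> onorm (resolvent s D A \<mu>) \<le> C / cmod \<mu>"
    proof
      show "\<mu> \<in> resolvent_set s D A" using \<mu> sub by auto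
      have "\<mu> \<in> closure (sector (\<theta> - \<theta> / 2))" using \<mu> closure_subset by auto
      then show "onorm (resolvent s D A \<mu>) \<le> C / cmod \<mu>" using \<mu> C(2) by simp
    qed
  qed (fact lin C(1))+
  then show ?thesis by blast
qed

section \<open>The symbol of the resolvent family\<close>

lemma cmod_powr_of_real: "z \<noteq> 0 \<Longrightarrow> cmod (z powr of_real r) = cmod z powr r"
  by (simp add: powr_def norm_exp)

lemma has_vector_derivative_cexp:
  fixes z :: complex
  shows
  "((\<lambda>u. exp (- (z * of_real u))) has_vector_derivative - z * exp (- (z * of_real r))) (at r within S)"
proof -
  have "((\<lambda>u. exp (- (z * u))) has_field_derivative - z * exp (- (z * of_real r))) (at (complex_of_real r))"
    by (auto intro!: derivative_eq_intros)
  then show ?thesis by (rule has_vector_derivative_real_field)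
qed

lemma kernel_eq: "kernel \<alpha> \<beta> \<nu> u = \<alpha> / Gamma \<nu> * (u powr (\<nu> - 1) * exp (- \<beta> * u))"
  by (simp add: kernel_def)

section \<open>The kernel and its primitive\<close>

locale volterra_kernel =
  fixes \<alpha> \<beta> \<nu> :: real
  assumes \<alpha>: "\<alpha> > 0" and \<beta>: "\<beta> \<ge> 0" and \<nu>: "0 < \<nu>" "\<nu> < 1"
begin

text \<open>This is 1 * \<kappa>. Unlike \<kappa>, which is singular at 0, it is continuous up to
  the end point, and the convolutions below are formed with it.\<close>

definition k1 :: "real \<Rightarrow> real" where "k1 t = integral {0..t} (kernel \<alpha> \<beta> \<nu>)"

lemma kernel_nonneg: "0 \<le> kernel \<alpha> \<beta> \<nu> u"
  unfolding kernel_eq using \<alpha> \<nu> by (intro mult_nonneg_nonneg divide_nonneg_nonneg) (auto simp: Gamma_real_pos less_imp_le)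

lemma kernel_absolutely_integrable:
  assumes "v \<ge> 0"
  shows "kernel \<alpha> \<beta> \<nu> absolutely_integrable_on {0..v}"
proof (rule measurable_bounded_by_integrable_imp_absolutely_integrable)
  have "kernel \<alpha> \<beta> \<nu> \<in> borel_measurable borel"
    unfolding kernel_eq[abs_def] by measurable
  then show "kernel \<alpha> \<beta> \<nu> \<in> borel_measurable (lebesgue_on {0..v})"
    by (intro measurable_restrict_space1 measurable_completion) simp
  show "(\<lambda>u. \<alpha> / Gamma \<nu> * u powr (\<nu> - 1)) integrable_on {0..v}"
    using \<nu> assms by (intro integrable_on_mult_right integrable_on_powr_from_0) auto
  fix u :: real assume u: "u \<in> {0..v}"
  have "\<alpha> / Gamma \<nu> * (u powr (\<nu> - 1) * exp (- \<beta> * u)) \<le> \<alpha> / Gamma \<nu> * (u powr (\<nu> - 1) * 1)"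
    using u \<alpha> \<beta> \<nu> by (intro mult_left_mono) (auto simp: Gamma_real_pos less_imp_le)
  then show "norm (kernel \<alpha> \<beta> \<nu> u) \<le> \<alpha> / Gamma \<nu> * u powr (\<nu> - 1)"
    using kernel_nonneg[of u] by (simp add: kernel_eq)
qed simp

lemma kernel_integrable: "v \<ge> 0 \<Longrightarrow> kernel \<alpha> \<beta> \<nu> integrable_on {0..v}"
  using kernel_absolutely_integrable by (simp add: absolutely_integrable_on_def)

lemma continuous_on_k1: "continuous_on {0..v} k1"
proof (cases "v \<ge> 0")
  case True
  then show ?thesis unfolding k1_def[abs_def] by (intro indefinite_integral_continuous_1 kernel_integrable)
qed simp

lemma k1_0: "k1 0 = 0" by (simp add: k1_def)

lemma k1_nonneg: "v \<ge> 0 \<Longrightarrow> k1 v \<ge> 0"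
  unfolding k1_def by (intro integral_nonneg kernel_integrable kernel_nonneg)

lemma k1_mono: "0 \<le> v \<Longrightarrow> v \<le> w \<Longrightarrow> k1 v \<le> k1 w"
  unfolding k1_def by (intro integral_subset_le kernel_integrable) (auto intro: kernel_nonneg)

lemma continuous_on_k1_compose:
  assumes "continuous_on S f" "\<And>x. x \<in> S \<Longrightarrow> 0 \<le> f x"
  shows "continuous_on S (\<lambda>x. k1 (f x))"
proof (rule continuous_on_compose2[of "{0..}" k1 S f])
  show "continuous_on {0..} k1"
  proof (clarsimp simp: continuous_on_eq_continuous_within)
    fix x :: real assume x: "0 \<le> x"
    have "continuous (at x within {0..x+1}) k1"
      using continuous_on_k1[of "x + 1"] x by (simp add: continuous_on_eq_continuous_within)
    moreover have "at x within {0..x+1} = at x within {0..}"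
      by (rule at_within_nhd[of _ "{..<x+1}"]) (use x in auto)
    ultimately show "continuous (at x within {0..}) k1" by (simp add: continuous_within)
  qed
qed (use assms in auto)

end

locale resolvent_symbol = sectorial_operator + volterra_kernel +
  fixes T :: real
  assumes T: "T > 0"
begin

text \<open>The bound for |kap|: being at most 1/2 it keeps 1 + kap away from 0, and being at most
  \<epsilon>/4 it keeps \<open>m z\<close> in the sector. The number \<open>a\<close> is the
  solution of \<alpha> a^(-\<nu>) = \<delta>.\<close>

definition \<delta> where "\<delta> = min (1 / 2) (\<epsilon> / 4)"
definition a where "a = (\<delta> / \<alpha>) powr (- 1 / \<nu>)"

text \<open>\<open>kap\<close> is the Laplace transform of the kernel \<open>\<kappa>\<close>. Transforming the resolvent equation yields
  \<open>H(z) = (z - (1 + kap z) A)\<^sup>-\<^sup>1 = c(z) (m(z) - A)\<^sup>-\<^sup>1\<close>, and \<open>a\<close> is so large that \<open>|kap z| \<le> \<delta>\<close> for \<open>Re z \<ge> a\<close>,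
  which keeps \<open>m(z)\<close> inside the sector.\<close>

definition kap :: "complex \<Rightarrow> complex" where
  "kap z = of_real \<alpha> * (z + of_real \<beta>) powr of_real (- \<nu>)"
definition kap' :: "complex \<Rightarrow> complex" where
  "kap' z = - (of_real \<alpha> * of_real \<nu> * (z + of_real \<beta>) powr of_real (- \<nu> - 1))"

definition c where "c z = 1 / (1 + kap z)"
definition c' where "c' z = - kap' z * (c z)\<^sup>2"
definition m where "m z = z * c z"
definition m' where "m' z = c z + z * c' z"

definition H where "H z = op_scale s (c z) (res (m z))"
definition H' where "H' z = op_scale s (c' z) (res (m z)) + op_scale s (c z) (op_scale s (m' z) (- (res (m z) o\<^sub>L res (m z))))"

section \<open>Estimates of the symbol on the half plane\<close>

lemma \<delta>: "\<delta> > 0" "\<delta> \<le> 1 / 2" "\<delta> \<le> \<epsilon> / 4"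
  using \<epsilon> by (auto simp: \<delta>_def)

lemma a: "a > 0" using \<delta> \<alpha> by (simp add: a_def)

lemma a_powr: "\<alpha> * a powr (- \<nu>) = \<delta>"
  using \<delta> \<alpha> \<nu> by (simp add: a_def powr_powr)

context
  fixes z :: complex
  assumes z: "a \<le> Re z"
begin

lemma z0: "z \<noteq> 0" "0 < Re z" "z + of_real \<beta> \<noteq> 0" "0 < Re (z + of_real \<beta>)"
  using z a \<beta> by (auto simp: complex_eq_iff)

lemma nonpos: "z + of_real \<beta> \<notin> \<real>\<^sub>\<le>\<^sub>0"
  using z0(4) by (auto simp: complex_nonpos_Reals_iff)

lemma cmod_z\<beta>: "cmod z \<le> cmod (z + of_real \<beta>)" "a \<le> cmod (z + of_real \<beta>)"
proof -
  show "cmod z \<le> cmod (z + of_real \<beta>)"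
  proof -
    have "(Re z)\<^sup>2 \<le> (Re (z + of_real \<beta>))\<^sup>2" using \<beta> z0(2) by (intro power_mono) auto
    then show ?thesis unfolding cmod_def by (intro real_sqrt_le_mono) simp
  qed
  then show "a \<le> cmod (z + of_real \<beta>)" using z complex_Re_le_cmod[of z] by linarith
qed

lemma norm_kap: "cmod (kap z) \<le> \<delta>"
proof -
  have "cmod (kap z) = \<alpha> * cmod (z + of_real \<beta>) powr (- \<nu>)"
    unfolding kap_def norm_mult cmod_powr_of_real[OF z0(3)] using \<alpha> by simp
  also have "\<dots> \<le> \<alpha> * a powr (- \<nu>)"
    using cmod_z\<beta> a \<nu> \<alpha> by (intro mult_left_mono powr_mono2') auto
  finally show ?thesis by (simp add: a_powr)
qed

lemma DERIV_kap: "(kap has_field_derivative kap' z) (at z)"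
proof -
  have "((\<lambda>z. of_real \<alpha> * (z + of_real \<beta>) powr of_real (- \<nu>)) has_field_derivative
    of_real \<alpha> * (of_real (- \<nu>) * (z + of_real \<beta>) powr (of_real (- \<nu>) - 1))) (at z)"
    by (intro DERIV_cmult DERIV_shift[THEN iffD1] has_field_derivative_powr nonpos)
  then show ?thesis by (simp add: kap_def[abs_def] kap'_def mult_ac)
qed

text \<open>Since kap' = -\<nu> kap / (z + \<beta>) and |z| \<le> |z + \<beta>| on the half plane,
  |z kap'| is at most \<nu> \<delta>.\<close>

lemma norm_kap': "cmod z * cmod (kap' z) \<le> 1"
proof -
  have "cmod (kap' z) = \<alpha> * \<nu> * cmod (z + of_real \<beta>) powr (- \<nu> - 1)"
    unfolding kap'_def norm_minus_cancel norm_mult cmod_powr_of_real[OF z0(3)] using \<alpha> \<nu> by simp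
  also have "\<dots> = \<nu> * (\<alpha> * cmod (z + of_real \<beta>) powr (- \<nu>)) / cmod (z + of_real \<beta>)"
    using z0(3) by (simp add: powr_diff)
  also have "\<alpha> * cmod (z + of_real \<beta>) powr (- \<nu>) \<le> \<alpha> * a powr (- \<nu>)"
    using cmod_z\<beta> a \<nu> \<alpha> by (intro mult_left_mono powr_mono2') auto
  also have "\<nu> * (\<alpha> * a powr (- \<nu>)) / cmod (z + of_real \<beta>) \<le> 1 * 1 / cmod z"
    unfolding a_powr using \<nu> \<delta> cmod_z\<beta> z0 by (intro frac_le mult_mono) auto
  finally have "cmod (kap' z) \<le> 1 / cmod z" using \<nu> by (simp add: mult_left_mono divide_right_mono)
  then show ?thesis using z0(1) by (simp add: field_simps)
qed

lemma one_plus_kap: "1 + kap z \<noteq> 0" "cmod (1 + kap z) \<ge> 1 / 2" "cmod (1 + kap z) \<le> 3 / 2"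
proof -
  show "cmod (1 + kap z) \<ge> 1 / 2"
    using norm_kap \<delta> norm_triangle_ineq2[of 1 "- kap z"] by simp
  then show "1 + kap z \<noteq> 0" by auto
  show "cmod (1 + kap z) \<le> 3 / 2"
    using norm_kap \<delta> norm_triangle_ineq[of 1 "kap z"] by simp
qed

lemma norm_c: "cmod (c z) \<le> 2"
  using one_plus_kap by (simp add: c_def norm_divide field_simps)

lemma norm_c': "cmod z * cmod (c' z) \<le> 4"
proof -
  have "cmod z * cmod (c' z) = (cmod z * cmod (kap' z)) * (cmod (c z))\<^sup>2"
    by (simp add: c'_def norm_mult norm_power)
  also have "\<dots> \<le> 1 * 2\<^sup>2" using norm_kap' norm_c by (intro mult_mono power_mono) auto
  finally show ?thesis by simp
qed

lemma norm_m: "cmod (m z) \<le> 2 * cmod z" "2 / 3 * cmod z \<le> cmod (m z)" "m z \<noteq> 0"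
  using norm_c mult_left_mono[OF norm_c, of "cmod z"] mult_left_mono[OF one_plus_kap(3), of "cmod z"] one_plus_kap z0(1)
  by (auto simp: m_def norm_mult c_def norm_divide field_simps)

text \<open>From m = z - m kap and |kap| \<le> \<epsilon> one gets Re m \<ge> Re z - \<epsilon> |m|,
  and Re z is positive.\<close>

lemma m_\<Omega>: "m z \<in> \<Omega>"
proof -
  have "m z = z - z * kap z * c z"
    using one_plus_kap(1) by (simp add: m_def c_def field_simps)
  then have "Re (m z) \<ge> Re z - cmod (z * kap z * c z)"
    using abs_Re_le_cmod[of "z * kap z * c z"] by simp
  moreover have "cmod (z * kap z * c z) = cmod (m z) * cmod (kap z)" by (simp add: m_def norm_mult)
  moreover have "cmod (m z) * cmod (kap z) \<le> cmod (m z) * \<epsilon>"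
    using norm_kap \<delta> \<epsilon> by (intro mult_left_mono) auto
  ultimately show ?thesis using z0(2) by (simp add: mult.commute)
qed

lemma norm_res_m: "norm (res (m z)) \<le> 2 * C / cmod z"
proof -
  have "norm (res (m z)) \<le> C / cmod (m z)" by (rule norm_res[OF m_\<Omega>])
  also have "\<dots> \<le> C / (2 / 3 * cmod z)"
    using norm_m z0 C by (intro divide_left_mono mult_pos_pos) auto
  also have "\<dots> \<le> 2 * C / cmod z" using C z0(1) by (simp add: field_simps)
  finally show ?thesis .
qed

lemma DERIV_c: "(c has_field_derivative c' z) (at z)"
proof -
  have "((\<lambda>z. 1 / (1 + kap z)) has_field_derivative (0 * (1 + kap z) - 1 * (0 + kap' z)) / ((1 + kap z) * (1 + kap z))) (at z)"
    by (intro DERIV_divide DERIV_add DERIV_kap DERIV_const one_plus_kap)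
  then show ?thesis by (simp add: c_def[abs_def] c'_def power2_eq_square)
qed

lemma DERIV_m: "(m has_field_derivative m' z) (at z)"
proof -
  have "((\<lambda>z. z * c z) has_field_derivative 1 * c z + c' z * z) (at z)"
    by (intro DERIV_mult DERIV_ident DERIV_c)
  then show ?thesis by (simp add: m_def[abs_def] m'_def mult.commute)
qed

lemma norm_m': "cmod (m' z) \<le> 6"
  using norm_triangle_ineq[of "c z" "z * c' z"] norm_c norm_c' by (simp add: m'_def norm_mult)

end

lemma continuous_kap: "continuous_on {z. a \<le> Re z} kap" "continuous_on {z. a \<le> Re z} kap'"
proof -
  have powr: "continuous_on {z. a \<le> Re z} (\<lambda>z. (z + of_real \<beta>) powr of_real q)" for q
  proof (rule continuous_on_powr_complex)
    show "{z. a \<le> Re z} \<subseteq> {z. Re (z + of_real \<beta>) \<ge> 0 \<or> Im (z + of_real \<beta>) \<noteq> 0}"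
      using z0(4) by (auto intro: less_imp_le)
    show "Re (of_real q) > 0" if "z \<in> {z. a \<le> Re z}" "z + of_real \<beta> = 0" for z
      using z0(3)[of z] that by simp
  qed (intro continuous_intros)+
  show "continuous_on {z. a \<le> Re z} kap"
    unfolding kap_def by (rule continuous_on_mult_left[OF powr])
  show "continuous_on {z. a \<le> Re z} kap'"
    unfolding kap'_def by (rule continuous_on_minus[OF continuous_on_mult_left[OF powr]])
qed

lemma continuous_symbols:
  "continuous_on {z. a \<le> Re z} c" "continuous_on {z. a \<le> Re z} c'" "continuous_on {z. a \<le> Re z} m"
  "continuous_on {z. a \<le> Re z} m'" "continuous_on {z. a \<le> Re z} (\<lambda>z. res (m z))"
proof -
  show 1: "continuous_on {z. a \<le> Re z} c"
    unfolding c_def using one_plus_kap(1) by (auto intro!: continuous_intros continuous_kap)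
  show 2: "continuous_on {z. a \<le> Re z} c'"
    unfolding c'_def by (intro continuous_intros continuous_kap 1)
  show 3: "continuous_on {z. a \<le> Re z} m" unfolding m_def by (intro continuous_intros 1)
  show "continuous_on {z. a \<le> Re z} m'" unfolding m'_def by (intro continuous_intros 1 2)
  show "continuous_on {z. a \<le> Re z} (\<lambda>z. res (m z))"
    by (rule continuous_on_compose2[OF continuous_on_res 3]) (use m_\<Omega> in auto)
qed

text \<open>The two terms of \<open>H'\<close> are bounded by 4 * 2 C and 2 * 6 * (2 C)^2 over
  |z|^2, from |c| \<le> 2, |z c'| \<le> 4, |m'| \<le> 6 and the resolvent bound 2 C/|z|. The bound 4
  C/|z| of \<open>H\<close> is enlarged to the same constant.\<close>

sublocale half_plane_symbol s H H' a "8 * C + 48 * C\<^sup>2"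
proof (rule half_plane_symbol.intro[OF _ op_space], unfold_locales)
  interpret op: complex_banach "op_scale s" by (rule op_space)
  show "0 < a" by (rule a)
  fix z assume z: "a \<le> Re z"
  show "op.has_cderiv H (H' z) z"
    unfolding H_def[abs_def] H'_def
    by (intro op.has_cderiv_scale op.has_cderiv_chain has_cderiv_res m_\<Omega> DERIV_c DERIV_m z)
  have n: "norm (res (m z)) \<le> 2 * C / cmod z" "cmod (c z) \<le> 2" using norm_res_m norm_c z by auto
  have z0: "cmod z > 0" using z0(1)[OF z] by simp
  have "norm (H z) \<le> 2 * (2 * C / cmod z)"
    unfolding H_def op.norm_s using n C by (intro mult_mono) auto
  also have "\<dots> \<le> (8 * C + 48 * C\<^sup>2) / cmod z" using z0 C by (simp add: field_simps)
  finally show "norm (H z) \<le> (8 * C + 48 * C\<^sup>2) / cmod z" .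
  have "norm (op_scale s (c' z) (res (m z))) \<le> 4 / cmod z * (2 * C / cmod z)"
    unfolding op.norm_s using norm_c'[OF z] z0 n C by (intro mult_mono) (auto simp: field_simps)
  moreover have "norm (op_scale s (c z) (op_scale s (m' z) (- (res (m z) o\<^sub>L res (m z))))) \<le> 2 * (6 * ((2 * C / cmod z) * (2 * C / cmod z)))"
    unfolding op.norm_s norm_minus_cancel using norm_m'[OF z] n C
    by (intro mult_mono order_trans[OF norm_blinfun_compose]) auto
  ultimately have "norm (H' z) \<le> 4 / cmod z * (2 * C / cmod z) + 2 * (6 * ((2 * C / cmod z) * (2 * C / cmod z)))"
    unfolding H'_def by (rule norm_triangle_mono)
  also have "\<dots> = (8 * C + 48 * C\<^sup>2) / (cmod z)\<^sup>2" using z0 by (simp add: field_simps power2_eq_square)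
  finally show "norm (H' z) \<le> (8 * C + 48 * C\<^sup>2) / (cmod z)\<^sup>2" .
next
  interpret op: complex_banach "op_scale s" by (rule op_space)
  show "continuous_on {z. a \<le> Re z} H'"
    unfolding H'_def
    by (intro continuous_intros op.s.continuous_on bounded_bilinear.continuous_on[OF bounded_bilinear_blinfun_compose] continuous_symbols)
qed

lemma inverse_transform_compact:
  assumes "complex_compact_resolvent s D A" "t \<ge> 0"
  shows "compact_operator (inverse_transform t)"
proof -
  have sc: "op_scale s q X \<in> compact_ops" if "X \<in> compact_ops" for q X
    by (rule compact_ops_compose_left[OF that s.bounded_linear_right]) simp
  have "inverse_transform t \<in> compact_ops"
  proof (rule inverse_transform_in_closed_subspace[OF closed_compact_ops subspace_compact_ops sc _ assms(2)])
    fix z assume z: "a \<le> Re z"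
    have r: "res (m z) \<in> compact_ops"
      using res_compact[OF assms(1)] sector_bound m_\<Omega>[OF z] by auto
    show "H' z \<in> compact_ops"
      unfolding H'_def using r
      by (intro subspace_add[OF subspace_compact_ops] sc subspace_neg[OF subspace_compact_ops] compact_ops_compose_right)
  qed
  then show ?thesis by (simp add: compact_ops_def)
qed

section \<open>The resolvent equation transformed over a bounded interval\<close>

definition kap_upto :: "complex \<Rightarrow> real \<Rightarrow> complex" where
  "kap_upto z v = integral {0..v} (\<lambda>u. exp (- (z * of_real u)) * of_real (kernel \<alpha> \<beta> \<nu> u))"

lemma kap_upto_integrable:
  fixes z :: complex
  assumes v: "v \<ge> 0"
  shows "(\<lambda>u. exp (- (z * of_real u)) * of_real (kernel \<alpha> \<beta> \<nu> u)) integrable_on {0..v}"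
proof -
  have 1: "(\<lambda>u. complex_of_real (kernel \<alpha> \<beta> \<nu> u)) absolutely_integrable_on {0..v}"
    using absolutely_integrable_linear[OF kernel_absolutely_integrable[OF v] bounded_linear_of_real] by (simp add: o_def)
  have 2: "(\<lambda>u. exp (- (z * of_real u))) \<in> borel_measurable (lebesgue_on {0..v})"
    by (intro continuous_imp_measurable_on_sets_lebesgue continuous_intros) auto
  have 3: "bounded ((\<lambda>u. exp (- (z * of_real u))) ` {0..v})"
    by (intro compact_imp_bounded compact_continuous_image continuous_intros) auto
  have 4: "bilinear ((*) :: complex \<Rightarrow> complex \<Rightarrow> complex)"
    unfolding bilinear_conv_bounded_bilinear by (rule bounded_bilinear_mult)
  have "(\<lambda>u. exp (- (z * of_real u)) * of_real (kernel \<alpha> \<beta> \<nu> u)) absolutely_integrable_on {0..v}"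
    by (rule absolutely_integrable_bounded_measurable_product[OF 4 2 _ 3 1]) simp
  then show ?thesis by (simp add: absolutely_integrable_on_def)
qed

text \<open>The tail of the power u^(\<nu>-1) at p = z + \<beta>; the factor e^(-v \<beta>) is
  dropped, and the remaining power of Re p is estimated by its value at a, which yields
  \<open>\<delta>\<close>.\<close>

lemma kap_tail:
  assumes z: "a \<le> Re z" and v: "v \<ge> 0"
  shows "cmod (kap z - kap_upto z v) \<le> exp (- v * Re z) * \<delta>"
proof -
  let ?p = "z + of_real \<beta>"
  have G: "Gamma \<nu> > 0" using \<nu> by (simp add: Gamma_real_pos)
  have "kap_upto z v = integral {0..v} (\<lambda>u. of_real (\<alpha> / Gamma \<nu>) * (of_real (u powr (\<nu> - 1)) * exp (- ?p * of_real u)))"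
    unfolding kap_upto_def kernel_eq
    by (intro integral_cong) (simp add: exp_of_real[symmetric] exp_add[symmetric] algebra_simps)
  also have "\<dots> = of_real (\<alpha> / Gamma \<nu>) * integral {0..v} (\<lambda>u. of_real (u powr (\<nu> - 1)) * exp (- ?p * of_real u))"
    by (rule integral_mult_right)
  finally have "kap z - kap_upto z v = of_real (\<alpha> / Gamma \<nu>) * (of_real (Gamma \<nu>) * ?p powr (- of_real \<nu>)
    - integral {0..v} (\<lambda>u. of_real (u powr (\<nu> - 1)) * exp (- ?p * of_real u)))"
    using G by (simp add: kap_def right_diff_distrib)
  also have "cmod \<dots> \<le> \<alpha> / Gamma \<nu> * (exp (- v * Re ?p) * (Gamma \<nu> * Re ?p powr (- \<nu>)))"
  proof -
    have "\<bar>\<alpha> / Gamma \<nu>\<bar> = \<alpha> / Gamma \<nu>" using G \<alpha> by simp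
    then show ?thesis
      unfolding norm_mult norm_of_real
      using G \<alpha> laplace_powr_tail[OF \<nu> z0(4)[OF z] v] by (simp only:) (intro mult_left_mono; simp)
  qed
  also have "\<dots> = exp (- v * Re ?p) * (\<alpha> * Re ?p powr (- \<nu>))" using G by simp
  also have "\<dots> \<le> exp (- v * Re z) * (\<alpha> * a powr (- \<nu>))"
    using z v \<beta> a \<alpha> \<nu> by (intro mult_mono mult_left_mono powr_mono2') (auto simp: mult_left_mono)
  finally show ?thesis by (simp add: a_powr)
qed

text \<open>Integration by parts with k1' = \<kappa>. Because \<kappa> is singular at 0, this
  derivative is available in the open interval only, whence the interior form of the fundamental
  theorem.\<close>

lemma laplace_k1:
  assumes z: "z \<noteq> 0" and v: "v \<ge> 0"
  shows "((\<lambda>u. exp (- (z * of_real u)) * of_real (k1 u)) has_integral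
    (kap_upto z v - exp (- (z * of_real v)) * of_real (k1 v)) / z) {0..v}"
proof -
  let ?F = "\<lambda>u. exp (- (z * of_real u)) * of_real (k1 u)"
  let ?k = "\<lambda>u. exp (- (z * of_real u)) * of_real (kernel \<alpha> \<beta> \<nu> u)"
  have "((\<lambda>u. ?k u - z * ?F u) has_integral ?F v - ?F 0) {0..v}"
  proof (rule fundamental_theorem_of_calculus_interior[OF v])
    show "continuous_on {0..v} ?F" by (intro continuous_intros continuous_on_k1)
    fix u assume u: "u \<in> {0<..<v}"
    have "(k1 has_vector_derivative kernel \<alpha> \<beta> \<nu> u) (at u within {0..v})"
      unfolding k1_def[abs_def]
    proof (rule integral_has_vector_derivative_continuous_at[where S = "{}", unfolded Diff_empty])
      show "kernel \<alpha> \<beta> \<nu> integrable_on {0..v}" by (rule kernel_integrable[OF v])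
      show "continuous (at u within {0..v}) (kernel \<alpha> \<beta> \<nu>)"
        unfolding kernel_eq[abs_def] using u by (intro continuous_intros) auto
    qed (use u in auto)
    then have "(k1 has_vector_derivative kernel \<alpha> \<beta> \<nu> u) (at u)"
      using at_within_Icc_at[of 0 u v] u by simp
    then have 1: "((\<lambda>u. complex_of_real (k1 u)) has_vector_derivative of_real (kernel \<alpha> \<beta> \<nu> u)) (at u)"
      by (rule bounded_linear.has_vector_derivative[OF bounded_linear_of_real])
    have 2: "((\<lambda>u. exp (- (z * of_real u))) has_vector_derivative - z * exp (- (z * of_real u))) (at u)"
      by (rule has_vector_derivative_cexp)
    show "(?F has_vector_derivative ?k u - z * ?F u) (at u)"
      using has_vector_derivative_mult[OF 2 1] by (simp add: algebra_simps)
  qed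
  from has_integral_diff[OF integrable_integral[OF kap_upto_integrable[OF v, of z]] this]
  have "((\<lambda>u. z * ?F u) has_integral kap_upto z v - ?F v) {0..v}"
    by (simp add: kap_upto_def k1_0)
  from has_integral_mult_right[OF this, of "1 / z"] show ?thesis using z by (simp add: field_simps)
qed

text \<open>Convolution with 1 + 1 * \<kappa>. For the orbit g(t) = G(t) x the resolvent equation
  reads \<open>A (convolved g r) = g r - x\<close>, the form in which it is transformed.\<close>

definition convolved :: "(real \<Rightarrow> 'a) \<Rightarrow> real \<Rightarrow> 'a" where
  "convolved g r = integral {0..r} (\<lambda>q. (1 + k1 (r - q)) *\<^sub>R g q)"

context
  fixes g :: "real \<Rightarrow> 'a"
  assumes g: "continuous_on {0..T} g"
begin

text \<open>As \<open>k1 0 = 0\<close>, cutting off with \<open>max\<close> extends the kernel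
  continuously across q = r. The second part then has a continuous integrand on the whole square, so
  the order of integration can be exchanged without passing to a triangle.\<close>

lemma convolved_eq:
  assumes r: "r \<in> {0..T}"
  shows "convolved g r = integral {0..r} g + integral {0..T} (\<lambda>q. k1 (max 0 (r - q)) *\<^sub>R g q)"
proof -
  have c: "continuous_on {0..T} (\<lambda>q. k1 (max 0 (r - q)) *\<^sub>R g q)"
    by (intro continuous_intros continuous_on_k1_compose g) auto
  have "convolved g r = integral {0..r} (\<lambda>q. g q + k1 (max 0 (r - q)) *\<^sub>R g q)"
    unfolding convolved_def by (intro integral_cong) (simp add: scaleR_add_left)
  also have "\<dots> = integral {0..r} g + integral {0..r} (\<lambda>q. k1 (max 0 (r - q)) *\<^sub>R g q)"
    using r by (intro integral_add integrable_continuous_real continuous_on_subset[OF g] continuous_on_subset[OF c]) auto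
  also have "integral {0..r} (\<lambda>q. k1 (max 0 (r - q)) *\<^sub>R g q) = integral {0..T} (\<lambda>q. k1 (max 0 (r - q)) *\<^sub>R g q)"
  proof -
    have "integral {0..T} (\<lambda>q. k1 (max 0 (r - q)) *\<^sub>R g q) = integral {0..T} (\<lambda>q. if q \<in> {0..r} then k1 (max 0 (r - q)) *\<^sub>R g q else 0)"
      by (intro integral_cong) (auto simp: max_def k1_0)
    also have "\<dots> = integral {0..r} (\<lambda>q. k1 (max 0 (r - q)) *\<^sub>R g q)"
      using integral_restrict_Int[of "{0..T}" "{0..r}" "\<lambda>q. k1 (max 0 (r - q)) *\<^sub>R g q"] r by simp
    finally show ?thesis by simp
  qed
  finally show ?thesis .
qed

lemma continuous_on_convolved_parts:
  "continuous_on {0..T} (\<lambda>r. integral {0..r} g)"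
  "continuous_on {0..T} (\<lambda>r. integral {0..T} (\<lambda>q. k1 (max 0 (r - q)) *\<^sub>R g q))"
proof -
  show "continuous_on {0..T} (\<lambda>r. integral {0..r} g)"
    by (intro indefinite_integral_continuous_1 integrable_continuous_real g)
  have "continuous_on ({0..T} \<times> cbox 0 T) (\<lambda>(r, q). k1 (max 0 (r - q)) *\<^sub>R g q)"
    unfolding split_beta by (intro continuous_intros continuous_on_k1_compose continuous_on_compose2[OF g]) auto
  from integral_continuous_on_param[OF this]
  show "continuous_on {0..T} (\<lambda>r. integral {0..T} (\<lambda>q. k1 (max 0 (r - q)) *\<^sub>R g q))" by simp
qed

lemma continuous_on_convolved: "continuous_on {0..T} (convolved g)"
  using continuous_on_add[OF continuous_on_convolved_parts] by (rule continuous_on_eq) (simp add: convolved_eq)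

text \<open>By parts; the boundary value at T is itself an integral of \<open>g\<close> and is
  merged with the rest, so that a single integral against \<open>g\<close> remains.\<close>

lemma laplace_on_integral:
  assumes z: "z \<noteq> 0"
  shows "laplace_on T (\<lambda>r. integral {0..r} g) z = integral {0..T} (\<lambda>q. s ((exp (- (z * of_real q)) - exp (- (z * of_real T))) / z) (g q))"
proof -
  let ?G = "\<lambda>r. integral {0..r} g"
  let ?e = "\<lambda>r. exp (- (z * of_real r))"
  have "((\<lambda>r. s (?e r) (g r) - s z (s (?e r) (?G r))) has_integral s (?e T) (?G T) - s (?e 0) (?G 0)) {0..T}"
  proof (rule fundamental_theorem_of_calculus)
    fix r assume r: "r \<in> {0..T}"
    have 1: "(?G has_vector_derivative g r) (at r within {0..T})"
      by (rule integral_has_vector_derivative[OF g r])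
    have 2: "(?e has_vector_derivative - z * ?e r) (at r within {0..T})"
      by (rule has_vector_derivative_cexp)
    show "((\<lambda>r. s (?e r) (?G r)) has_vector_derivative s (?e r) (g r) - s z (s (?e r) (?G r))) (at r within {0..T})"
      using s.has_vector_derivative[OF 2 1] by (simp add: s_mult s.minus_left)
  qed (use T in simp)
  then have "integral {0..T} (\<lambda>r. s (?e r) (g r) - s z (s (?e r) (?G r))) = s (?e T) (?G T)"
    by (simp add: integral_unique s.zero_right)
  moreover have i1: "(\<lambda>r. s (?e r) (g r)) integrable_on {0..T}" "(\<lambda>r. s (?e r) (?G r)) integrable_on {0..T}"
    by (intro integrable_continuous_real s.continuous_on continuous_intros g continuous_on_convolved_parts)+
  moreover have "(\<lambda>r. s z (s (?e r) (?G r))) integrable_on {0..T}"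
    using integrable_linear[OF i1(2) s.bounded_linear_right[of z]] by (simp add: o_def)
  moreover have "integral {0..T} (\<lambda>r. s z (s (?e r) (?G r))) = s z (laplace_on T ?G z)"
    unfolding laplace_on_def using integral_linear[OF i1(2) s.bounded_linear_right[of z]] by (simp add: o_def)
  ultimately have "s z (laplace_on T ?G z) = integral {0..T} (\<lambda>r. s (?e r) (g r)) - s (?e T) (?G T)"
    by (simp add: integral_diff algebra_simps)
  also have "s (?e T) (?G T) = integral {0..T} (\<lambda>q. s (?e T) (g q))"
    using integral_linear[OF integrable_continuous_real[OF g] s.bounded_linear_right[of "?e T"]] by (simp add: o_def)
  also have "integral {0..T} (\<lambda>r. s (?e r) (g r)) - integral {0..T} (\<lambda>q. s (?e T) (g q)) =
    integral {0..T} (\<lambda>q. s (?e q - ?e T) (g q))"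
    unfolding s.diff_left
    by (intro integral_diff[symmetric] i1 integrable_continuous_real s.continuous_on continuous_intros g)
  finally have "s (1 / z) (s z (laplace_on T ?G z)) = s (1 / z) (integral {0..T} (\<lambda>q. s (?e q - ?e T) (g q)))" by simp
  moreover have "(\<lambda>q. s (?e q - ?e T) (g q)) integrable_on {0..T}"
    by (intro integrable_continuous_real s.continuous_on continuous_intros g)
  then have "s (1 / z) (integral {0..T} (\<lambda>q. s (?e q - ?e T) (g q))) = integral {0..T} (\<lambda>q. s ((?e q - ?e T) / z) (g q))"
    by (drule_tac integral_linear[OF _ s.bounded_linear_right[of "1 / z"]]) (simp add: o_def s_mult)
  ultimately show ?thesis using z by (simp add: s_mult)
qed

text \<open>The translate by q of \<open>laplace_k1\<close> on [0, T - q]; the cut-off kernel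
  vanishes before q, so the interval may be enlarged to [0, T].\<close>

lemma laplace_k1_shift:
  assumes z: "z \<noteq> 0" and q: "q \<in> {0..T}"
  shows "integral {0..T} (\<lambda>r. exp (- (z * of_real r)) * of_real (k1 (max 0 (r - q)))) =
    (exp (- (z * of_real q)) * kap_upto z (T - q) - exp (- (z * of_real T)) * of_real (k1 (T - q))) / z"
proof -
  let ?f = "\<lambda>u. exp (- (z * of_real u)) * of_real (k1 u)"
  have "(?f has_integral (kap_upto z (T - q) - exp (- (z * of_real (T - q))) * of_real (k1 (T - q))) / z) (cbox 0 (T - q))"
    using laplace_k1[OF z, of "T - q"] q by simp
  from has_integral_affinity'[OF this, of 1 "- q"]
  have hi: "((\<lambda>r. ?f (r - q)) has_integral (kap_upto z (T - q) - exp (- (z * of_real (T - q))) * of_real (k1 (T - q))) / z) {q..T}"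
    by simp
  have veq: "exp (- (z * of_real q)) * ((kap_upto z (T - q) - exp (- (z * of_real (T - q))) * of_real (k1 (T - q))) / z) =
    (exp (- (z * of_real q)) * kap_upto z (T - q) - exp (- (z * of_real T)) * of_real (k1 (T - q))) / z"
  proof -
    have "exp (- (z * of_real q)) * exp (- (z * of_real (T - q))) = exp (- (z * of_real T))"
      by (simp add: algebra_simps flip: exp_add)
    then show ?thesis by (simp only: times_divide_eq_right right_diff_distrib mult.assoc[symmetric])
  qed
  from has_integral_mult_right[OF hi, of "exp (- (z * of_real q))"]
  have "((\<lambda>r. exp (- (z * of_real q)) * ?f (r - q)) has_integral
    (exp (- (z * of_real q)) * kap_upto z (T - q) - exp (- (z * of_real T)) * of_real (k1 (T - q))) / z) {q..T}"
    unfolding veq .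
  then have "((\<lambda>r. exp (- (z * of_real r)) * of_real (k1 (max 0 (r - q)))) has_integral
    (exp (- (z * of_real q)) * kap_upto z (T - q) - exp (- (z * of_real T)) * of_real (k1 (T - q))) / z) {q..T}"
  proof (rule has_integral_eq[rotated])
    fix r assume r: "r \<in> {q..T}"
    have "exp (- (z * of_real q)) * exp (- (z * of_real (r - q))) = exp (- (z * of_real r))"
      by (simp add: algebra_simps flip: exp_add)
    then show "exp (- (z * of_real q)) * ?f (r - q) = exp (- (z * of_real r)) * of_real (k1 (max 0 (r - q)))"
      using r by (simp add: mult.assoc[symmetric])
  qed
  then have "((\<lambda>r. if r \<in> {q..T} then exp (- (z * of_real r)) * of_real (k1 (max 0 (r - q))) else 0) has_integral
    (exp (- (z * of_real q)) * kap_upto z (T - q) - exp (- (z * of_real T)) * of_real (k1 (T - q))) / z) {0..T}"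
    using q by (subst has_integral_restrict) auto
  then have "((\<lambda>r. exp (- (z * of_real r)) * of_real (k1 (max 0 (r - q)))) has_integral
    (exp (- (z * of_real q)) * kap_upto z (T - q) - exp (- (z * of_real T)) * of_real (k1 (T - q))) / z) {0..T}"
    by (rule has_integral_eq[rotated]) (auto simp: max_def k1_0)
  then show ?thesis by (rule integral_unique)
qed

text \<open>On the half line the result would be (1 + kap z)/z times the transform of g. Stopping at
  T leaves for the value at time q only the remaining time T - q, hence
  \<open>kap_upto z (T - q)\<close>, and boundary values at T.\<close>

lemma laplace_on_convolved:
  assumes z: "z \<noteq> 0"
  shows "laplace_on T (convolved g) z = integral {0..T} (\<lambda>q. s ((exp (- (z * of_real q)) * (1 + kap_upto z (T - q))
    - exp (- (z * of_real T)) * of_real (1 + k1 (T - q))) / z) (g q))"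
proof -
  let ?e = "\<lambda>r. exp (- (z * of_real r))"
  let ?N1 = "\<lambda>q. (?e q - ?e T) / z"
  let ?N2 = "\<lambda>q. (?e q * kap_upto z (T - q) - ?e T * of_real (k1 (T - q))) / z"
  let ?Y = "\<lambda>r. integral {0..T} (\<lambda>q. k1 (max 0 (r - q)) *\<^sub>R g q)"
  have "continuous_on {0..T} (kap_upto z)"
    unfolding kap_upto_def using T by (intro indefinite_integral_continuous_1 kap_upto_integrable) auto
  then have ck: "continuous_on {0..T} (\<lambda>q. kap_upto z (T - q))"
    by (rule continuous_on_compose2) (auto intro!: continuous_intros)
  have cN: "continuous_on {0..T} (\<lambda>q. s (?N1 q) (g q))" "continuous_on {0..T} (\<lambda>q. s (?N2 q) (g q))"
    using z by (auto intro!: s.continuous_on continuous_intros g ck continuous_on_k1_compose)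
  have "laplace_on T (convolved g) z = integral {0..T} (\<lambda>r. s (?e r) (integral {0..r} g) + s (?e r) (?Y r))"
    unfolding laplace_on_def s.add_right[symmetric] by (intro integral_cong) (simp add: convolved_eq)
  also have "\<dots> = laplace_on T (\<lambda>r. integral {0..r} g) z + integral {0..T} (\<lambda>r. s (?e r) (?Y r))"
    unfolding laplace_on_def
    by (intro integral_add integrable_continuous_real s.continuous_on continuous_intros continuous_on_convolved_parts)
  also have "integral {0..T} (\<lambda>r. s (?e r) (?Y r)) = integral {0..T} (\<lambda>q. s (?N2 q) (g q))"
  proof -
    have "integral {0..T} (\<lambda>r. s (?e r) (?Y r)) = integral {0..T} (\<lambda>r. integral {0..T} (\<lambda>q. s (?e r * of_real (k1 (max 0 (r - q)))) (g q)))"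
    proof (rule integral_cong)
      fix r
      have "continuous_on {0..T} (\<lambda>q. k1 (max 0 (r - q)) *\<^sub>R g q)"
        by (intro continuous_intros continuous_on_k1_compose g) auto
      from integral_linear[OF integrable_continuous_real[OF this] s.bounded_linear_right[of "?e r"]]
      show "s (?e r) (?Y r) = integral {0..T} (\<lambda>q. s (?e r * of_real (k1 (max 0 (r - q)))) (g q))"
        by (simp add: o_def s_of_real[symmetric] s_mult)
    qed
    also have "\<dots> = integral {0..T} (\<lambda>q. integral {0..T} (\<lambda>r. s (?e r * of_real (k1 (max 0 (r - q)))) (g q)))"
    proof -
      have "continuous_on (cbox (0, 0) (T, T)) (\<lambda>(r, q). s (?e r * of_real (k1 (max 0 (r - q)))) (g q))"
        unfolding split_beta
        by (intro s.continuous_on continuous_intros continuous_on_k1_compose continuous_on_compose2[OF g]) auto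
      from integral_swap_continuous[OF this] show ?thesis by simp
    qed
    also have "\<dots> = integral {0..T} (\<lambda>q. s (?N2 q) (g q))"
    proof (rule integral_cong)
      fix q assume q: "q \<in> {0..T}"
      have "continuous_on {0..T} (\<lambda>r. ?e r * of_real (k1 (max 0 (r - q))))"
        by (intro continuous_intros continuous_on_k1_compose) auto
      from integral_linear[OF integrable_continuous_real[OF this] s.bounded_linear_left[of "g q"]]
      show "integral {0..T} (\<lambda>r. s (?e r * of_real (k1 (max 0 (r - q)))) (g q)) = s (?N2 q) (g q)"
        unfolding laplace_k1_shift[OF z q, symmetric] by (simp add: o_def)
    qed
    finally show ?thesis .
  qed
  also have "laplace_on T (\<lambda>r. integral {0..r} g) z + integral {0..T} (\<lambda>q. s (?N2 q) (g q)) =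
    integral {0..T} (\<lambda>q. s (?N1 q) (g q) + s (?N2 q) (g q))"
    unfolding laplace_on_integral[OF z] by (intro integral_add[symmetric] integrable_continuous_real cN)
  also have "\<dots> = integral {0..T} (\<lambda>q. s ((?e q * (1 + kap_upto z (T - q)) - ?e T * of_real (1 + k1 (T - q))) / z) (g q))"
    unfolding s_add_left[symmetric] by (intro integral_cong) (simp add: algebra_simps flip: add_divide_distrib diff_divide_distrib)
  finally show ?thesis .
qed

text \<open>Every term that spoils the product formula is of order e^(-T Re z): the missing tail of
  \<kappa> beyond T - q, delayed by q, gives e^(-q Re z) e^(-(T-q) Re z), and the boundary values at
  T carry the factor directly.\<close>

lemma truncation_error:
  assumes z: "a \<le> Re z" and G: "\<And>q. q \<in> {0..T} \<Longrightarrow> norm (g q) \<le> G"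
  shows "norm (s ((1 + kap z) / z) (laplace_on T g z) - laplace_on T (convolved g) z)
    \<le> T * (\<delta> + 1 + k1 T) * G / cmod z * exp (- T * Re z)"
proof -
  let ?e = "\<lambda>r. exp (- (z * of_real r))"
  have z0: "z \<noteq> 0" using z a by auto
  let ?N = "\<lambda>q. (?e q * (kap z - kap_upto z (T - q)) + ?e T * of_real (1 + k1 (T - q))) / z"
  let ?M = "\<lambda>q. (?e q * (1 + kap_upto z (T - q)) - ?e T * of_real (1 + k1 (T - q))) / z"
  have "continuous_on {0..T} (kap_upto z)"
    unfolding kap_upto_def using T by (intro indefinite_integral_continuous_1 kap_upto_integrable) auto
  then have ck: "continuous_on {0..T} (\<lambda>q. kap_upto z (T - q))"
    by (rule continuous_on_compose2) (auto intro!: continuous_intros)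
  have cM: "continuous_on {0..T} (\<lambda>q. s (?M q) (g q))" "continuous_on {0..T} (\<lambda>q. s (?N q) (g q))"
    using z0 by (auto intro!: s.continuous_on continuous_intros g ck continuous_on_k1_compose)
  have c: "continuous_on {0..T} (\<lambda>q. s ((1 + kap z) / z * ?e q) (g q))"
    by (intro s.continuous_on continuous_intros g)
  have "continuous_on {0..T} (\<lambda>q. s (?e q) (g q))" by (intro s.continuous_on continuous_intros g)
  from integral_linear[OF integrable_continuous_real[OF this] s.bounded_linear_right[of "(1 + kap z) / z"]]
  have "s ((1 + kap z) / z) (laplace_on T g z) = integral {0..T} (\<lambda>q. s ((1 + kap z) / z * ?e q) (g q))"
    by (simp add: laplace_on_def o_def s_mult)
  then have "s ((1 + kap z) / z) (laplace_on T g z) - laplace_on T (convolved g) z =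
    integral {0..T} (\<lambda>q. s ((1 + kap z) / z * ?e q) (g q) - s (?M q) (g q))"
    unfolding laplace_on_convolved[OF z0] by (simp only: integral_diff[OF integrable_continuous_real[OF c] integrable_continuous_real[OF cM(1)]])
  also have "\<dots> = integral {0..T} (\<lambda>q. s (?N q) (g q))"
    unfolding s.diff_left[symmetric] by (intro integral_cong) (simp add: algebra_simps add_divide_distrib diff_divide_distrib)
  finally have E: "s ((1 + kap z) / z) (laplace_on T g z) - laplace_on T (convolved g) z = integral {0..T} (\<lambda>q. s (?N q) (g q))" .
  have "norm (integral {0..T} (\<lambda>q. s (?N q) (g q))) \<le> integral {0..T} (\<lambda>q. (\<delta> + 1 + k1 T) * exp (- T * Re z) / cmod z * G)"
  proof (rule integral_norm_bound_integral)
    show "(\<lambda>q. s (?N q) (g q)) integrable_on {0..T}" by (rule integrable_continuous_real[OF cM(2)])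
    fix q assume q: "q \<in> {0..T}"
    have "cmod (?e q * (kap z - kap_upto z (T - q))) \<le> exp (- q * Re z) * (exp (- (T - q) * Re z) * \<delta>)"
      unfolding norm_mult using kap_tail[OF z, of "T - q"] q by (intro mult_mono) (auto simp: mult.commute)
    also have "\<dots> = exp (- T * Re z) * \<delta>"
      by (simp add: algebra_simps flip: exp_add)
    finally have 1: "cmod (?e q * (kap z - kap_upto z (T - q))) \<le> exp (- T * Re z) * \<delta>" .
    have "cmod (?e T * of_real (1 + k1 (T - q))) = exp (- T * Re z) * (1 + k1 (T - q))"
      unfolding norm_mult norm_of_real using k1_nonneg[of "T - q"] q by (simp add: mult.commute)
    also have "\<dots> \<le> exp (- T * Re z) * (1 + k1 T)"
      using k1_mono[of "T - q" T] q by (intro mult_left_mono) auto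
    finally have "cmod (?e q * (kap z - kap_upto z (T - q)) + ?e T * of_real (1 + k1 (T - q))) \<le> exp (- T * Re z) * \<delta> + exp (- T * Re z) * (1 + k1 T)"
      by (rule norm_triangle_mono[OF 1])
    then have "cmod (?N q) \<le> (\<delta> + 1 + k1 T) * exp (- T * Re z) / cmod z"
      unfolding norm_divide using z0 by (intro divide_right_mono) (auto simp: algebra_simps)
    then show "norm (s (?N q) (g q)) \<le> (\<delta> + 1 + k1 T) * exp (- T * Re z) / cmod z * G"
      unfolding norm_s using G[OF q] k1_nonneg[of T] \<delta> T by (intro mult_mono) auto
  qed auto
  also have "\<dots> = T * (\<delta> + 1 + k1 T) * G / cmod z * exp (- T * Re z)"
    using T by (simp add: mult_ac)
  finally show ?thesis unfolding E .
qed

text \<open>The equation is rewritten with the resolvent at m(z) before it is transformed, so the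
  unbounded operator never has to be interchanged with an integral. Solving for the transform of g
  gives H(z) x plus the truncation errors.\<close>

theorem resolvent_family_transform:
  assumes eq: "\<And>r. r \<in> {0..T} \<Longrightarrow> convolved g r \<in> D \<and> A (convolved g r) = g r - x"
    and t: "t \<in> {0..T}"
  shows "inverse_transform t x = t *\<^sub>R g t"
proof -
  obtain G where "G > 0" "\<forall>x\<in>g ` {0..T}. norm x \<le> G"
    using compact_imp_bounded[OF compact_continuous_image[OF g compact_Icc]] unfolding bounded_pos by blast
  then have G: "\<And>r. r \<in> {0..T} \<Longrightarrow> norm (g r) \<le> G" "G > 0" by auto
  \<comment> \<open>The first summand comes from e^(-zT) H(z) x. The second comes from the error
    \<open>n\<close>, which is multiplied by m and by m^2 times the resolvent at m, together at most
    2 (C + 1) |z|.\<close>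
  define K0 where "K0 = (8 * C + 48 * C\<^sup>2) / a * norm x + 2 * (C + 1) * (T * (\<delta> + 1 + k1 T) * G)"
  have K0: "K0 \<ge> 0"
    unfolding K0_def using C a \<delta> T k1_nonneg[of T] G(2)
    by (intro add_nonneg_nonneg mult_nonneg_nonneg divide_nonneg_nonneg) auto
  have bound: "norm (H z x - laplace_on T g z) \<le> K0 / a * cmod z * exp (- T * Re z)" if z: "a \<le> Re z" for z
  proof -
    let ?e = "\<lambda>r. exp (- (z * of_real r))"
    let ?R = "res (m z)"
    have z0: "z \<noteq> 0" "cmod z > 0" "a \<le> cmod z" using z a complex_Re_le_cmod[of z] by auto
    have m0: "m z \<noteq> 0" by (rule norm_m(3)[OF z])
    have rs: "m z \<in> resolvent_set s D A" using sector_bound m_\<Omega>[OF z] by auto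
    define w where "w = laplace_on T g z"
    define X where "X = laplace_on T (convolved g) z"
    define n where "n = s ((1 + kap z) / z) w - X"
    have inv_m: "(1 + kap z) / z = 1 / m z"
      using z0 one_plus_kap(1)[OF z] by (simp add: m_def c_def)
    have n: "norm n \<le> T * (\<delta> + 1 + k1 T) * G / cmod z * exp (- T * Re z)"
      unfolding n_def w_def X_def by (rule truncation_error[OF z G(1)])
    have mX: "s (m z) X = w - s (m z) n"
      using m0 unfolding n_def inv_m by (simp add: s.diff_right s_mult)
    have "X = ?R (s (m z) X - w + s ((1 - ?e T) / z) x)"
    proof -
      have ce: "continuous_on {0..T} (\<lambda>r. s (?e r) (convolved g r))" "continuous_on {0..T} (\<lambda>r. s (?e r) (g r))"
        "continuous_on {0..T} (\<lambda>r. s (?e r) x)"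
        by (intro s.continuous_on continuous_intros continuous_on_convolved g)+
      note ie = ce[THEN integrable_continuous_real]
      have im: "(\<lambda>r. s (m z) (s (?e r) (convolved g r))) integrable_on {0..T}"
        using integrable_linear[OF ie(1) s.bounded_linear_right[of "m z"]] by (simp add: o_def)
      \<comment> \<open>The resolvent equation in bounded form: m X - A X = m X - g + x with X =
        \<open>convolved g r\<close>, inverted.\<close>
      have "convolved g r = ?R (s (m z) (convolved g r) - g r + x)" if "r \<in> {0..T}" for r
        using res_left[OF rs, of "convolved g r"] eq[OF that] by (simp add: algebra_simps)
      then have "s (?e r) (convolved g r) = ?R (s (m z) (s (?e r) (convolved g r)) - s (?e r) (g r) + s (?e r) x)" if "r \<in> {0..T}" for r
      proof -
        have "s (?e r) (convolved g r) = s (?e r) (?R (s (m z) (convolved g r) - g r + x))"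
          using that \<open>\<And>r. r \<in> {0..T} \<Longrightarrow> convolved g r = _\<close> by simp
        also have "\<dots> = ?R (s (?e r) (s (m z) (convolved g r) - g r + x))"
          by (rule res_s[OF rs, symmetric])
        also have "s (?e r) (s (m z) (convolved g r) - g r + x) = s (m z) (s (?e r) (convolved g r)) - s (?e r) (g r) + s (?e r) x"
          by (simp add: s.add_right s.diff_right s_mult mult.commute)
        finally show ?thesis .
      qed
      then have "X = integral {0..T} (\<lambda>r. ?R (s (m z) (s (?e r) (convolved g r)) - s (?e r) (g r) + s (?e r) x))"
        unfolding X_def laplace_on_def by (intro integral_cong)
      also have "\<dots> = ?R (integral {0..T} (\<lambda>r. s (m z) (s (?e r) (convolved g r)) - s (?e r) (g r) + s (?e r) x))"
        using integral_linear[OF integrable_add[OF integrable_diff[OF im ie(2)] ie(3)] blinfun.bounded_linear_right[of ?R]] by (simp add: o_def)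
      also have "integral {0..T} (\<lambda>r. s (m z) (s (?e r) (convolved g r)) - s (?e r) (g r) + s (?e r) x) =
        s (m z) X - w + integral {0..T} (\<lambda>r. s (?e r) x)"
        unfolding integral_add[OF integrable_diff[OF im ie(2)] ie(3)] integral_diff[OF im ie(2)] X_def w_def laplace_on_def
        using integral_linear[OF ie(1) s.bounded_linear_right[of "m z"]] by (simp add: o_def)
      also have "integral {0..T} (\<lambda>r. s (?e r) x) = s ((1 - ?e T) / z) x"
      proof -
        have "(?e has_integral (- ?e T / z - - ?e 0 / z)) {0..T}"
        proof (rule fundamental_theorem_of_calculus)
          fix r
          show "((\<lambda>r. - ?e r / z) has_vector_derivative ?e r) (at r within {0..T})"
            using bounded_linear.has_vector_derivative[OF bounded_linear_mult_right[of "- 1 / z"] has_vector_derivative_cexp[of z r "{0..T}"]] z0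
            by simp
        qed (use T in simp)
        from has_integral_linear[OF this s.bounded_linear_left[of x]]
        show ?thesis by (intro integral_unique) (simp add: o_def diff_divide_distrib)
      qed
      finally show ?thesis .
    qed
    then have X: "X = s ((1 - ?e T) / z) (?R x) - s (m z) (?R n)"
      unfolding mX by (simp add: blinfun.add_right blinfun.diff_right blinfun.minus_right res_s[OF rs])
    have w: "w = s (m z) X + s (m z) n" using mX by simp
    have Hx: "H z x = s (m z / z) (?R x)" unfolding H_def m_def using z0 by simp
    \<comment> \<open>The deviation splits into a term from truncating the transform of the constant
      x and two terms linear in the error \<open>n\<close>.\<close>
    have Hw: "H z x - w = s (?e T) (H z x) + s (m z) (s (m z) (?R n)) - s (m z) n"
    proof -
      have "m z * ((1 - ?e T) / z) = m z / z - ?e T * (m z / z)" by (simp add: diff_divide_distrib right_diff_distrib)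
      then have "s (m z) (s ((1 - ?e T) / z) (?R x)) = H z x - s (?e T) (H z x)"
        unfolding Hx s_mult by (simp only: s.diff_left)
      then show ?thesis unfolding w X s.diff_right by simp
    qed
    have h0: "norm (H z x - w) \<le> norm (s (?e T) (H z x)) + norm (s (m z) (s (m z) (?R n))) + norm (s (m z) n)"
    proof -
      have "norm (p + q - r) \<le> norm p + norm q + norm r" for p q r :: 'a
        using norm_triangle_ineq4[of "p + q" r] norm_triangle_ineq[of p q] by linarith
      then show ?thesis by (simp only: Hw)
    qed
    have h1: "norm (s (?e T) (H z x)) \<le> exp (- T * Re z) * ((8 * C + 48 * C\<^sup>2) / a * norm x)"
    proof -
      have "norm (H z) \<le> (8 * C + 48 * C\<^sup>2) / cmod z" by (rule H_bound[OF z])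
      also have "\<dots> \<le> (8 * C + 48 * C\<^sup>2) / a" using z0 a C by (intro divide_left_mono) auto
      finally have h: "norm (H z x) \<le> (8 * C + 48 * C\<^sup>2) / a * norm x"
        by (rule order_trans[OF norm_blinfun mult_right_mono]) simp
      have "cmod (?e T) = exp (- T * Re z)" by (simp add: mult.commute)
      then show ?thesis unfolding norm_s using h by (simp only:) (intro mult_left_mono; simp)
    qed
    have h2: "norm (s (m z) (s (m z) (?R n))) \<le> 2 * cmod z * (C * norm n)"
    proof -
      have "norm (s (m z) (?R n)) \<le> cmod (m z) * (C / cmod (m z) * norm n)"
        unfolding norm_s
        by (intro mult_left_mono order_trans[OF norm_blinfun mult_right_mono[OF norm_res[OF m_\<Omega>[OF z]] norm_ge_zero]]) simp
      also have "\<dots> = C * norm n" using m0 by simp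
      finally show ?thesis
        unfolding norm_s[of "m z" "s (m z) (?R n)"] using norm_m(1)[OF z] by (intro mult_mono) auto
    qed
    have h3: "norm (s (m z) n) \<le> 2 * cmod z * norm n"
      unfolding norm_s using norm_m(1)[OF z] by (intro mult_right_mono) auto
    have "norm (H z x - w) \<le> exp (- T * Re z) * ((8 * C + 48 * C\<^sup>2) / a * norm x) + 2 * cmod z * (C * norm n) + 2 * cmod z * norm n"
      using h0 h1 h2 h3 by linarith
    also have "\<dots> = exp (- T * Re z) * ((8 * C + 48 * C\<^sup>2) / a * norm x) + 2 * (C + 1) * (cmod z * norm n)"
      by (simp add: ring_distribs mult_ac)
    also have "\<dots> \<le> exp (- T * Re z) * ((8 * C + 48 * C\<^sup>2) / a * norm x) + 2 * (C + 1) * (T * (\<delta> + 1 + k1 T) * G * exp (- T * Re z))"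
      using mult_left_mono[OF n, of "cmod z"] z0 C by (intro add_left_mono mult_left_mono) auto
    also have "\<dots> = K0 * exp (- T * Re z)"
      unfolding K0_def by (simp only: ring_distribs mult_ac)
    \<comment> \<open>The factor |z|/a \<ge> 1 only brings the bound into the form expected by
      \<open>inverse_transform_eq\<close>.\<close>
    also have "\<dots> \<le> K0 / a * cmod z * exp (- T * Re z)"
    proof -
      have "K0 * 1 \<le> K0 * (cmod z / a)" using K0 z0 a by (intro mult_left_mono) auto
      then show ?thesis by (intro mult_right_mono) auto
    qed
    finally show ?thesis by (simp add: w_def)
  qed
  show ?thesis by (rule inverse_transform_eq[OF T g bound t])
qed

end

end

section \<open>Resolvent families are compact and norm continuous\<close>

context volterra_kernel
begin

text \<open>For x in \<open>D\<close> the integral is taken in the graph of \<open>A\<close>, a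
  closed subspace, so that \<open>A\<close> passes through it. Density extends the equation to all
  x: both components depend continuously on x, and the graph is closed.\<close>

lemma resolvent_equation:
  fixes s :: "complex \<Rightarrow> 'w \<Rightarrow> 'w::banach" and G :: "real \<Rightarrow> 'w \<Rightarrow>\<^sub>L 'w"
  assumes s: "normed_space_over K s" "scalar_field K"
    and lin: "linear_operator_on K s D A" and closed: "closed_operator D A" and dense: "densely_defined D"
    and G: "resolvent_family K s D A \<alpha> \<beta> \<nu> G" and N: "\<forall>t\<in>{0..T}. norm (G t) \<le> N"
    and t: "t \<in> {0..T}"
  defines "y \<equiv> \<lambda>x. integral {0..t} (\<lambda>r. (1 + k1 (t - r)) *\<^sub>R G r x)"
  shows "y x \<in> D \<and> A (y x) = G t x - x"
proof -
  let ?Z = "{(x, A x) |x. x \<in> D}"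
  have cG: "continuous_on {0..t} (\<lambda>r. G r x)" for x
    using G unfolding resolvent_family_def by (meson atLeastAtMost_iff atLeast_iff continuous_on_subset subsetI)
  have GD: "G r x \<in> D" "G r (A x) = A (G r x)" if "r \<ge> 0" "x \<in> D" for r x
    using G that by (auto simp: resolvent_family_def)
  have ck: "continuous_on {0..t} (\<lambda>r. (1 + k1 (t - r)) *\<^sub>R G r x)" for x
    by (intro continuous_intros continuous_on_k1_compose cG) auto
  have Zc: "closed ?Z" using closed by (simp add: closed_operator_def)
  have scale: "r *\<^sub>R x \<in> D \<and> A (r *\<^sub>R x) = r *\<^sub>R A x" if "x \<in> D" for r x
  proof -
    have "complex_of_real r \<in> K" using s(2) by (auto simp: scalar_field_def)
    moreover have "s (complex_of_real r) x = r *\<^sub>R x" for x using s(1) by (simp add: normed_space_over_def)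
    ultimately show ?thesis using lin that by (metis linear_operator_on_def)
  qed
  have add: "x + y \<in> D \<and> A (x + y) = A x + A y" if "x \<in> D" "y \<in> D" for x y
    using lin that by (simp add: linear_operator_on_def)
  have zero: "0 \<in> D" using lin by (simp add: linear_operator_on_def)
  have Zs: "subspace ?Z"
  proof (rule subspaceI)
    show "0 \<in> ?Z" using scale[OF zero, of 0] by (auto simp: zero_prod_def)
    show "p + q \<in> ?Z" if "p \<in> ?Z" "q \<in> ?Z" for p q using that add by force
    show "c *\<^sub>R p \<in> ?Z" if "p \<in> ?Z" for c p using that scale by force
  qed
  have D_case: "(y x, G t x - x) \<in> ?Z" if x: "x \<in> D" for x
  proof -
    let ?f = "\<lambda>r. ((1 + k1 (t - r)) *\<^sub>R G r x, (1 + k1 (t - r)) *\<^sub>R G r (A x))"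
    have f: "?f integrable_on {0..t}"
      by (intro integrable_continuous_real continuous_on_Pair ck)
    have "integral {0..t} ?f \<in> ?Z"
    proof (rule integral_in_closed_subspace[OF Zc Zs f])
      fix r assume "r \<in> {0..t}"
      then have "G r x \<in> D" "G r (A x) = A (G r x)" using GD x by auto
      then show "?f r \<in> ?Z" using scale[of "G r x" "1 + k1 (t - r)"] by auto
    qed
    moreover have "fst (integral {0..t} ?f) = y x"
      using integral_linear[OF f bounded_linear_fst] by (simp add: o_def y_def)
    moreover have "snd (integral {0..t} ?f) = integral {0..t} (\<lambda>r. (1 + k1 (t - r)) *\<^sub>R G r (A x))"
      using integral_linear[OF f bounded_linear_snd] by (simp add: o_def)
    moreover have "integral {0..t} (\<lambda>r. (1 + k1 (t - r)) *\<^sub>R G r (A x)) = G t x - x"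
    proof -
      have "((\<lambda>r. (1 + k1 (t - r)) *\<^sub>R A (G r x)) has_integral G t x - x) {0..t}"
        using G x t unfolding resolvent_family_def k1_def by simp
      then have "((\<lambda>r. (1 + k1 (t - r)) *\<^sub>R G r (A x)) has_integral G t x - x) {0..t}"
        by (rule has_integral_eq[rotated]) (use GD x in auto)
      then show ?thesis by (rule integral_unique)
    qed
    ultimately have "integral {0..t} ?f = (y x, G t x - x)" by (intro prod_eqI) simp_all
    then show ?thesis using \<open>integral {0..t} ?f \<in> ?Z\<close> by simp
  qed
  have "x \<in> closure D" using dense by (simp add: densely_defined_def)
  then obtain X where X: "\<And>n. X n \<in> D" "X \<longlonglongrightarrow> x" unfolding closure_sequential by blast
  have "bounded_linear y"
  proof (rule bounded_linear_intro)
    fix u v :: 'w and c :: real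
    show "y (u + v) = y u + y v"
      unfolding y_def blinfun.add_right scaleR_add_right by (intro integral_add integrable_continuous_real ck)
    show "y (c *\<^sub>R u) = c *\<^sub>R y u"
      unfolding y_def blinfun.scaleR_right scaleR_left_commute[of _ c] by (rule integral_cmul)
    have "norm (y u) \<le> integral {0..t} (\<lambda>r. (1 + k1 t) * (N * norm u))"
      unfolding y_def
    proof (rule integral_norm_bound_integral)
      fix r assume r: "r \<in> {0..t}"
      have "norm (G r u) \<le> N * norm u"
        by (rule order_trans[OF norm_blinfun mult_right_mono]) (use N r t in auto)
      then show "norm ((1 + k1 (t - r)) *\<^sub>R G r u) \<le> (1 + k1 t) * (N * norm u)"
        unfolding norm_scaleR using k1_nonneg[of "t - r"] k1_mono[of "t - r" t] r
        by (intro mult_mono) auto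
    qed (use integrable_continuous_real[OF ck] in auto)
    then show "norm (y u) \<le> norm u * (t * (1 + k1 t) * N)" using t by (simp add: mult_ac)
  qed
  then have "(\<lambda>n. y (X n)) \<longlonglongrightarrow> y x" using X(2) by (rule bounded_linear.tendsto)
  moreover have "(\<lambda>n. G t (X n) - X n) \<longlonglongrightarrow> G t x - x"
    by (intro tendsto_diff X(2) bounded_linear.tendsto[OF blinfun.bounded_linear_right])
  ultimately have "(\<lambda>n. (y (X n), G t (X n) - X n)) \<longlonglongrightarrow> (y x, G t x - x)"
    by (rule tendsto_Pair)
  from closed_sequentially[OF Zc D_case[OF X(1)] this] show ?thesis by auto
qed

end

lemma bounded_linear_Cplx: "bounded_linear (\<lambda>x :: 'a::real_normed_vector. Cplx x 0)"
proof (rule bounded_linear_intro[where K = 1])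
  show "norm (Cplx x 0) \<le> norm x * 1" for x :: 'a
    using norm_complexification_le[of "Cplx x 0"] by simp
qed (simp_all add: plus_complexification_def scaleR_complexification_def)

lemma bounded_linear_re_part: "bounded_linear (re_part :: 'a::real_normed_vector complexification \<Rightarrow> 'a)"
  by (rule bounded_linear_intro[where K = 1]) (simp_all add: norm_re_part_le)

text \<open>\<open>Q\<close> is determined by \<open>A\<close> and the parameters alone and serves
  every orbit g. Phrasing it for single orbits instead of a family makes it applicable to the
  complexified operator, where only the orbits of real vectors are at hand.\<close>

lemma complex_resolvent_family_transform:
  fixes s :: "complex \<Rightarrow> 'e \<Rightarrow> 'e::banach"
  assumes s: "normed_space_over UNIV s" and params: "T > 0" "\<alpha> > 0" "\<beta> \<ge> 0" "0 < \<nu>" "\<nu> < 1"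
    and lin: "linear_operator_on UNIV s D A" and sec: "complex_sectorial s D A \<theta>" and cr: "complex_compact_resolvent s D A"
  shows "\<exists>Q. continuous_on {0..T} (Q :: real \<Rightarrow> 'e \<Rightarrow>\<^sub>L 'e) \<and> (\<forall>t\<ge>0. compact_operator (Q t)) \<and>
    (\<forall>x g. continuous_on {0..T} g \<longrightarrow>
      (\<forall>t\<in>{0..T}. integral {0..t} (\<lambda>r. (1 + volterra_kernel.k1 \<alpha> \<beta> \<nu> (t - r)) *\<^sub>R g r) \<in> D \<and>
        A (integral {0..t} (\<lambda>r. (1 + volterra_kernel.k1 \<alpha> \<beta> \<nu> (t - r)) *\<^sub>R g r)) = g t - x) \<longrightarrow>
      (\<forall>t\<in>{0..T}. Q t x = t *\<^sub>R g t))"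
proof -
  have cb: "complex_banach s" using s by (rule complex_banach.intro)
  obtain \<epsilon> C where "sectorial_operator s D A \<epsilon> C" using sectorial_operatorI[OF cb lin sec] by blast
  moreover have "volterra_kernel \<alpha> \<beta> \<nu>" using params by (intro volterra_kernel.intro)
  ultimately interpret resolvent_symbol s D A \<epsilon> C \<alpha> \<beta> \<nu> T
    using params(1) by (intro resolvent_symbol.intro resolvent_symbol_axioms.intro)
  show ?thesis
  proof (intro exI[of _ inverse_transform] conjI allI impI ballI)
    show "continuous_on {0..T} inverse_transform" by (rule inverse_transform_continuous)
    show "compact_operator (inverse_transform t)" if "t \<ge> 0" for t
      by (rule inverse_transform_compact[OF cr that])
    show "inverse_transform t x = t *\<^sub>R g t"
      if "continuous_on {0..T} g" "\<forall>t\<in>{0..T}. integral {0..t} (\<lambda>r. (1 + k1 (t - r)) *\<^sub>R g r) \<in> D \<and>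
        A (integral {0..t} (\<lambda>r. (1 + k1 (t - r)) *\<^sub>R g r)) = g t - x" "t \<in> {0..T}" for x g t
      using that by (intro resolvent_family_transform) (auto simp: convolved_def)
  qed
qed

text \<open>Q(t) = t G(t) is divided by t, which excludes the end point 0. For real scalars
  \<open>Q\<close> belongs to the complexified operator and is compressed to real vectors.\<close>

theorem resolvent_family_compact_continuous:
  fixes s :: "complex \<Rightarrow> 'w \<Rightarrow> 'w::banach" and G :: "real \<Rightarrow> 'w \<Rightarrow>\<^sub>L 'w"
  assumes K: "scalar_field K" and s: "normed_space_over K s"
    and params: "T > 0" "\<alpha> > 0" "\<beta> \<ge> 0" "0 < \<nu>" "\<nu> < 1"
    and lin: "linear_operator_on K s D A" and closed: "closed_operator D A" and dense: "densely_defined D"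
    and sec: "sectorial K s D A (\<nu> * pi / 2)" and cr: "compact_resolvent K s D A"
    and G: "resolvent_family K s D A \<alpha> \<beta> \<nu> G" and N: "\<forall>t\<in>{0..T}. norm (G t) \<le> N"
  shows "continuous_on {0<..T} (G :: real \<Rightarrow> 'w \<Rightarrow>\<^sub>L 'w)" "\<And>t. t \<in> {0<..T} \<Longrightarrow> compact_operator (G t)"
proof -
  interpret volterra_kernel \<alpha> \<beta> \<nu> using params by (intro volterra_kernel.intro)
  note eq = resolvent_equation[OF s K lin closed dense G N]
  have cG: "continuous_on {0..T} (\<lambda>r. G r x)" for x
    using G unfolding resolvent_family_def by (meson atLeastAtMost_iff atLeast_iff continuous_on_subset subsetI)
  have "\<exists>Q. continuous_on {0..T} (Q :: real \<Rightarrow> 'w \<Rightarrow>\<^sub>L 'w) \<and> (\<forall>t\<ge>0. Q t \<in> compact_ops) \<and> (\<forall>t\<in>{0..T}. Q t = t *\<^sub>R G t)"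
  proof (cases "K = UNIV")
    case True
    obtain Q where Q: "continuous_on {0..T} (Q :: real \<Rightarrow> 'w \<Rightarrow>\<^sub>L 'w)" "\<forall>t\<ge>0. compact_operator (Q t)"
      "\<forall>x g. continuous_on {0..T} g \<longrightarrow>
      (\<forall>t\<in>{0..T}. integral {0..t} (\<lambda>r. (1 + k1 (t - r)) *\<^sub>R g r) \<in> D \<and>
        A (integral {0..t} (\<lambda>r. (1 + k1 (t - r)) *\<^sub>R g r)) = g t - x) \<longrightarrow>
      (\<forall>t\<in>{0..T}. Q t x = t *\<^sub>R g t)"
      using complex_resolvent_family_transform[of s T \<alpha> \<beta> \<nu> D A "\<nu> * pi / 2"] s lin sec cr params
      unfolding True sectorial_def compact_resolvent_def by auto
    have "Q t = t *\<^sub>R G t" if t: "t \<in> {0..T}" for t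
    proof (rule blinfun_eqI)
      fix x
      show "Q t x = (t *\<^sub>R G t) x"
        using Q(3)[rule_format, of "\<lambda>r. G r x" x t, OF cG eq t] by (simp add: blinfun.scaleR_left)
    qed
    then show ?thesis using Q by (intro exI[of _ Q]) (simp add: compact_ops_def)
  next
    case False
    let ?D = "complexify_dom D" and ?A = "complexify_op A"
    have KR: "K = \<real>" using False K by (simp add: scalar_field_def)
    have sr: "s (complex_of_real r) x = r *\<^sub>R x" for r x using s by (simp add: normed_space_over_def)
    have scale: "r *\<^sub>R x \<in> D" "A (r *\<^sub>R x) = r *\<^sub>R A x" if "x \<in> D" for r x
      using lin that unfolding KR linear_operator_on_def by (metis Reals_of_real sr)+
    have add: "x + y \<in> D" "A (x + y) = A x + A y" if "x \<in> D" "y \<in> D" for x y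
      using lin that by (simp_all add: linear_operator_on_def)
    have zero: "0 \<in> D" using lin by (simp add: linear_operator_on_def)
    have A0: "A 0 = 0" using scale(2)[OF zero, of 0] by simp
    have diff: "x - y \<in> D" "A (x - y) = A x - A y" if "x \<in> D" "y \<in> D" for x y
      using add[of x "- y"] scale[of y "- 1"] that by auto
    have lin': "linear_operator_on UNIV scaleCplx ?D ?A"
      unfolding linear_operator_on_def complexify_dom_def complexify_op_def scaleCplx_def
      using zero by (auto simp: add diff scale plus_complexification_def)
    obtain Q where Q: "continuous_on {0..T} (Q :: real \<Rightarrow> 'w complexification \<Rightarrow>\<^sub>L 'w complexification)" "\<forall>t\<ge>0. compact_operator (Q t)"
      "\<forall>x g. continuous_on {0..T} g \<longrightarrow>
      (\<forall>t\<in>{0..T}. integral {0..t} (\<lambda>r. (1 + k1 (t - r)) *\<^sub>R g r) \<in> ?D \<and>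
        ?A (integral {0..t} (\<lambda>r. (1 + k1 (t - r)) *\<^sub>R g r)) = g t - x) \<longrightarrow>
      (\<forall>t\<in>{0..T}. Q t x = t *\<^sub>R g t)"
      using complex_resolvent_family_transform[OF normed_space_over_complexification params lin', of "\<nu> * pi / 2"] sec cr False
      unfolding sectorial_def compact_resolvent_def by auto
    \<comment> \<open>Embedding of the real vectors, and below the projection onto the real part;
      composing with them preserves norm continuity and compactness.\<close>
    define E where "E = Blinfun (\<lambda>x :: 'w. Cplx x 0)"
    define R where "R = Blinfun (re_part :: 'w complexification \<Rightarrow> 'w)"
    have E: "blinfun_apply E = (\<lambda>x. Cplx x 0)" unfolding E_def by (rule bounded_linear_Blinfun_apply[OF bounded_linear_Cplx])
    have R: "blinfun_apply R = re_part" unfolding R_def by (rule bounded_linear_Blinfun_apply[OF bounded_linear_re_part])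
    show ?thesis
    proof (intro exI[of _ "\<lambda>t. R o\<^sub>L (Q t o\<^sub>L E)"] conjI ballI allI impI)
      show "continuous_on {0..T} (\<lambda>t. R o\<^sub>L (Q t o\<^sub>L E))"
        by (intro bounded_bilinear.continuous_on[OF bounded_bilinear_blinfun_compose] continuous_on_const Q(1))
      fix t :: real
      {
        assume t: "t \<ge> 0"
        have "Q t o\<^sub>L E \<in> compact_ops" using Q(2) t by (intro compact_ops_compose_right) (simp add: compact_ops_def)
        then show "R o\<^sub>L (Q t o\<^sub>L E) \<in> compact_ops"
          by (rule compact_ops_compose_left[OF _ blinfun.bounded_linear_right[of R]]) simp
      }
      assume t: "t \<in> {0..T}"
      show "R o\<^sub>L (Q t o\<^sub>L E) = t *\<^sub>R G t"
      proof (rule blinfun_eqI)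
        fix x
        \<comment> \<open>The orbit of a real vector stays real, so its resolvent equation for the
          complexified operator is the embedded real one.\<close>
        have "Q t (Cplx x 0) = t *\<^sub>R Cplx (G t x) 0"
        proof (rule Q(3)[rule_format, of "\<lambda>r. Cplx (G r x) 0", OF _ _ t])
          show "continuous_on {0..T} (\<lambda>r. Cplx (G r x) 0)"
            by (rule bounded_linear.continuous_on[OF bounded_linear_Cplx cG])
          fix t assume t: "t \<in> {0..T}"
          have "continuous_on {0..t} (\<lambda>r. (1 + k1 (t - r)) *\<^sub>R G r x)"
            using t by (intro continuous_intros continuous_on_k1_compose continuous_on_subset[OF cG]) auto
          from integral_linear[OF integrable_continuous_real[OF this] bounded_linear_Cplx]
          have "integral {0..t} (\<lambda>r. (1 + k1 (t - r)) *\<^sub>R Cplx (G r x) 0) = Cplx (integral {0..t} (\<lambda>r. (1 + k1 (t - r)) *\<^sub>R G r x)) 0"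
            by (simp add: o_def scaleR_complexification_def)
          then show "integral {0..t} (\<lambda>r. (1 + k1 (t - r)) *\<^sub>R Cplx (G r x) 0) \<in> ?D \<and>
            ?A (integral {0..t} (\<lambda>r. (1 + k1 (t - r)) *\<^sub>R Cplx (G r x) 0)) = Cplx (G t x) 0 - Cplx x 0"
            using eq[OF t, of x] zero A0 by (simp add: complexify_dom_def complexify_op_def minus_complexification_def)
        qed
        then show "(R o\<^sub>L (Q t o\<^sub>L E)) x = (t *\<^sub>R G t) x"
          by (simp add: E R blinfun.scaleR_left)
      qed
    qed
  qed
  then obtain Q where Q: "continuous_on {0..T} (Q :: real \<Rightarrow> 'w \<Rightarrow>\<^sub>L 'w)" "\<And>t. t \<ge> 0 \<Longrightarrow> Q t \<in> compact_ops"
    "\<And>t. t \<in> {0..T} \<Longrightarrow> Q t = t *\<^sub>R G t" by blast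
  have GQ: "G t = (1 / t) *\<^sub>R Q t" if "t \<in> {0<..T}" for t
    using that Q(3)[of t] by simp
  have "continuous_on {0<..T} (\<lambda>t. (1 / t) *\<^sub>R Q t)"
    by (intro continuous_intros continuous_on_subset[OF Q(1)]) auto
  then show "continuous_on {0<..T} G"
    by (rule continuous_on_eq) (simp add: GQ)
  show "compact_operator (G t)" if "t \<in> {0<..T}" for t
    using subspace_scale[OF subspace_compact_ops Q(2), of t "1 / t"] that GQ[OF that] by (simp add: compact_ops_def)
qed

section \<open>Strong measurability and the Bochner integral\<close>

text \<open>The library develops its integral through Borel measurability, which is adequate for separable
  spaces only; the facts needed are therefore derived from approximation by simple functions.\<close>

abbreviation "sbi \<equiv> Bochner_Integration.simple_bochner_integral"
abbreviation "simple_integrable \<equiv> Bochner_Integration.simple_bochner_integrable"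

text \<open>Simple functions converge only almost everywhere and \<open>M\<close> is not assumed
  complete, so the norm itself may fail to be Borel measurable. The estimates below work with a
  measurable representative.\<close>

lemma strongly_measurable_norm:
  assumes "strongly_measurable M g"
  shows "\<exists>n. n \<in> borel_measurable M \<and> (AE x in M. norm (g x) = n x)"
proof -
  obtain S where S: "\<And>i::nat. simple_function M (S i)" "AE x in M. (\<lambda>i. S i x) \<longlonglongrightarrow> g x"
    using assms by (auto simp: strongly_measurable_def)
  have "(\<lambda>x. norm (S i x)) \<in> borel_measurable M" for i
    by (rule borel_measurable_simple_function) (rule simple_function_compose1[OF S(1)])
  then have "(\<lambda>x. lim (\<lambda>i. norm (S i x))) \<in> borel_measurable M" by measurable
  moreover have "AE x in M. norm (g x) = lim (\<lambda>i. norm (S i x))"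
    using S(2) by eventually_elim (intro limI[symmetric] tendsto_norm)
  ultimately show ?thesis by blast
qed

lemma strongly_measurable_simple: "simple_function M g \<Longrightarrow> strongly_measurable M g"
  unfolding strongly_measurable_def by (intro exI[of _ "\<lambda>i. g"]) simp

lemma strongly_measurable_cong_AE:
  assumes "strongly_measurable M g" "AE x in M. g x = h x"
  shows "strongly_measurable M h"
proof -
  obtain S where S: "\<And>i::nat. simple_function M (S i)" "AE x in M. (\<lambda>i. S i x) \<longlonglongrightarrow> g x"
    using assms(1) by (auto simp: strongly_measurable_def)
  have "AE x in M. (\<lambda>i. S i x) \<longlonglongrightarrow> h x" using S(2) assms(2) by eventually_elim simp
  then show ?thesis using S(1) by (auto simp: strongly_measurable_def)
qed

lemma strongly_measurable_compose2:
  assumes "strongly_measurable M g" "strongly_measurable M h"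
    and F: "\<And>x y X Y. X \<longlonglongrightarrow> x \<Longrightarrow> Y \<longlonglongrightarrow> y \<Longrightarrow> (\<lambda>n. F (X n) (Y n)) \<longlonglongrightarrow> F x y"
  shows "strongly_measurable M (\<lambda>x. F (g x) (h x))"
proof -
  obtain S where S: "\<And>i::nat. simple_function M (S i)" "AE x in M. (\<lambda>i. S i x) \<longlonglongrightarrow> g x"
    using assms(1) by (auto simp: strongly_measurable_def)
  obtain R where R: "\<And>i::nat. simple_function M (R i)" "AE x in M. (\<lambda>i. R i x) \<longlonglongrightarrow> h x"
    using assms(2) by (auto simp: strongly_measurable_def)
  have "AE x in M. (\<lambda>i. F (S i x) (R i x)) \<longlonglongrightarrow> F (g x) (h x)"
    using S(2) R(2) by eventually_elim (rule F)
  moreover have "simple_function M (\<lambda>x. F (S i x) (R i x))" for i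
    by (rule simple_function_compose2[OF S(1) R(1)])
  ultimately show ?thesis
    unfolding strongly_measurable_def by (intro exI[of _ "\<lambda>i x. F (S i x) (R i x)"]) simp
qed

lemma strongly_measurable_add:
  "strongly_measurable M g \<Longrightarrow> strongly_measurable M h \<Longrightarrow> strongly_measurable M (\<lambda>x. g x + h x)"
  by (rule strongly_measurable_compose2) (auto intro: tendsto_add)

lemma strongly_measurable_diff:
  "strongly_measurable M g \<Longrightarrow> strongly_measurable M h \<Longrightarrow> strongly_measurable M (\<lambda>x. g x - h x)"
  by (rule strongly_measurable_compose2) (auto intro: tendsto_diff)

lemma strongly_measurable_linear:
  assumes "strongly_measurable M g" "bounded_linear F"
  shows "strongly_measurable M (\<lambda>x. F (g x))"
  by (rule strongly_measurable_compose2[OF assms(1) assms(1), of "\<lambda>x y. F x"]) (rule bounded_linear.tendsto[OF assms(2)])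

lemma strongly_measurable_indicator:
  assumes "strongly_measurable M g" "A \<in> sets M"
  shows "strongly_measurable M (\<lambda>x. indicator A x *\<^sub>R g x)"
  by (rule strongly_measurable_compose2[OF strongly_measurable_simple assms(1)])
    (use assms(2) in \<open>auto intro: tendsto_scaleR\<close>)

lemma strongly_measurable_sum:
  assumes "finite I" "\<And>i. i \<in> I \<Longrightarrow> strongly_measurable M (g i)"
  shows "strongly_measurable M (\<lambda>x. \<Sum>i\<in>I. g i x)"
  using assms by (induction I) (auto intro: strongly_measurable_add strongly_measurable_simple)

text \<open>Dominated convergence of the indicators, with majorant 1: on a finite measure space
  convergence almost everywhere gives convergence in measure.\<close>

lemma tendsto_measure_large_deviation:
  assumes "finite_measure M" and n: "\<And>i::nat. n i \<in> borel_measurable M" "AE x in M. (\<lambda>i. n i x) \<longlonglongrightarrow> (0::real)" and e: "e > 0"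
  shows "(\<lambda>i. measure M {x \<in> space M. n i x > e}) \<longlonglongrightarrow> 0"
proof -
  interpret finite_measure M by fact
  let ?E = "\<lambda>i. {x \<in> space M. n i x > e}"
  have E: "?E i \<in> sets M" for i using n(1)[of i] by measurable
  have "(\<lambda>i. integral\<^sup>L M (indicator (?E i) :: _ \<Rightarrow> real)) \<longlonglongrightarrow> integral\<^sup>L M (\<lambda>x. 0 :: real)"
  proof (rule integral_dominated_convergence[where w = "\<lambda>x. 1"])
    show "AE x in M. (\<lambda>i. indicator (?E i) x :: real) \<longlonglongrightarrow> 0"
      using n(2)
    proof eventually_elim
      case (elim x)
      then have "\<forall>\<^sub>F i in sequentially. n i x < e" using e by (rule order_tendstoD)
      then have "\<forall>\<^sub>F i in sequentially. indicator (?E i) x = (0::real)"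
        by eventually_elim (simp add: indicator_def)
      then show ?case by (rule tendsto_eventually)
    qed
  qed (use E in \<open>auto simp: indicator_def\<close>)
  then show ?thesis using E by (simp add: emeasure_eq_measure)
qed

lemma strongly_measurable_approx:
  assumes "finite_measure M" "strongly_measurable M g" "e > 0"
  shows "\<exists>S E. simple_function M S \<and> E \<in> sets M \<and> measure M E < e \<and> (AE x in M. x \<notin> E \<longrightarrow> norm (S x - g x) \<le> e)"
proof -
  obtain S where S: "\<And>i::nat. simple_function M (S i)" "AE x in M. (\<lambda>i. S i x) \<longlonglongrightarrow> g x"
    using assms(2) by (auto simp: strongly_measurable_def)
  have "\<exists>n. n \<in> borel_measurable M \<and> (AE x in M. norm (S i x - g x) = n x)" for i
    by (rule strongly_measurable_norm[OF strongly_measurable_diff[OF strongly_measurable_simple[OF S(1)] assms(2)]])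
  then have "\<forall>i. \<exists>n. n \<in> borel_measurable M \<and> (AE x in M. norm (S i x - g x) = n x)" by blast
  from choice[OF this] obtain n where "\<forall>i. n i \<in> borel_measurable M \<and> (AE x in M. norm (S i x - g x) = n i x)" ..
  then have n: "\<And>i. n i \<in> borel_measurable M" "\<And>i. AE x in M. norm (S i x - g x) = n i x" by auto
  have "AE x in M. \<forall>i. norm (S i x - g x) = n i x" using n(2) by (simp add: AE_all_countable)
  then have "AE x in M. (\<lambda>i. n i x) \<longlonglongrightarrow> 0"
    using S(2)
  proof eventually_elim
    case (elim x)
    then have "(\<lambda>i. norm (S i x - g x)) \<longlonglongrightarrow> 0" by (intro tendsto_norm_zero LIM_zero)
    then show ?case using elim(1) by simp
  qed
  from tendsto_measure_large_deviation[OF assms(1) n(1) this assms(3)]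
  have "\<forall>\<^sub>F i in sequentially. measure M {x \<in> space M. n i x > e} < e"
    using assms(3) by (rule order_tendstoD)
  then obtain i where i: "measure M {x \<in> space M. n i x > e} < e" by (auto simp: eventually_sequentially)
  show ?thesis
  proof (intro exI conjI)
    show "simple_function M (S i)" by (rule S)
    show "{x \<in> space M. n i x > e} \<in> sets M" using n(1)[of i] by measurable
    show "measure M {x \<in> space M. n i x > e} < e" by (rule i)
    show "AE x in M. x \<notin> {x \<in> space M. n i x > e} \<longrightarrow> norm (S i x - g x) \<le> e"
      using n(2)[of i] AE_space by eventually_elim auto
  qed
qed

text \<open>Each \<open>h n\<close> is replaced by a simple function within 2^-n of it outside a set
  of measure below 2^-n. By Borel-Cantelli almost every point lies in only finitely many exceptional
  sets, so the simple functions have the same limit.\<close>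

lemma strongly_measurable_lim:
  assumes fin: "finite_measure M" and h: "\<And>n::nat. strongly_measurable M (h n)" "AE x in M. (\<lambda>n. h n x) \<longlonglongrightarrow> g x"
  shows "strongly_measurable M g"
proof -
  interpret finite_measure M by fact
  have "\<forall>n. \<exists>S E. simple_function M S \<and> E \<in> sets M \<and> measure M E < (1/2) ^ n \<and> (AE x in M. x \<notin> E \<longrightarrow> norm (S x - h n x) \<le> (1/2) ^ n)"
    by (intro allI strongly_measurable_approx[OF fin h(1)]) simp
  from choice[OF this] obtain S where "\<forall>n. \<exists>E. simple_function M (S n) \<and> E \<in> sets M \<and> measure M E < (1/2) ^ n \<and> (AE x in M. x \<notin> E \<longrightarrow> norm (S n x - h n x) \<le> (1/2) ^ n)" ..
  from choice[OF this] obtain E where "\<forall>n. simple_function M (S n) \<and> E n \<in> sets M \<and> measure M (E n) < (1/2) ^ n \<and> (AE x in M. x \<notin> E n \<longrightarrow> norm (S n x - h n x) \<le> (1/2) ^ n)" ..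
  then have SE: "\<And>n. simple_function M (S n)" "\<And>n. E n \<in> sets M" "\<And>n. measure M (E n) < (1/2) ^ n"
    "\<And>n. AE x in M. x \<notin> E n \<longrightarrow> norm (S n x - h n x) \<le> (1/2) ^ n" by blast+
  have "AE x in M. \<forall>\<^sub>F n in sequentially. x \<in> space M - E n"
  proof (rule borel_cantelli_AE1[OF SE(2)])
    show "emeasure M (E n) < \<infinity>" for n by (simp add: emeasure_eq_measure)
    show "summable (\<lambda>n. measure M (E n))"
      by (rule summable_comparison_test'[OF summable_geometric[of "1/2::real"]]) (use SE(3) in \<open>auto intro: less_imp_le\<close>)
  qed
  moreover have "AE x in M. \<forall>n. x \<notin> E n \<longrightarrow> norm (S n x - h n x) \<le> (1/2) ^ n"
    using SE(4) by (simp add: AE_all_countable)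
  ultimately have "AE x in M. (\<lambda>n. S n x) \<longlonglongrightarrow> g x"
    using h(2)
  proof eventually_elim
    case (elim x)
    have "(\<lambda>n. S n x - h n x) \<longlonglongrightarrow> 0"
    proof (rule Lim_null_comparison)
      show "\<forall>\<^sub>F n in sequentially. norm (S n x - h n x) \<le> (1/2) ^ n"
        using elim(1) by eventually_elim (use elim(2) in auto)
      show "(\<lambda>n. (1/2) ^ n :: real) \<longlonglongrightarrow> 0" by (rule LIMSEQ_power_zero) simp
    qed
    from tendsto_add[OF this elim(3)] show ?case by simp
  qed
  then show ?thesis using SE(1) unfolding strongly_measurable_def by (intro exI[of _ S]) simp
qed

lemma simple_integrable_finite_measure:
  "finite_measure M \<Longrightarrow> simple_function M S \<Longrightarrow> simple_integrable M S"
  by (simp add: Bochner_Integration.simple_bochner_integrable.simps finite_measure.emeasure_finite)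

lemma simple_integral_norm_le:
  assumes "simple_integrable M S"
  shows "ennreal (norm (sbi M S)) \<le> (\<integral>\<^sup>+x. norm (S x) \<partial>M)"
proof -
  have n: "simple_integrable M (\<lambda>x. norm (S x))"
    by (rule Bochner_Integration.simple_bochner_integrable_compose2[where p = "\<lambda>x y. norm x", OF _ assms assms]) simp
  have "ennreal (norm (sbi M S)) \<le> ennreal (sbi M (\<lambda>x. norm (S x)))"
    by (intro ennreal_leI Bochner_Integration.simple_bochner_integral_norm_bound assms)
  also have "\<dots> = (\<integral>\<^sup>+x. norm (S x) \<partial>M)"
    by (rule Bochner_Integration.simple_bochner_integral_eq_nn_integral[OF n]) simp
  finally show ?thesis .
qed

text \<open>Additivity of the nonnegative integral needs measurable integrands, so the two norms on
  the right are replaced by Borel representatives.\<close>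

lemma nn_integral_norm_triangle:
  fixes p q :: "'b \<Rightarrow> 'a::real_normed_vector"
  assumes g: "strongly_measurable M g" and p: "strongly_measurable M p" and q: "strongly_measurable M q"
  shows "(\<integral>\<^sup>+x. norm (p x - q x) \<partial>M) \<le> (\<integral>\<^sup>+x. norm (g x - p x) \<partial>M) + (\<integral>\<^sup>+x. norm (g x - q x) \<partial>M)"
proof -
  obtain n where n: "n \<in> borel_measurable M" "AE x in M. norm (g x - p x) = n x"
    using strongly_measurable_norm[OF strongly_measurable_diff[OF g p]] by blast
  obtain m where m: "m \<in> borel_measurable M" "AE x in M. norm (g x - q x) = m x"
    using strongly_measurable_norm[OF strongly_measurable_diff[OF g q]] by blast
  have "(\<integral>\<^sup>+x. norm (p x - q x) \<partial>M) \<le> (\<integral>\<^sup>+x. ennreal (n x) + ennreal (m x) \<partial>M)"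
  proof (rule nn_integral_mono_AE)
    show "AE x in M. ennreal (norm (p x - q x)) \<le> ennreal (n x) + ennreal (m x)"
      using n(2) m(2)
    proof eventually_elim
      case (elim x)
      have "norm (p x - q x) \<le> n x + m x"
        using elim norm_triangle_ineq4[of "g x - q x" "g x - p x"] by simp
      moreover have "n x \<ge> 0" "m x \<ge> 0"
        using norm_ge_zero[of "g x - p x"] norm_ge_zero[of "g x - q x"] unfolding elim by simp_all
      ultimately show ?case by (simp add: ennreal_leI flip: ennreal_plus)
    qed
  qed
  also have "\<dots> = (\<integral>\<^sup>+x. n x \<partial>M) + (\<integral>\<^sup>+x. m x \<partial>M)"
    using n(1) m(1) by (intro nn_integral_add) auto
  also have "(\<integral>\<^sup>+x. n x \<partial>M) = (\<integral>\<^sup>+x. norm (g x - p x) \<partial>M)"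
    using n(2) by (intro nn_integral_cong_AE) (auto elim: eventually_mono)
  also have "(\<integral>\<^sup>+x. m x \<partial>M) = (\<integral>\<^sup>+x. norm (g x - q x) \<partial>M)"
    using m(2) by (intro nn_integral_cong_AE) (auto elim: eventually_mono)
  finally show ?thesis .
qed

lemma simple_integrable_strongly_measurable: "simple_integrable M S \<Longrightarrow> strongly_measurable M S"
  by (auto simp: Bochner_Integration.simple_bochner_integrable.simps intro: strongly_measurable_simple)

lemma simple_integral_dist_le:
  assumes g: "strongly_measurable M g" and S: "simple_integrable M S" and R: "simple_integrable M R"
  shows "ennreal (norm (sbi M S - sbi M R)) \<le> (\<integral>\<^sup>+x. norm (g x - S x) \<partial>M) + (\<integral>\<^sup>+x. norm (g x - R x) \<partial>M)"
proof -
  have "simple_integrable M (\<lambda>x. S x - R x)"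
    by (rule Bochner_Integration.simple_bochner_integrable_compose2[OF _ S R]) simp
  from simple_integral_norm_le[OF this]
  have "ennreal (norm (sbi M S - sbi M R)) \<le> (\<integral>\<^sup>+x. norm (S x - R x) \<partial>M)"
    by (simp add: Bochner_Integration.simple_bochner_integral_diff[OF S R])
  also have "\<dots> \<le> (\<integral>\<^sup>+x. norm (g x - S x) \<partial>M) + (\<integral>\<^sup>+x. norm (g x - R x) \<partial>M)"
    by (rule nn_integral_norm_triangle[OF g simple_integrable_strongly_measurable[OF S] simple_integrable_strongly_measurable[OF R]])
  finally show ?thesis .
qed

lemma strong_bochner_integralI:
  assumes "strongly_measurable M g" "\<And>i::nat. simple_integrable M (S i)"
    "(\<lambda>i. \<integral>\<^sup>+x. norm (g x - S i x) \<partial>M) \<longlonglongrightarrow> 0" "(\<lambda>i. sbi M (S i)) \<longlonglongrightarrow> I"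
  shows "has_strong_bochner_integral M g I"
  unfolding has_strong_bochner_integral_def
  by (intro conjI exI[of _ S] allI) (fact assms)+

lemma strong_bochner_integralD:
  "has_strong_bochner_integral M g I \<Longrightarrow> \<exists>S. strongly_measurable M g \<and> (\<forall>i::nat. simple_integrable M (S i)) \<and>
    (\<lambda>i. \<integral>\<^sup>+x. norm (g x - S i x) \<partial>M) \<longlonglongrightarrow> 0 \<and> (\<lambda>i. sbi M (S i)) \<longlonglongrightarrow> I"
  unfolding has_strong_bochner_integral_def by (simp only: ex_simps simp_thms)

text \<open>Makes the value independent of the approximating sequence: the simple integrals of two
  such sequences differ by at most the sum of their distances to \<open>g\<close>.\<close>

lemma strong_bochner_integral_approx:
  assumes I: "has_strong_bochner_integral M g I"
    and S: "\<And>i::nat. simple_integrable M (S i)" "(\<lambda>i. \<integral>\<^sup>+x. norm (g x - S i x) \<partial>M) \<longlonglongrightarrow> 0"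
  shows "(\<lambda>i. sbi M (S i)) \<longlonglongrightarrow> I"
proof -
  from strong_bochner_integralD[OF I]
  obtain R where g: "strongly_measurable M g" and R: "\<forall>i::nat. simple_integrable M (R i)"
    "(\<lambda>i. \<integral>\<^sup>+x. norm (g x - R i x) \<partial>M) \<longlonglongrightarrow> 0" "(\<lambda>i. sbi M (R i)) \<longlonglongrightarrow> I"
    by (elim exE conjE)
  note R = R(1)[THEN spec] R(2,3)
  have "(\<lambda>i. (\<integral>\<^sup>+x. norm (g x - S i x) \<partial>M) + (\<integral>\<^sup>+x. norm (g x - R i x) \<partial>M)) \<longlonglongrightarrow> 0"
    using tendsto_add[OF S(2) R(2)] by simp
  then have "(\<lambda>i. ennreal (norm (sbi M (S i) - sbi M (R i)))) \<longlonglongrightarrow> 0"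
    by (rule tendsto_sandwich[where f = "\<lambda>_. 0", OF _ _ tendsto_const, rotated 2]) (auto intro!: always_eventually simple_integral_dist_le[OF g S(1) R(1)])
  then have "(\<lambda>i. norm (sbi M (S i) - sbi M (R i))) \<longlonglongrightarrow> 0"
    by (subst (asm) ennreal_0[symmetric], subst (asm) tendsto_ennreal_iff) auto
  then have "(\<lambda>i. sbi M (S i) - sbi M (R i)) \<longlonglongrightarrow> 0" by (rule tendsto_norm_zero_cancel)
  from tendsto_add[OF this R(3)] show ?thesis by simp
qed

lemma strong_bochner_integral_norm_le:
  fixes g :: "'a \<Rightarrow> 'b::real_normed_vector"
  assumes "has_strong_bochner_integral M g I"
  shows "ennreal (norm I) \<le> (\<integral>\<^sup>+x. norm (g x) \<partial>M)"
proof -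
  from strong_bochner_integralD[OF assms]
  obtain R where g: "strongly_measurable M g" and R: "\<forall>i::nat. simple_integrable M (R i)"
    "(\<lambda>i. \<integral>\<^sup>+x. norm (g x - R i x) \<partial>M) \<longlonglongrightarrow> 0" "(\<lambda>i. sbi M (R i)) \<longlonglongrightarrow> I"
    by (elim exE conjE)
  note R = R(1)[THEN spec] R(2,3)
  have le: "ennreal (norm (sbi M (R i))) \<le> (\<integral>\<^sup>+x. norm (g x - R i x) \<partial>M) + (\<integral>\<^sup>+x. norm (g x) \<partial>M)" for i
  proof -
    have "strongly_measurable M (\<lambda>x. 0 :: 'b)" by (intro strongly_measurable_simple) simp
    from nn_integral_norm_triangle[OF g simple_integrable_strongly_measurable[OF R(1)] this, of i]
    have "(\<integral>\<^sup>+x. norm (R i x) \<partial>M) \<le> (\<integral>\<^sup>+x. norm (g x - R i x) \<partial>M) + (\<integral>\<^sup>+x. norm (g x) \<partial>M)"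
      by (simp only: diff_zero)
    then show ?thesis by (rule order_trans[OF simple_integral_norm_le[OF R(1)]])
  qed
  have l1: "(\<lambda>i. ennreal (norm (sbi M (R i)))) \<longlonglongrightarrow> ennreal (norm I)" by (intro tendsto_ennrealI tendsto_norm R)
  have l2: "(\<lambda>i. (\<integral>\<^sup>+x. norm (g x - R i x) \<partial>M) + (\<integral>\<^sup>+x. norm (g x) \<partial>M)) \<longlonglongrightarrow> 0 + (\<integral>\<^sup>+x. norm (g x) \<partial>M)"
    by (intro tendsto_add R tendsto_const)
  show ?thesis using LIMSEQ_le[OF l1 l2] le by simp
qed


text \<open>The given simple functions converge pointwise but without control in mean. Cutting them
  off at an integrable bound permits dominated convergence, and completeness of the space yields the
  integral.\<close>

lemma strong_bochner_integral_exists: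
  fixes g :: "'b \<Rightarrow> 'a::banach"
  assumes fin: "finite_measure M" and g: "strongly_measurable M g" and h: "integrable M h" "AE x in M. norm (g x) \<le> h x"
  shows "\<exists>I. has_strong_bochner_integral M g I"
proof -
  obtain S where S: "\<And>i::nat. simple_function M (S i)" "AE x in M. (\<lambda>i. S i x) \<longlonglongrightarrow> g x"
    using g by (auto simp: strongly_measurable_def)
  interpret finite_measure M by fact
  \<comment> \<open>The surplus 1 makes norm (g x) < k x strict, so at almost every point the
    cut-off at \<open>k\<close> is inactive from some index on.\<close>
  define k where "k x = \<bar>h x\<bar> + 1" for x
  have k: "k \<in> borel_measurable M" "integrable M k" "\<And>x. k x \<ge> 1"
    using h(1) by (auto simp: k_def[abs_def] intro!: Bochner_Integration.integrable_add)
  define R where "R i x = (if norm (S i x) \<le> k x then S i x else 0)" for i x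
  have R_simple: "simple_function M (R i)" for i
  proof -
    have "{x \<in> space M. norm (S i x) \<le> k x} \<in> sets M"
    proof -
      have "(\<lambda>x. norm (S i x)) \<in> borel_measurable M"
        by (rule borel_measurable_simple_function) (rule simple_function_compose1[OF S(1)])
      then show ?thesis using k(1) by measurable
    qed
    then show ?thesis unfolding R_def
      by (intro simple_function_If[OF S(1)]) auto
  qed
  have R: "simple_integrable M (R i)" for i by (rule simple_integrable_finite_measure[OF fin R_simple])
  have "\<forall>i. \<exists>n. n \<in> borel_measurable M \<and> (AE x in M. norm (g x - R i x) = n x)"
    by (intro allI strongly_measurable_norm strongly_measurable_diff g strongly_measurable_simple R_simple)
  from choice[OF this] obtain n where "\<forall>i. n i \<in> borel_measurable M \<and> (AE x in M. norm (g x - R i x) = n i x)" ..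
  then have n: "\<And>i. n i \<in> borel_measurable M" "\<And>i. AE x in M. norm (g x - R i x) = n i x" by auto
  have AE: "AE x in M. \<forall>i. norm (g x - R i x) = n i x" using n(2) by (simp add: AE_all_countable)
  have "(\<lambda>i. \<integral>\<^sup>+x. n i x \<partial>M) \<longlonglongrightarrow> (\<integral>\<^sup>+x. 0 \<partial>M)"
  proof (rule nn_integral_dominated_convergence[where w = "\<lambda>x. 2 * k x"])
    show "AE x in M. ennreal (n i x) \<le> ennreal (2 * k x)" for i
      using n(2)[of i] h(2)
    proof eventually_elim
      case (elim x)
      have "norm (g x - R i x) \<le> k x + k x"
        using elim(2) k(3)[of x] norm_triangle_ineq4[of "g x" "R i x"] by (auto simp: R_def k_def)
      then show ?case using elim(1) by (simp add: ennreal_leI)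
    qed
    show "(\<integral>\<^sup>+x. ennreal (2 * k x) \<partial>M) < \<infinity>"
      using k(2) nn_integral_eq_integral[of M "\<lambda>x. 2 * k x"] k(3) by (simp add: order_trans[OF zero_le_one])
    show "AE x in M. (\<lambda>i. ennreal (n i x)) \<longlonglongrightarrow> 0"
      using AE S(2) h(2)
    proof eventually_elim
      case (elim x)
      have "norm (g x) < k x" using elim(3) by (simp add: k_def)
      then have "\<forall>\<^sub>F i in sequentially. norm (S i x) < k x"
        by (rule order_tendstoD(2)[OF tendsto_norm[OF elim(2)]])
      then have "\<forall>\<^sub>F i in sequentially. S i x = R i x" by eventually_elim (simp add: R_def)
      with elim(2) have "(\<lambda>i. R i x) \<longlonglongrightarrow> g x" by (rule Lim_transform_eventually)
      then have "(\<lambda>i. norm (g x - R i x)) \<longlonglongrightarrow> norm (g x - g x)" by (intro tendsto_intros)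
      then have "(\<lambda>i. n i x) \<longlonglongrightarrow> 0" using elim(1) by simp
      from tendsto_ennrealI[OF this] show ?case by simp
    qed
  qed (use n(1) k(1) in auto)
  moreover have "(\<integral>\<^sup>+x. n i x \<partial>M) = (\<integral>\<^sup>+x. norm (g x - R i x) \<partial>M)" for i
    using n(2)[of i] by (intro nn_integral_cong_AE) (auto elim: eventually_mono)
  ultimately have lim: "(\<lambda>i. \<integral>\<^sup>+x. norm (g x - R i x) \<partial>M) \<longlonglongrightarrow> 0" by simp
  have "Cauchy (\<lambda>i. sbi M (R i))"
  proof (rule metric_CauchyI)
    fix e :: real assume e: "e > 0"
    then have "\<forall>\<^sub>F i in sequentially. (\<integral>\<^sup>+x. norm (g x - R i x) \<partial>M) < ennreal (e / 2)"
      by (intro order_tendstoD(2)[OF lim]) simp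
    then obtain N where N: "\<And>i. i \<ge> N \<Longrightarrow> (\<integral>\<^sup>+x. norm (g x - R i x) \<partial>M) < ennreal (e / 2)"
      by (auto simp: eventually_sequentially)
    have "dist (sbi M (R i)) (sbi M (R j)) < e" if "i \<ge> N" "j \<ge> N" for i j
    proof -
      have "ennreal (norm (sbi M (R i) - sbi M (R j))) \<le> (\<integral>\<^sup>+x. norm (g x - R i x) \<partial>M) + (\<integral>\<^sup>+x. norm (g x - R j x) \<partial>M)"
        by (rule simple_integral_dist_le[OF g R R])
      also have "\<dots> < ennreal (e / 2) + ennreal (e / 2)"
        using N that by (intro add_strict_mono)
      also have "\<dots> = ennreal e" using e by (simp flip: ennreal_plus)
      finally show ?thesis by (simp add: dist_norm ennreal_less_iff)
    qed
    then show "\<exists>N. \<forall>i\<ge>N. \<forall>j\<ge>N. dist (sbi M (R i)) (sbi M (R j)) < e" by blast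
  qed
  then have "convergent (\<lambda>i. sbi M (R i))" by (rule Cauchy_convergent)
  then have "(\<lambda>i. sbi M (R i)) \<longlonglongrightarrow> lim (\<lambda>i. sbi M (R i))" by (simp only: convergent_LIMSEQ_iff)
  from strong_bochner_integralI[OF g R lim this] show ?thesis by (rule exI)
qed

lemma strong_bochner_integral_combine:
  assumes I: "has_strong_bochner_integral M g I" and J: "has_strong_bochner_integral M h J"
    and F: "bounded_linear F" "bounded_linear G"
  shows "has_strong_bochner_integral M (\<lambda>x. F (g x) + G (h x)) (F I + G J)"
proof -
  from strong_bochner_integralD[OF I]
  obtain S where g: "strongly_measurable M g" and S: "\<forall>i::nat. simple_integrable M (S i)"
    "(\<lambda>i. \<integral>\<^sup>+x. norm (g x - S i x) \<partial>M) \<longlonglongrightarrow> 0" "(\<lambda>i. sbi M (S i)) \<longlonglongrightarrow> I"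
    by (elim exE conjE)
  note S = S(1)[THEN spec] S(2,3)
  from strong_bochner_integralD[OF J]
  obtain R where h: "strongly_measurable M h" and R: "\<forall>i::nat. simple_integrable M (R i)"
    "(\<lambda>i. \<integral>\<^sup>+x. norm (h x - R i x) \<partial>M) \<longlonglongrightarrow> 0" "(\<lambda>i. sbi M (R i)) \<longlonglongrightarrow> J"
    by (elim exE conjE)
  note R = R(1)[THEN spec] R(2,3)
  interpret F: bounded_linear F by fact
  interpret G: bounded_linear G by fact
  obtain a where a: "a > 0" "\<And>x. norm (F x) \<le> norm x * a" using F.pos_bounded by blast
  obtain b where b: "b > 0" "\<And>x. norm (G x) \<le> norm x * b" using G.pos_bounded by blast
  let ?Q = "\<lambda>i x. F (S i x) + G (R i x)"
  have FS: "simple_integrable M (\<lambda>x. F (S i x))" "simple_integrable M (\<lambda>x. G (R i x))" for i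
    by (rule Bochner_Integration.simple_bochner_integrable_compose2[where p = "\<lambda>x y. F x", OF _ S(1) S(1)])
      (rule F.zero, rule Bochner_Integration.simple_bochner_integrable_compose2[where p = "\<lambda>x y. G x", OF _ R(1) R(1)], rule G.zero)
  have Q: "simple_integrable M (?Q i)" for i
    by (rule Bochner_Integration.simple_bochner_integrable_compose2[OF _ FS]) simp
  have sum: "sbi M (?Q i) = F (sbi M (S i)) + G (sbi M (R i))" for i
    unfolding Bochner_Integration.simple_bochner_integral_add[OF FS]
      Bochner_Integration.simple_bochner_integral_linear[OF F.linear S(1)]
      Bochner_Integration.simple_bochner_integral_linear[OF G.linear R(1)] ..
  have le: "(\<integral>\<^sup>+x. norm (F (g x) + G (h x) - ?Q i x) \<partial>M) \<le>
    ennreal a * (\<integral>\<^sup>+x. norm (g x - S i x) \<partial>M) + ennreal b * (\<integral>\<^sup>+x. norm (h x - R i x) \<partial>M)" for i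
  proof -
    obtain n where n: "n \<in> borel_measurable M" "AE x in M. norm (g x - S i x) = n x"
      using strongly_measurable_norm[OF strongly_measurable_diff[OF g simple_integrable_strongly_measurable[OF S(1)]]] by blast
    obtain m where m: "m \<in> borel_measurable M" "AE x in M. norm (h x - R i x) = m x"
      using strongly_measurable_norm[OF strongly_measurable_diff[OF h simple_integrable_strongly_measurable[OF R(1)]]] by blast
    have "(\<integral>\<^sup>+x. norm (F (g x) + G (h x) - ?Q i x) \<partial>M) \<le> (\<integral>\<^sup>+x. ennreal a * ennreal (n x) + ennreal b * ennreal (m x) \<partial>M)"
    proof (rule nn_integral_mono_AE)
      show "AE x in M. ennreal (norm (F (g x) + G (h x) - ?Q i x)) \<le> ennreal a * ennreal (n x) + ennreal b * ennreal (m x)"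
        using n(2) m(2)
      proof eventually_elim
        case (elim x)
        have "F (g x) + G (h x) - ?Q i x = F (g x - S i x) + G (h x - R i x)" by (simp add: F.diff G.diff)
        then have "norm (F (g x) + G (h x) - ?Q i x) \<le> a * n x + b * m x"
          using a(2)[of "g x - S i x"] b(2)[of "h x - R i x"] norm_triangle_ineq[of "F (g x - S i x)" "G (h x - R i x)"]
          unfolding elim by (simp add: mult.commute)
        moreover have "n x \<ge> 0" "m x \<ge> 0"
          using norm_ge_zero[of "g x - S i x"] norm_ge_zero[of "h x - R i x"] unfolding elim by simp_all
        ultimately show ?case using a(1) b(1) by (simp add: ennreal_leI flip: ennreal_plus ennreal_mult)
      qed
    qed
    also have "\<dots> = ennreal a * (\<integral>\<^sup>+x. n x \<partial>M) + ennreal b * (\<integral>\<^sup>+x. m x \<partial>M)"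
      using n(1) m(1) by (subst nn_integral_add) (auto simp: nn_integral_cmult)
    also have "(\<integral>\<^sup>+x. n x \<partial>M) = (\<integral>\<^sup>+x. norm (g x - S i x) \<partial>M)"
      using n(2) by (intro nn_integral_cong_AE) (auto elim: eventually_mono)
    also have "(\<integral>\<^sup>+x. m x \<partial>M) = (\<integral>\<^sup>+x. norm (h x - R i x) \<partial>M)"
      using m(2) by (intro nn_integral_cong_AE) (auto elim: eventually_mono)
    finally show ?thesis .
  qed
  have "(\<lambda>i. ennreal a * (\<integral>\<^sup>+x. norm (g x - S i x) \<partial>M) + ennreal b * (\<integral>\<^sup>+x. norm (h x - R i x) \<partial>M)) \<longlonglongrightarrow> 0"
    using tendsto_add[OF ennreal_tendsto_cmult[OF _ S(2), of "ennreal a"] ennreal_tendsto_cmult[OF _ R(2), of "ennreal b"]] by simp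
  then have lim: "(\<lambda>i. \<integral>\<^sup>+x. norm (F (g x) + G (h x) - ?Q i x) \<partial>M) \<longlonglongrightarrow> 0"
    by (rule tendsto_sandwich[where f = "\<lambda>_. 0", OF _ _ tendsto_const, rotated 2]) (auto intro!: always_eventually le)
  have int: "(\<lambda>i. sbi M (?Q i)) \<longlonglongrightarrow> F I + G J"
    unfolding sum by (rule tendsto_add[OF F.tendsto[OF S(3)] G.tendsto[OF R(3)]])
  have "strongly_measurable M (\<lambda>x. F (g x) + G (h x))"
    by (rule strongly_measurable_add[OF strongly_measurable_linear[OF g F(1)] strongly_measurable_linear[OF h F(2)]])
  from strong_bochner_integralI[OF this Q lim int] show ?thesis .
qed

text \<open>Convolutions are treated as integrals over the fixed interval [0, T] with an indicator;
  this leads back to integrals over [0, t] as in a mild solution.\<close>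

lemma strong_bochner_integral_restrict:
  assumes \<Omega>: "\<Omega> \<in> sets M" and I: "has_strong_bochner_integral M (\<lambda>x. indicator \<Omega> x *\<^sub>R g x) I"
  shows "has_strong_bochner_integral (restrict_space M \<Omega>) g I"
proof -
  have \<Omega>': "\<Omega> \<inter> space M \<in> sets M" "\<Omega> \<inter> space M = \<Omega>" using \<Omega> sets.sets_into_space[OF \<Omega>] by auto
  from strong_bochner_integralD[OF I]
  obtain S where g: "strongly_measurable M (\<lambda>x. indicator \<Omega> x *\<^sub>R g x)" and S: "\<forall>i::nat. simple_integrable M (S i)"
    "(\<lambda>i. \<integral>\<^sup>+x. norm (indicator \<Omega> x *\<^sub>R g x - S i x) \<partial>M) \<longlonglongrightarrow> 0" "(\<lambda>i. sbi M (S i)) \<longlonglongrightarrow> I"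
    by (elim exE conjE)
  note S = S(1)[THEN spec] S(2,3)
  \<comment> \<open>The approximating functions may be nonzero outside \<open>\<Omega>\<close>;
    cutting them off does not increase the distance to the integrand.\<close>
  let ?R = "\<lambda>i x. indicator \<Omega> x *\<^sub>R S i x"
  have si: "simple_function M (indicator \<Omega> :: _ \<Rightarrow> real)" using \<Omega> by simp
  have R: "simple_integrable M (?R i)" for i
  proof (rule Bochner_Integration.simple_bochner_integrable.intros)
    show "simple_function M (?R i)"
      by (rule simple_function_compose2[OF si]) (use S(1)[of i] in \<open>auto simp: Bochner_Integration.simple_bochner_integrable.simps\<close>)
    have "emeasure M {y \<in> space M. ?R i y \<noteq> 0} \<le> emeasure M {y \<in> space M. S i y \<noteq> 0}"
    proof (rule emeasure_mono)
      have "simple_function M (S i)" using S(1)[of i] by (auto simp: Bochner_Integration.simple_bochner_integrable.simps)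
      from simple_functionD(2)[OF this, of "- {0}"] show "{y \<in> space M. S i y \<noteq> 0} \<in> sets M"
        by (simp add: vimage_def Int_def conj_commute)
    qed auto
    then show "emeasure M {y \<in> space M. ?R i y \<noteq> 0} \<noteq> \<infinity>"
      using S(1)[of i] by (auto simp: Bochner_Integration.simple_bochner_integrable.simps top_unique)
  qed
  have R_lim: "(\<lambda>i. \<integral>\<^sup>+x. norm (indicator \<Omega> x *\<^sub>R g x - ?R i x) \<partial>M) \<longlonglongrightarrow> 0"
  proof (rule tendsto_sandwich[OF _ _ tendsto_const S(2)])
    show "\<forall>\<^sub>F i in sequentially. (\<integral>\<^sup>+x. norm (indicator \<Omega> x *\<^sub>R g x - ?R i x) \<partial>M) \<le> (\<integral>\<^sup>+x. norm (indicator \<Omega> x *\<^sub>R g x - S i x) \<partial>M)"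
      by (intro always_eventually allI nn_integral_mono ennreal_leI) (auto simp: indicator_def)
  qed auto
  have S': "simple_integrable (restrict_space M \<Omega>) (S i)" for i
    unfolding Bochner_Integration.simple_bochner_integrable_restrict_space[OF \<Omega>'(1)] by (rule R)
  show ?thesis
    unfolding has_strong_bochner_integral_def
  proof (intro conjI exI[of _ S] allI S')
    have "(\<lambda>i. sbi M (?R i)) \<longlonglongrightarrow> I" by (rule strong_bochner_integral_approx[OF I R R_lim])
    then show "(\<lambda>i. sbi (restrict_space M \<Omega>) (S i)) \<longlonglongrightarrow> I"
      by (simp add: Bochner_Integration.simple_bochner_integral_restrict_space[OF \<Omega>'(1) S'])
    have "(\<integral>\<^sup>+x. norm (g x - S i x) \<partial>restrict_space M \<Omega>) = (\<integral>\<^sup>+x. norm (indicator \<Omega> x *\<^sub>R g x - ?R i x) \<partial>M)" for i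
      unfolding nn_integral_restrict_space[OF \<Omega>'(1)]
      by (intro nn_integral_cong) (auto simp: indicator_def)
    then show "(\<lambda>i. \<integral>\<^sup>+x. norm (g x - S i x) \<partial>restrict_space M \<Omega>) \<longlonglongrightarrow> 0" using R_lim by simp
    obtain Q where Q: "\<And>i::nat. simple_function M (Q i)" "AE x in M. (\<lambda>i. Q i x) \<longlonglongrightarrow> indicator \<Omega> x *\<^sub>R g x"
      using g by (auto simp: strongly_measurable_def)
    show "strongly_measurable (restrict_space M \<Omega>) g"
      unfolding strongly_measurable_def
    proof (intro exI[of _ Q] conjI allI)
      show "simple_function (restrict_space M \<Omega>) (Q i)" for i
        unfolding simple_function_restrict_space[OF \<Omega>'(1)]
        by (rule simple_function_compose2[OF si Q(1)])
      show "AE x in restrict_space M \<Omega>. (\<lambda>i. Q i x) \<longlonglongrightarrow> g x"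
        unfolding AE_restrict_space_iff[OF \<Omega>'(1)] using Q(2) by eventually_elim (intro impI, simp)
    qed
  qed
qed

text \<open>Rounding down to multiples of 1/(n+1). It takes finitely many values on a bounded
  interval and never exceeds s, so it stays in [0, c] whenever s does.\<close>

definition grid :: "nat \<Rightarrow> real \<Rightarrow> real" where
  "grid n s = real_of_int \<lfloor>s * real (Suc n)\<rfloor> / real (Suc n)"

lemma grid_le: "grid n s \<le> s" "s - grid n s \<le> 1 / real (Suc n)"
proof -
  have "real_of_int \<lfloor>s * real (Suc n)\<rfloor> \<le> s * real (Suc n)" by simp
  then show "grid n s \<le> s" unfolding grid_def by (simp add: divide_le_eq)
  have "s * real (Suc n) \<le> real_of_int \<lfloor>s * real (Suc n)\<rfloor> + 1" by linarith
  then have "s \<le> (real_of_int \<lfloor>s * real (Suc n)\<rfloor> + 1) / real (Suc n)" by (simp add: le_divide_eq)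
  then show "s - grid n s \<le> 1 / real (Suc n)" unfolding grid_def by (simp add: add_divide_distrib)
qed

lemma grid_nonneg: "s \<ge> 0 \<Longrightarrow> grid n s \<ge> 0"
  unfolding grid_def by simp

lemma grid_tendsto: "(\<lambda>n. grid n s) \<longlonglongrightarrow> s"
proof -
  have "(\<lambda>n. grid n s - s) \<longlonglongrightarrow> 0"
  proof (rule Lim_null_comparison)
    show "\<forall>\<^sub>F n in sequentially. norm (grid n s - s) \<le> 1 / real (Suc n)"
    proof (intro always_eventually allI)
      fix n show "norm (grid n s - s) \<le> 1 / real (Suc n)" using grid_le(1)[of n s] grid_le(2)[of s n] by simp
    qed
    show "(\<lambda>n. 1 / real (Suc n)) \<longlonglongrightarrow> 0" by (rule LIMSEQ_Suc[OF lim_const_over_n])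
  qed
  then show ?thesis by (rule LIM_zero_cancel)
qed

lemma grid_simple: "simple_function (lebesgue_on {0..T}) (grid n)"
proof (rule simple_function_borel_measurable)
  have "grid n \<in> borel_measurable borel" unfolding grid_def[abs_def] by measurable
  then show "grid n \<in> borel_measurable (lebesgue_on {0..T})"
    by (intro measurable_restrict_space1 measurable_completion) simp
  have "grid n ` {0..T} \<subseteq> (\<lambda>k. real_of_int k / real (Suc n)) ` {0..\<lfloor>T * real (Suc n)\<rfloor>}"
  proof
    fix y assume "y \<in> grid n ` {0..T}"
    then obtain s where s: "0 \<le> s" "s \<le> T" "y = grid n s" by auto
    have "0 \<le> \<lfloor>s * real (Suc n)\<rfloor>" using s(1) by simp
    moreover have "\<lfloor>s * real (Suc n)\<rfloor> \<le> \<lfloor>T * real (Suc n)\<rfloor>" using s(2) by (intro floor_mono mult_right_mono) auto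
    ultimately show "y \<in> (\<lambda>k. real_of_int k / real (Suc n)) ` {0..\<lfloor>T * real (Suc n)\<rfloor>}"
      unfolding s(3) grid_def by (intro imageI) simp
  qed
  then show "finite (grid n ` space (lebesgue_on {0..T}))"
    by (simp add: space_restrict_space) (rule finite_subset, auto)
qed

lemma finite_measure_lebesgue_on: "finite_measure (lebesgue_on {0..T::real})"
  by (rule finite_measureI) (simp add: emeasure_restrict_space space_restrict_space emeasure_lborel_Icc_eq)

lemma space_lebesgue_on_Icc [simp]: "space (lebesgue_on {0..T::real}) = {0..T}"
  by (simp add: space_restrict_space)

lemma interval_sets: "S \<in> sets borel \<Longrightarrow> S \<subseteq> {0..T::real} \<Longrightarrow> S \<in> sets (lebesgue_on {0..T})"
  by (subst sets_restrict_space_iff) auto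

text \<open>With \<open>w\<close> sampled on the grid only finitely many second arguments occur, so
  the composition is a finite sum of cut-off measurable functions. Continuity of \<open>w\<close>
  and of \<open>f s\<close> gives the limit.\<close>

lemma strongly_measurable_Caratheodory:
  fixes f :: "real \<Rightarrow> 'a::metric_space \<Rightarrow> 'b::real_normed_vector"
  assumes f: "AE s in lebesgue_on {0..T}. continuous_on UNIV (f s)" "\<And>x. strongly_measurable (lebesgue_on {0..T}) (\<lambda>s. f s x)"
    and w: "continuous_on {0..T} w"
  shows "strongly_measurable (lebesgue_on {0..T}) (\<lambda>s. f s (w s))"
proof (rule strongly_measurable_lim[OF finite_measure_lebesgue_on])
  let ?M = "lebesgue_on {0..T}"
  show "strongly_measurable ?M (\<lambda>s. f s (w (grid n s)))" for n
  proof -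
    let ?V = "grid n ` {0..T}"
    have fin: "finite ?V" using simple_functionD(1)[OF grid_simple[of T n]] by simp
    have "strongly_measurable ?M (\<lambda>s. \<Sum>v\<in>?V. indicator {s \<in> {0..T}. grid n s = v} s *\<^sub>R f s (w v))"
    proof (intro strongly_measurable_sum fin strongly_measurable_indicator f(2))
      fix v
      have "grid n -` {v} \<inter> space ?M \<in> sets ?M" by (rule simple_functionD(2)[OF grid_simple])
      moreover have "grid n -` {v} \<inter> space ?M = {s \<in> {0..T}. grid n s = v}" by auto
      ultimately show "{s \<in> {0..T}. grid n s = v} \<in> sets ?M" by simp
    qed
    moreover have "AE s in ?M. (\<Sum>v\<in>?V. indicator {s \<in> {0..T}. grid n s = v} s *\<^sub>R f s (w v)) = f s (w (grid n s))"
    proof (rule AE_I2)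
      fix s assume "s \<in> space ?M"
      then have s: "s \<in> {0..T}" by simp
      have "(\<Sum>v\<in>?V. indicator {s \<in> {0..T}. grid n s = v} s *\<^sub>R f s (w v)) = (\<Sum>v\<in>?V. if v = grid n s then f s (w v) else 0)"
        using s by (intro sum.cong) auto
      also have "\<dots> = f s (w (grid n s))" using fin s by (simp add: sum.delta)
      finally show "(\<Sum>v\<in>?V. indicator {s \<in> {0..T}. grid n s = v} s *\<^sub>R f s (w v)) = f s (w (grid n s))" .
    qed
    ultimately show ?thesis by (rule strongly_measurable_cong_AE)
  qed
  show "AE s in ?M. (\<lambda>n. f s (w (grid n s))) \<longlonglongrightarrow> f s (w s)"
    using f(1) AE_space
  proof eventually_elim
    case (elim s)
    then have s: "s \<in> {0..T}" by simp
    have "(\<lambda>n. w (grid n s)) \<longlonglongrightarrow> w s"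
    proof (rule continuous_on_tendsto_compose[OF w grid_tendsto s])
      show "\<forall>\<^sub>F n in sequentially. grid n s \<in> {0..T}"
      proof (intro always_eventually allI)
        fix n show "grid n s \<in> {0..T}" using s grid_nonneg[of s n] grid_le(1)[of n s] by simp
      qed
    qed
    then show ?case by (rule continuous_on_tendsto_compose[OF elim(1)]) auto
  qed
qed

text \<open>Both the operator and the vector are discretised: the uniform bound \<open>N\<close>
  controls the error in the vector, and strong continuity the error in the operator at the fixed
  vector \<open>h s\<close>.\<close>

lemma strongly_measurable_operator_apply:
  fixes \<Gamma> :: "real \<Rightarrow> 'a::real_normed_vector \<Rightarrow>\<^sub>L 'b::real_normed_vector"
  assumes \<Gamma>: "\<And>x. continuous_on {0..c} (\<lambda>s. \<Gamma> s x)" "\<And>s. s \<in> {0..c} \<Longrightarrow> norm (\<Gamma> s) \<le> N"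
    and h: "strongly_measurable (lebesgue_on {0..T}) h"
  shows "strongly_measurable (lebesgue_on {0..T}) (\<lambda>s. indicator {0..c} s *\<^sub>R \<Gamma> s (h s))"
proof -
  let ?M = "lebesgue_on {0..T}"
  obtain S where S0: "\<forall>i::nat. simple_function ?M (S i)" "AE x in ?M. (\<lambda>i. S i x) \<longlonglongrightarrow> h x"
    using h unfolding strongly_measurable_def by (elim exE conjE)
  note S = S0(1)[THEN spec] S0(2)
  have c: "{s \<in> {0..T}. s \<in> {0..c}} \<in> sets ?M" by (intro interval_sets) auto
  have "simple_function ?M (\<lambda>s. if s \<in> {0..c} then \<Gamma> (grid n s) (S n s) else 0)" for n
    by (intro simple_function_If simple_function_compose2[OF grid_simple S(1)] simple_function_const) (use c in simp)
  moreover have "AE s in ?M. (\<lambda>n. if s \<in> {0..c} then \<Gamma> (grid n s) (S n s) else 0) \<longlonglongrightarrow> indicator {0..c} s *\<^sub>R \<Gamma> s (h s)"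
    using S(2)
  proof eventually_elim
    case (elim s)
    show ?case
    proof (cases "s \<in> {0..c}")
      case True
      then have gr: "grid n s \<in> {0..c}" for n using grid_nonneg[of s n] grid_le(1)[of n s] by auto
      have 1: "(\<lambda>n. \<Gamma> (grid n s) (S n s - h s)) \<longlonglongrightarrow> 0"
      proof (rule Lim_null_comparison)
        show "\<forall>\<^sub>F n in sequentially. norm (\<Gamma> (grid n s) (S n s - h s)) \<le> N * norm (S n s - h s)"
          by (intro always_eventually allI order_trans[OF norm_blinfun mult_right_mono] \<Gamma>(2) gr) simp
        show "(\<lambda>n. N * norm (S n s - h s)) \<longlonglongrightarrow> 0"
          using elim by (intro tendsto_mult_right_zero tendsto_norm_zero LIM_zero)
      qed
      have 2: "(\<lambda>n. \<Gamma> (grid n s) (h s)) \<longlonglongrightarrow> \<Gamma> s (h s)"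
        by (rule continuous_on_tendsto_compose[OF \<Gamma>(1) grid_tendsto True]) (use gr in simp)
      from tendsto_add[OF 1 2] show ?thesis using True by (simp add: blinfun.diff_right)
    next
      case False
      then show ?thesis by (simp del: atLeastAtMost_iff)
    qed
  qed
  ultimately show ?thesis
    unfolding strongly_measurable_def
    by (intro exI[of _ "\<lambda>n s. if s \<in> {0..c} then \<Gamma> (grid n s) (S n s) else 0"] conjI allI)
qed

lemma strong_bochner_integral_norm_le_integral:
  assumes "has_strong_bochner_integral M g I" "integrable M k" "AE x in M. norm (g x) \<le> k x"
  shows "norm I \<le> integral\<^sup>L M k"
proof -
  have k0: "AE x in M. 0 \<le> k x" using assms(3) by eventually_elim (rule order_trans[OF norm_ge_zero])
  have "ennreal (norm I) \<le> (\<integral>\<^sup>+x. norm (g x) \<partial>M)" by (rule strong_bochner_integral_norm_le[OF assms(1)])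
  also have "\<dots> \<le> (\<integral>\<^sup>+x. k x \<partial>M)"
    using assms(3) by (intro nn_integral_mono_AE) (auto elim: eventually_mono intro: ennreal_leI)
  also have "\<dots> = ennreal (integral\<^sup>L M k)" by (rule nn_integral_eq_integral[OF assms(2) k0])
  finally show ?thesis using integral_nonneg_AE[OF k0] by (simp add: ennreal_le_iff)
qed

lemma strong_bochner_integral_diff_le:
  assumes "has_strong_bochner_integral M g I" "has_strong_bochner_integral M h J"
    "integrable M k" "AE x in M. norm (g x - h x) \<le> k x"
  shows "norm (I - J) \<le> integral\<^sup>L M k"
proof (rule strong_bochner_integral_norm_le_integral[OF _ assms(3)])
  show "has_strong_bochner_integral M (\<lambda>x. g x + - h x) (I - J)"
    using strong_bochner_integral_combine[OF assms(1,2) bounded_linear_ident bounded_linear_minus[OF bounded_linear_ident]] by simp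
  show "AE x in M. norm (g x + - h x) \<le> k x" using assms(4) by simp
qed

lemma strong_bochner_integral_zero: "has_strong_bochner_integral M (\<lambda>x. 0 :: 'b::real_normed_vector) 0"
proof -
  have "sbi M (\<lambda>x. 0 :: 'b) = 0" unfolding Bochner_Integration.simple_bochner_integral_def by (intro sum.neutral) auto
  then show ?thesis
    by (intro strong_bochner_integralI[of _ _ "\<lambda>i x. 0"])
      (simp_all add: strongly_measurable_simple Bochner_Integration.simple_bochner_integrable.simps)
qed

lemma strong_bochner_integral_sum:
  assumes "finite J" "\<And>j. j \<in> J \<Longrightarrow> has_strong_bochner_integral M (g j) (I j)" "\<And>j. bounded_linear (F j)"
  shows "has_strong_bochner_integral M (\<lambda>x. \<Sum>j\<in>J. F j (g j x)) (\<Sum>j\<in>J. F j (I j))"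
  using assms(1,2)
proof (induction J)
  case empty
  show ?case by (simp add: strong_bochner_integral_zero)
next
  case (insert j J)
  then have "has_strong_bochner_integral M (\<lambda>x. F j (g j x) + (\<Sum>j\<in>J. F j (g j x))) (F j (I j) + (\<Sum>j\<in>J. F j (I j)))"
    by (intro strong_bochner_integral_combine[OF _ _ assms(3) bounded_linear_ident]) auto
  then show ?case using insert.hyps by simp
qed

text \<open>Absolute continuity of the integral: the part of \<open>\<psi>\<close> above a high
  level n has small integral, and the rest contributes at most n times the measure of the
  set.\<close>

lemma integral_small_sets:
  assumes "finite_measure M" "integrable M \<psi>" "\<And>x. x \<in> space M \<Longrightarrow> 0 \<le> \<psi> x" "e > 0"
  shows "\<exists>d>0. \<forall>A\<in>sets M. measure M A < d \<longrightarrow> integral\<^sup>L M (\<lambda>x. indicator A x * \<psi> x) < (e :: real)"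
proof -
  interpret finite_measure M by fact
  have mm: "integrable M (\<lambda>x. min (\<psi> x) (real n))" for n
    by (rule Bochner_Integration.integrable_bound[OF assms(2)]) (use assms in \<open>auto simp: abs_of_nonneg\<close>)
  have "(\<lambda>n. integral\<^sup>L M (\<lambda>x. \<psi> x - min (\<psi> x) (real n))) \<longlonglongrightarrow> integral\<^sup>L M (\<lambda>x. 0 :: real)"
  proof (rule integral_dominated_convergence[where w = \<psi>])
    show "AE x in M. (\<lambda>n. \<psi> x - min (\<psi> x) (real n)) \<longlonglongrightarrow> 0"
    proof (rule AE_I2)
      fix x
      obtain m where "\<psi> x \<le> real m" using real_arch_simple by blast
      then have "\<forall>\<^sub>F n in sequentially. \<psi> x - min (\<psi> x) (real n) = 0"
        unfolding eventually_sequentially by (intro exI[of _ m]) auto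
      then show "(\<lambda>n. \<psi> x - min (\<psi> x) (real n)) \<longlonglongrightarrow> 0" by (rule tendsto_eventually)
    qed
  qed (use assms in auto)
  then have "\<forall>\<^sub>F n in sequentially. integral\<^sup>L M (\<lambda>x. \<psi> x - min (\<psi> x) (real n)) < e / 2"
    using assms(4) by (intro order_tendstoD(2)) auto
  then obtain n where n: "integral\<^sup>L M (\<lambda>x. \<psi> x - min (\<psi> x) (real n)) < e / 2"
    by (auto simp: eventually_sequentially)
  show ?thesis
  proof (intro exI[of _ "e / (2 * (real n + 1))"] conjI ballI impI)
    show "0 < e / (2 * (real n + 1))" using assms(4) by simp
    fix A assume A: "A \<in> sets M" "measure M A < e / (2 * (real n + 1))"
    have "integral\<^sup>L M (\<lambda>x. indicator A x * \<psi> x) \<le> integral\<^sup>L M (\<lambda>x. (\<psi> x - min (\<psi> x) (real n)) + real n * indicator A x)"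
    proof (rule integral_mono)
      show "integrable M (\<lambda>x. indicator A x * \<psi> x)"
        using integrable_mult_indicator[OF A(1) assms(2)] by simp
      show "integrable M (\<lambda>x. (\<psi> x - min (\<psi> x) (real n)) + real n * indicator A x)"
        using A(1) assms(2) mm by (intro Bochner_Integration.integrable_add Bochner_Integration.integrable_diff integrable_mult_right integrable_real_indicator) (auto simp: emeasure_eq_measure)
      fix x assume "x \<in> space M"
      then show "indicator A x * \<psi> x \<le> (\<psi> x - min (\<psi> x) (real n)) + real n * indicator A x"
        by (auto simp: indicator_def)
    qed
    also have "\<dots> = integral\<^sup>L M (\<lambda>x. \<psi> x - min (\<psi> x) (real n)) + real n * measure M A"
      using A(1) assms(2) mm by (subst Bochner_Integration.integral_add) (auto simp: emeasure_eq_measure)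
    also have "\<dots> < e / 2 + e / 2"
    proof (rule add_less_le_mono[OF n])
      have "real n * measure M A \<le> (real n + 1) * (e / (2 * (real n + 1)))"
        using A(2) by (intro mult_mono) auto
      also have "\<dots> = e / 2"
      proof -
        have "real n + 1 > 0" by simp
        then show ?thesis by (simp add: field_simps)
      qed
      finally show "real n * measure M A \<le> e / 2" .
    qed
    finally show "integral\<^sup>L M (\<lambda>x. indicator A x * \<psi> x) < e" by simp
  qed
qed

lemma precompact_finite_sum:
  fixes X :: "'i \<Rightarrow> 'a::real_normed_vector set"
  assumes "finite J" "\<And>j. j \<in> J \<Longrightarrow> precompact (X j)"
  shows "precompact {\<Sum>j\<in>J. x j |x. \<forall>j\<in>J. x j \<in> X j}"
  using assms
proof (induction J)
  case empty
  show ?case by (auto simp: precompact_def intro!: exI[of _ "{0}"])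
next
  case (insert j J)
  have "{\<Sum>j\<in>insert j J. x j |x. \<forall>j\<in>insert j J. x j \<in> X j} \<subseteq> {x + y |x y. x \<in> X j \<and> y \<in> {\<Sum>j\<in>J. x j |x. \<forall>j\<in>J. x j \<in> X j}}"
    using insert.hyps by auto
  with precompact_sum[of "X j" "{\<Sum>j\<in>J. x j |x. \<forall>j\<in>J. x j \<in> X j}"] insert.IH insert.prems show ?case
    by (meson insertCI precompact_subset)
qed

text \<open>In infinite dimensions bounded sequences need not have convergent subsequences, hence
  the precompactness at each time. A diagonal subsequence converges on a countable dense set, and
  equicontinuity spreads this over the interval uniformly.\<close>

theorem Arzela_Ascoli_interval:
  fixes w :: "nat \<Rightarrow> real \<Rightarrow> 'a::complete_space"
  assumes T: "T > 0"
    and eq: "\<And>e. e > 0 \<Longrightarrow> \<exists>d>0. \<forall>n. \<forall>t\<in>{0..T}. \<forall>t'\<in>{0..T}. \<bar>t - t'\<bar> < d \<longrightarrow> dist (w n t) (w n t') < e"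
    and pc: "\<And>t. t \<in> {0..T} \<Longrightarrow> precompact (range (\<lambda>n. w n t))"
  shows "\<exists>r v. strict_mono (r :: nat \<Rightarrow> nat) \<and> uniform_limit {0..T} (\<lambda>k. w (r k)) v sequentially"
proof -
  \<comment> \<open>Enumerates the points k T/(m+1), cut off at T, of all equidistant partitions of
    the interval.\<close>
  define q where "q i = (case prod_decode i of (k, m) \<Rightarrow> min T (real k * T / real (Suc m)))" for i
  have q: "q i \<in> {0..T}" for i using T by (auto simp: q_def split: prod.splits)
  interpret subseqs "\<lambda>i s. convergent (\<lambda>k. w (s k) (q i))"
  proof
    fix i and s :: "nat \<Rightarrow> nat" assume "strict_mono s"
    have "compact (closure (range (\<lambda>n. w n (q i))))" using pc[OF q] by (simp add: precompact_iff_compact_closure)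
    then have "seq_compact (closure (range (\<lambda>n. w n (q i))))" by (rule compact_imp_seq_compact)
    moreover have "\<forall>k. w (s k) (q i) \<in> closure (range (\<lambda>n. w n (q i)))"
      by (intro allI set_mp[OF closure_subset]) simp
    ultimately obtain l r where "strict_mono (r :: nat \<Rightarrow> nat)" "((\<lambda>k. w (s k) (q i)) \<circ> r) \<longlonglongrightarrow> l"
      by (rule seq_compactE)
    then show "\<exists>r. strict_mono r \<and> convergent (\<lambda>k. w ((s \<circ> r) k) (q i))"
      by (auto simp: convergent_def o_def)
  qed
  have conv: "convergent (\<lambda>k. w (diagseq k) (q i))" for i
  proof -
    \<comment> \<open>Only the part of the diagonal sequence beyond index i is known to be a
      subsequence of the selection for \<open>q i\<close>; an initial segment does not affect
      convergence.\<close>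
    have "convergent (\<lambda>k. w ((diagseq \<circ> (+) (Suc i)) k) (q i))"
    proof (rule diagseq_holds)
      fix r s :: "nat \<Rightarrow> nat" and n assume r: "strict_mono r" and "convergent (\<lambda>k. w (s k) (q n))"
      then obtain l where "(\<lambda>k. w (s k) (q n)) \<longlonglongrightarrow> l" by (auto simp: convergent_def)
      from LIMSEQ_subseq_LIMSEQ[OF this r] show "convergent (\<lambda>k. w ((s \<circ> r) k) (q n))"
        unfolding convergent_def o_def by (rule exI)
    qed
    then have "convergent (\<lambda>k. w (diagseq (k + Suc i)) (q i))" by (simp add: o_def add.commute)
    then show ?thesis by (simp only: convergent_ignore_initial_segment[of "\<lambda>k. w (diagseq k) (q i)" "Suc i"])
  qed
  have "uniformly_Cauchy_on {0..T} (\<lambda>k. w (diagseq k))"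
  proof (rule uniformly_Cauchy_onI)
    fix e :: real assume e: "e > 0"
    then obtain d where d: "d > 0" "\<And>n t t'. t \<in> {0..T} \<Longrightarrow> t' \<in> {0..T} \<Longrightarrow> \<bar>t - t'\<bar> < d \<Longrightarrow> dist (w n t) (w n t') < e / 3"
      using eq[of "e / 3"] by (auto simp: zero_less_divide_iff)
    obtain m where m: "T / real (Suc m) < d"
      using reals_Archimedean[of "d / T"] d(1) T by (auto simp: field_simps)
    define p where "p k = min T (real k * T / real (Suc m))" for k
    have pq: "p k = q (prod_encode (k, m))" for k by (simp add: p_def q_def)
    have "\<exists>L. \<forall>i\<ge>L. \<forall>j\<ge>L. dist (w (diagseq i) (p k)) (w (diagseq j) (p k)) < e / 3" for k
      using metric_CauchyD[OF convergent_Cauchy[OF conv], of "e / 3" "prod_encode (k, m)"] e by (simp add: pq)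
    then obtain L where L: "\<And>k i j. i \<ge> L k \<Longrightarrow> j \<ge> L k \<Longrightarrow> dist (w (diagseq i) (p k)) (w (diagseq j) (p k)) < e / 3" by metis
    define L0 where "L0 = Max (L ` {..Suc m})"
    have L0: "L k \<le> L0" if "k \<le> Suc m" for k using that by (auto simp: L0_def)
    show "\<exists>M. \<forall>x\<in>{0..T}. \<forall>i\<ge>M. \<forall>j\<ge>M. dist (w (diagseq i) x) (w (diagseq j) x) < e"
    proof (intro exI[of _ L0] ballI allI impI)
      fix t i j assume t: "t \<in> {0..T}" and ij: "L0 \<le> i" "L0 \<le> j"
      define k where "k = nat \<lfloor>t * real (Suc m) / T\<rfloor>"
      have k0: "real k = real_of_int \<lfloor>t * real (Suc m) / T\<rfloor>" using t T by (simp add: k_def)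
      have k1: "real k \<le> t * real (Suc m) / T" "t * real (Suc m) / T < real k + 1" unfolding k0 by linarith+
      have "t * real (Suc m) / T \<le> real (Suc m)" using t T by (simp add: divide_le_eq mult.commute mult_left_mono)
      then have "k \<le> Suc m" using k1(1) by linarith
      have kt: "real k * T / real (Suc m) \<le> t" "t - real k * T / real (Suc m) < T / real (Suc m)"
      proof -
        have 1: "real k * T \<le> t * real (Suc m)" "t * real (Suc m) < (real k + 1) * T"
          using k1 T by (simp_all only: pos_le_divide_eq pos_divide_less_eq)
        then show "real k * T / real (Suc m) \<le> t" by (subst pos_divide_le_eq) simp_all
        have "t < (real k + 1) * T / real (Suc m)" using 1(2) by (subst pos_less_divide_eq) simp_all
        then show "t - real k * T / real (Suc m) < T / real (Suc m)" by (simp only: distrib_right add_divide_distrib mult_1)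
      qed
      then have pk: "p k = real k * T / real (Suc m)" using t by (simp add: p_def)
      have "p k \<in> {0..T}" unfolding pq by (rule q)
      moreover have "\<bar>t - p k\<bar> < d" using kt m unfolding pk by linarith
      ultimately have "dist (w n t) (w n (p k)) < e / 3" for n using t by (intro d(2))
      note near = this[of "diagseq i"] this[of "diagseq j"]
      have "dist (w (diagseq i) (p k)) (w (diagseq j) (p k)) < e / 3"
        using L0[OF \<open>k \<le> Suc m\<close>] ij by (intro L) auto
      then show "dist (w (diagseq i) t) (w (diagseq j) t) < e"
        using near dist_triangle[of "w (diagseq i) t" "w (diagseq j) t" "w (diagseq i) (p k)"]
          dist_triangle[of "w (diagseq i) (p k)" "w (diagseq j) t" "w (diagseq j) (p k)"]
        by (simp add: dist_commute)
    qed
  qed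
  then have "uniformly_convergent_on {0..T} (\<lambda>k. w (diagseq k))" by (rule Cauchy_uniformly_convergent)
  then obtain v where "uniform_limit {0..T} (\<lambda>k. w (diagseq k)) v sequentially" unfolding uniformly_convergent_on_def by blast
  then show ?thesis using subseq_diagseq by blast
qed

section \<open>Convolution with a compact operator family\<close>

text \<open>A single integrable \<open>\<psi>\<close> dominates all forcing terms, so the estimates
  below are uniform over a whole class of functions h. At time 0, where a resolvent family is the
  identity, only strong continuity can be expected.\<close>

locale compact_convolution =
  fixes G :: "real \<Rightarrow> 'w::banach \<Rightarrow>\<^sub>L 'w" and T N :: real and \<psi> :: "real \<Rightarrow> real"
  assumes T: "T > 0"
    and N: "\<And>t. t \<in> {0..T} \<Longrightarrow> norm (G t) \<le> N"
    and strong: "\<And>x. continuous_on {0..T} (\<lambda>t. G t x)"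
    and uniform: "continuous_on {0<..T} (G :: real \<Rightarrow> 'w \<Rightarrow>\<^sub>L 'w)"
    and compact: "\<And>t. t \<in> {0<..T} \<Longrightarrow> G t \<in> compact_ops"
    and \<psi>: "integrable (lebesgue_on {0..T}) \<psi>" "\<And>t. t \<in> {0..T} \<Longrightarrow> 0 \<le> \<psi> t"
begin

abbreviation "\<L> \<equiv> lebesgue_on {0..T}"

lemma N0: "0 \<le> N" using order_trans[OF norm_ge_zero N[of 0]] T by simp

definition dominated :: "(real \<Rightarrow> 'w) \<Rightarrow> bool" where
  "dominated h \<longleftrightarrow> strongly_measurable \<L> h \<and> (AE s in \<L>. norm (h s) \<le> \<psi> s)"

text \<open>The choice is meaningful only for dominated \<open>h\<close>, where the integral exists.\<close>

definition conv :: "(real \<Rightarrow> 'w) \<Rightarrow> real \<Rightarrow> 'w" where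
  "conv h t = (SOME I. has_strong_bochner_integral \<L> (\<lambda>s. indicator {0..t} s *\<^sub>R G (t - s) (h s)) I)"

lemma norm_G_apply: "v \<in> {0..T} \<Longrightarrow> norm (G v x) \<le> N * norm x"
  by (rule order_trans[OF norm_blinfun mult_right_mono[OF N]]) simp_all

lemma conv_integral:
  assumes h: "dominated h" and t: "t \<in> {0..T}"
  shows "has_strong_bochner_integral \<L> (\<lambda>s. indicator {0..t} s *\<^sub>R G (t - s) (h s)) (conv h t)"
  unfolding conv_def
proof (rule someI_ex, rule strong_bochner_integral_exists[OF finite_measure_lebesgue_on])
  show "strongly_measurable \<L> (\<lambda>s. indicator {0..t} s *\<^sub>R G (t - s) (h s))"
  proof (rule strongly_measurable_operator_apply)
    show "continuous_on {0..t} (\<lambda>s. G (t - s) x)" for x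
      by (rule continuous_on_compose2[OF strong[of x]]) (use t in \<open>auto intro!: continuous_intros\<close>)
    show "norm (G (t - s)) \<le> N" if "s \<in> {0..t}" for s using that t by (intro N) auto
    show "strongly_measurable \<L> h" using h by (simp add: dominated_def)
  qed
  show "integrable \<L> (\<lambda>s. N * \<psi> s)" using \<psi>(1) by simp
  have "AE s in \<L>. norm (h s) \<le> \<psi> s" using h by (simp add: dominated_def)
  then show "AE s in \<L>. norm (indicator {0..t} s *\<^sub>R G (t - s) (h s)) \<le> N * \<psi> s"
    using AE_space
  proof eventually_elim
    case (elim s)
    have "N * norm (h s) \<le> N * \<psi> s" using elim(1) N0 by (rule mult_left_mono)
    moreover have "0 \<le> N * \<psi> s" using \<psi>(2)[of s] elim(2) N0 by simp
    ultimately show ?case using norm_G_apply[of "t - s" "h s"] t by (auto simp: indicator_def)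
  qed
qed

text \<open>Causality: the value at t depends on h up to time t only, which lets the delayed
  equation be solved step by step.\<close>

lemma conv_cong: "(\<And>s. s \<in> {0..t} \<Longrightarrow> h s = h' s) \<Longrightarrow> conv h t = conv h' t"
proof -
  assume "\<And>s. s \<in> {0..t} \<Longrightarrow> h s = h' s"
  then have "(\<lambda>s. indicator {0..t} s *\<^sub>R G (t - s) (h s)) = (\<lambda>s. indicator {0..t} s *\<^sub>R G (t - s) (h' s))"
    by (auto simp: fun_eq_iff indicator_def)
  then show ?thesis unfolding conv_def by simp
qed

lemma norm_conv_le:
  assumes h: "dominated h" and t: "t \<in> {0..T}"
  shows "norm (conv h t) \<le> N * integral\<^sup>L \<L> \<psi>"
proof -
  have "norm (conv h t) \<le> integral\<^sup>L \<L> (\<lambda>s. N * \<psi> s)"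
  proof (rule strong_bochner_integral_norm_le_integral[OF conv_integral[OF h t]])
    show "integrable \<L> (\<lambda>s. N * \<psi> s)" using \<psi>(1) by simp
    have "AE s in \<L>. norm (h s) \<le> \<psi> s" using h by (simp add: dominated_def)
    then show "AE s in \<L>. norm (indicator {0..t} s *\<^sub>R G (t - s) (h s)) \<le> N * \<psi> s"
      using AE_space
    proof eventually_elim
      case (elim s)
      have "N * norm (h s) \<le> N * \<psi> s" using elim(1) N0 by (rule mult_left_mono)
      moreover have "0 \<le> N * \<psi> s" using \<psi>(2)[of s] elim(2) N0 by simp
      ultimately show ?case using norm_G_apply[of "t - s" "h s"] t by (auto simp: indicator_def)
    qed
  qed
  then show ?thesis by simp
qed

lemma conv_0:
  assumes h: "dominated h"
  shows "conv h 0 = 0"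
proof -
  have "AE s in \<L>. s \<noteq> 0"
  proof (rule AE_I[of _ _ "{0}"])
    show "{0} \<in> sets \<L>" using T by (intro interval_sets) auto
    show "emeasure \<L> {0} = 0" using T by (subst emeasure_restrict_space) auto
  qed auto
  then have "AE s in \<L>. norm (indicator {0..0} s *\<^sub>R G (0 - s) (h s)) \<le> 0"
    by eventually_elim (simp add: indicator_def)
  from strong_bochner_integral_norm_le_integral[OF conv_integral[OF h, of 0] _ this] T show ?thesis by simp
qed

text \<open>Dominated convergence with majorant 2 \<psi>, applied to measurable representatives
  \<open>d\<close> of the norms of the differences.\<close>

lemma conv_tendsto:
  assumes h: "\<And>n. dominated (h n)" "dominated h'" and lim: "AE s in \<L>. (\<lambda>n. h n s) \<longlonglongrightarrow> h' s" and t: "t \<in> {0..T}"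
  shows "(\<lambda>n. conv (h n) t) \<longlonglongrightarrow> conv h' t"
proof -
  have sm: "strongly_measurable \<L> (h n)" "strongly_measurable \<L> h'" "AE s in \<L>. norm (h n s) \<le> \<psi> s" "AE s in \<L>. norm (h' s) \<le> \<psi> s" for n
    using h by (simp_all add: dominated_def)
  have "\<forall>n. \<exists>d. d \<in> borel_measurable \<L> \<and> (AE s in \<L>. norm (h n s - h' s) = d s)"
    by (intro allI strongly_measurable_norm strongly_measurable_diff sm)
  from choice[OF this] obtain d where d0: "\<forall>n. d n \<in> borel_measurable \<L> \<and> (AE s in \<L>. norm (h n s - h' s) = d n s)" ..
  then have d: "\<And>n. d n \<in> borel_measurable \<L>" "\<And>n. AE s in \<L>. norm (h n s - h' s) = d n s" by simp_all
  have le: "AE s in \<L>. norm (d n s) \<le> 2 * \<psi> s" for n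
    using d(2)[of n] sm(3)[of n] sm(4)
  proof eventually_elim
    case (elim s)
    have "\<bar>d n s\<bar> = norm (h n s - h' s)" unfolding elim(1)[symmetric] by simp
    then show ?case using norm_triangle_ineq4[of "h n s" "h' s"] elim(2,3) by simp
  qed
  have int: "integrable \<L> (d n)" for n
    by (rule Bochner_Integration.integrable_bound[of _ "\<lambda>s. 2 * \<psi> s"])
      (use \<psi>(1) d(1) le[of n] in \<open>auto elim!: eventually_mono\<close>)
  have "(\<lambda>n. integral\<^sup>L \<L> (d n)) \<longlonglongrightarrow> integral\<^sup>L \<L> (\<lambda>s. 0 :: real)"
  proof (rule integral_dominated_convergence[where w = "\<lambda>s. 2 * \<psi> s"])
    have "AE s in \<L>. \<forall>n. norm (h n s - h' s) = d n s" using d(2) by (simp add: AE_all_countable)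
    then show "AE s in \<L>. (\<lambda>n. d n s) \<longlonglongrightarrow> 0"
      using lim
    proof eventually_elim
      case (elim s)
      have "(\<lambda>n. norm (h n s - h' s)) \<longlonglongrightarrow> 0" using elim(2) by (intro tendsto_norm_zero LIM_zero)
      then show ?case using elim(1) by simp
    qed
  qed (use \<psi>(1) d(1) le in auto)
  then have "(\<lambda>n. integral\<^sup>L \<L> (d n)) \<longlonglongrightarrow> 0" by simp
  then have "(\<lambda>n. N * integral\<^sup>L \<L> (d n)) \<longlonglongrightarrow> 0" by (rule tendsto_mult_right_zero)
  moreover have "norm (conv (h n) t - conv h' t) \<le> N * integral\<^sup>L \<L> (d n)" for n
  proof -
    have "norm (conv (h n) t - conv h' t) \<le> integral\<^sup>L \<L> (\<lambda>s. N * d n s)"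
    proof (rule strong_bochner_integral_diff_le[OF conv_integral[OF h(1) t] conv_integral[OF h(2) t]])
      show "AE s in \<L>. norm (indicator {0..t} s *\<^sub>R G (t - s) (h n s) - indicator {0..t} s *\<^sub>R G (t - s) (h' s)) \<le> N * d n s"
        using d(2)[of n] AE_space
      proof eventually_elim
        case (elim s)
        have "0 \<le> N * d n s" using N0 elim(1)[symmetric] by simp
        moreover have "norm (G (t - s) (h n s) - G (t - s) (h' s)) \<le> N * d n s" if "s \<le> t"
          using norm_G_apply[of "t - s" "h n s - h' s"] elim that t by (simp add: blinfun.diff_right)
        ultimately show ?case by (auto simp: indicator_def)
      qed
    qed (use int in simp)
    then show ?thesis by simp
  qed
  ultimately have "(\<lambda>n. conv (h n) t - conv h' t) \<longlonglongrightarrow> 0"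
    by (rule Lim_null_comparison[OF always_eventually[OF allI], rotated])
  then show ?thesis by (rule LIM_zero_cancel)
qed

lemma window_small:
  assumes "e > 0"
  shows "\<exists>d>0. \<forall>p q. q - p < d \<longrightarrow> integral\<^sup>L \<L> (\<lambda>s. indicator {p<..q} s * \<psi> s) < e"
proof -
  obtain d where d: "d > 0" "\<And>A. A \<in> sets \<L> \<Longrightarrow> measure \<L> A < d \<Longrightarrow> integral\<^sup>L \<L> (\<lambda>s. indicator A s * \<psi> s) < e"
    using integral_small_sets[OF finite_measure_lebesgue_on \<psi>(1) _ assms] \<psi>(2) by (auto simp del: atLeastAtMost_iff)
  have "integral\<^sup>L \<L> (\<lambda>s. indicator {p<..q} s * \<psi> s) < e" if pq: "q - p < d" for p q
  proof -
    let ?A = "{p<..q} \<inter> {0..T}"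
    have A: "?A \<in> sets \<L>" by (intro interval_sets) auto
    have "measure \<L> ?A = measure lebesgue ?A"
      by (rule measure_restrict_space) auto
    also have "\<dots> \<le> measure lebesgue {p..max p q}"
      by (rule measure_mono_fmeasurable) auto
    also have "\<dots> < d" using pq d(1) by (auto simp: max_def)
    finally have "integral\<^sup>L \<L> (\<lambda>s. indicator ?A s * \<psi> s) < e" by (rule d(2)[OF A])
    also have "integral\<^sup>L \<L> (\<lambda>s. indicator ?A s * \<psi> s) = integral\<^sup>L \<L> (\<lambda>s. indicator {p<..q} s * \<psi> s)"
      by (intro Bochner_Integration.integral_cong) (auto simp: indicator_def)
    finally show ?thesis .
  qed
  then show ?thesis using d(1) by (intro exI[of _ d] conjI allI impI)
qed

lemma window_integrable: "integrable \<L> (\<lambda>s. indicator {p<..q} s * \<psi> s)"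
proof -
  have "{p<..q} \<inter> {0..T} \<in> sets \<L>" by (intro interval_sets) auto
  from integrable_mult_indicator[OF this \<psi>(1)] show ?thesis
    by (rule Bochner_Integration.integrable_cong[THEN iffD1, rotated 2]) (auto simp: indicator_def)
qed

lemma G_modulus:
  assumes "\<delta> > 0" "e > 0"
  shows "\<exists>d>0. \<forall>v\<in>{\<delta>..T}. \<forall>v'\<in>{\<delta>..T}. \<bar>v - v'\<bar> < d \<longrightarrow> norm (G v - G v') < e"
proof -
  have "continuous_on {\<delta>..T} (G :: real \<Rightarrow> 'w \<Rightarrow>\<^sub>L 'w)" using assms(1) by (intro continuous_on_subset[OF uniform]) auto
  then have "uniformly_continuous_on {\<delta>..T} (G :: real \<Rightarrow> 'w \<Rightarrow>\<^sub>L 'w)" by (rule compact_uniformly_continuous) simp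
  then obtain d where "d > 0" "\<forall>v\<in>{\<delta>..T}. \<forall>v'\<in>{\<delta>..T}. dist v' v < d \<longrightarrow> dist (G v') (G v) < e"
    using assms(2) unfolding uniformly_continuous_on_def by (elim allE[of _ e] impE) (assumption, elim exE conjE)
  then show ?thesis by (intro exI[of _ d]) (simp add: dist_norm abs_minus_commute norm_minus_commute)
qed

text \<open>For s \<le> t - d1/2 both t - s and t' - s stay away from 0, where \<open>G\<close> is
  uniformly norm continuous. On the remaining window before t' only the norm bound is used, but
  there the mass of \<open>\<psi>\<close> is small. Neither estimate depends on h.\<close>

lemma conv_equicontinuous:
  assumes e: "e > 0"
  shows "\<exists>d>0. \<forall>h. dominated h \<longrightarrow> (\<forall>t\<in>{0..T}. \<forall>t'\<in>{0..T}. \<bar>t - t'\<bar> < d \<longrightarrow> dist (conv h t) (conv h t') < e)"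
proof -
  define P where "P = integral\<^sup>L \<L> \<psi>"
  have P: "P \<ge> 0" unfolding P_def using \<psi>(2) by (intro Bochner_Integration.integral_nonneg) auto
  \<comment> \<open>The window estimate is later multiplied by 2 N; taking 2 N + 1, and
    \<open>P + 1\<close> below, avoids a division by zero.\<close>
  obtain d1 where d1: "d1 > 0" "\<And>p q. q - p < d1 \<Longrightarrow> integral\<^sup>L \<L> (\<lambda>s. indicator {p<..q} s * \<psi> s) < e / (2 * (2 * N + 1))"
    using window_small[of "e / (2 * (2 * N + 1))"] e N0 by auto
  obtain d2 where d2: "d2 > 0" "\<And>v v'. v \<in> {d1 / 2..T} \<Longrightarrow> v' \<in> {d1 / 2..T} \<Longrightarrow> \<bar>v - v'\<bar> < d2 \<Longrightarrow> norm (G v - G v') < e / (2 * (P + 1))"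
    using G_modulus[of "d1 / 2" "e / (2 * (P + 1))"] d1(1) e P by auto
  have main: "dist (conv h t) (conv h t') < e"
    if h: "dominated h" and t: "t \<in> {0..T}" "t' \<in> {0..T}" "t \<le> t'" "t' - t < min (d1 / 2) d2" for h t t'
  proof -
    \<comment> \<open>Its length is d1/2 + (t' - t), which is below d1.\<close>
    let ?W = "{t - d1 / 2<..t'}"
    have "norm (conv h t' - conv h t) \<le> integral\<^sup>L \<L> (\<lambda>s. e / (2 * (P + 1)) * \<psi> s + 2 * N * (indicator ?W s * \<psi> s))"
    proof (rule strong_bochner_integral_diff_le[OF conv_integral[OF h t(2)] conv_integral[OF h t(1)]])
      show "integrable \<L> (\<lambda>s. e / (2 * (P + 1)) * \<psi> s + 2 * N * (indicator ?W s * \<psi> s))"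
        using \<psi>(1) window_integrable by (intro Bochner_Integration.integrable_add integrable_mult_right) auto
      have "AE s in \<L>. norm (h s) \<le> \<psi> s" using h by (simp add: dominated_def)
      then show "AE s in \<L>. norm (indicator {0..t'} s *\<^sub>R G (t' - s) (h s) - indicator {0..t} s *\<^sub>R G (t - s) (h s))
        \<le> e / (2 * (P + 1)) * \<psi> s + 2 * N * (indicator ?W s * \<psi> s)"
        using AE_space
      proof eventually_elim
        case (elim s)
        then have s: "0 \<le> s" "s \<le> T" by simp_all
        have p0: "0 \<le> \<psi> s" using \<psi>(2) elim(2) by simp
        have e0: "0 \<le> e / (2 * (P + 1)) * \<psi> s" using e P p0 by simp
        have Gb: "norm (G v (h s)) \<le> N * \<psi> s" if "v \<in> {0..T}" for v
          using norm_G_apply[OF that, of "h s"] mult_left_mono[OF elim(1) N0] by linarith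
        have N\<psi>: "0 \<le> N * \<psi> s" using N0 p0 by simp
        consider "s \<le> t - d1 / 2" | "t - d1 / 2 < s" "s \<le> t" | "t < s" "s \<le> t'" | "t' < s" by linarith
        then show ?case
        proof cases
          case 1
          have "norm (G (t' - s) (h s) - G (t - s) (h s)) \<le> norm (G (t' - s) - G (t - s)) * norm (h s)"
            unfolding blinfun.diff_left[symmetric] by (rule norm_blinfun)
          also have "\<dots> \<le> e / (2 * (P + 1)) * \<psi> s"
            using 1 t s d1(1) elim(1) e P by (intro mult_mono less_imp_le[OF d2(2)]) auto
          finally show ?thesis using 1 t s d1(1) by (simp add: indicator_def)
        next
          case 2
          have "norm (G (t' - s) (h s) - G (t - s) (h s)) \<le> N * \<psi> s + N * \<psi> s"
            using Gb[of "t' - s"] Gb[of "t - s"] 2 t s norm_triangle_ineq4[of "G (t' - s) (h s)" "G (t - s) (h s)"] by auto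
          then show ?thesis using 2 t s e0 by (simp add: indicator_def)
        next
          case 3
          then show ?thesis using Gb[of "t' - s"] t s e0 N\<psi> d1(1) by (simp add: indicator_def)
        next
          case 4
          then show ?thesis using t s e0 by (simp add: indicator_def)
        qed
      qed
    qed
    also have "\<dots> = e / (2 * (P + 1)) * P + 2 * N * integral\<^sup>L \<L> (\<lambda>s. indicator ?W s * \<psi> s)"
      unfolding P_def using \<psi>(1) window_integrable by (subst Bochner_Integration.integral_add) simp_all
    also have "\<dots> < e"
    proof -
      have 1: "e / (2 * (P + 1)) * P \<le> e / 2"
        using P e by (simp add: field_simps)
      have "integral\<^sup>L \<L> (\<lambda>s. indicator ?W s * \<psi> s) < e / (2 * (2 * N + 1))" using t(4) by (intro d1(2)) simp
      then have "2 * N * integral\<^sup>L \<L> (\<lambda>s. indicator ?W s * \<psi> s) \<le> 2 * N * (e / (2 * (2 * N + 1)))"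
        using N0 by (intro mult_left_mono) auto
      also have "\<dots> < (2 * N + 1) * (e / (2 * (2 * N + 1)))" using N0 e by (intro mult_strict_right_mono) auto
      also have "\<dots> = e / 2" using N0 by (simp add: field_simps)
      finally show ?thesis using 1 by linarith
    qed
    finally show ?thesis by (simp add: dist_norm norm_minus_commute)
  qed
  show ?thesis
  proof (intro exI[of _ "min (d1 / 2) d2"] conjI allI impI ballI)
    show "0 < min (d1 / 2) d2" using d1 d2 by simp
    fix h t t' assume "dominated h" "t \<in> {0..T}" "t' \<in> {0..T}" "\<bar>t - t'\<bar> < min (d1 / 2) d2"
    then show "dist (conv h t) (conv h t') < e"
      using main[of h t t'] main[of h t' t] by (cases "t \<le> t'") (auto simp: dist_commute)
  qed
qed

lemma conv_continuous: "dominated h \<Longrightarrow> continuous_on {0..T} (conv h)"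
proof (unfold continuous_on_iff, intro ballI allI impI)
  fix t e :: real assume h: "dominated h" and t: "t \<in> {0..T}" and e: "e > 0"
  from conv_equicontinuous[OF e] obtain d where d: "d > 0"
    "\<forall>h. dominated h \<longrightarrow> (\<forall>t\<in>{0..T}. \<forall>t'\<in>{0..T}. \<bar>t - t'\<bar> < d \<longrightarrow> dist (conv h t) (conv h t') < e)"
    by (elim exE conjE)
  have "dist (conv h t') (conv h t) < e" if "t' \<in> {0..T}" "dist t' t < d" for t'
    using d(2)[rule_format, OF h that(1) t] that(2) by (simp add: dist_real_def)
  then show "\<exists>d>0. \<forall>x'\<in>{0..T}. dist x' t < d \<longrightarrow> dist (conv h x') (conv h t) < e" using d(1) by (intro exI[of _ d]) simp
qed

text \<open>\<open>G 0\<close> need not be compact, so the last stretch of length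
  \<open>\<delta>\<close> is discarded at small cost. On the rest, rounding s to the grid changes
  G(t - s) little in norm and turns the integral into a finite sum of compact operators applied to
  vectors of norm at most \<open>P\<close>.\<close>

lemma precompact_conv:
  assumes t: "t \<in> {0..T}"
  shows "precompact {conv h t |h. dominated h}"
proof (rule precompact_approx)
  fix e :: real assume e: "e > 0"
  define P where "P = integral\<^sup>L \<L> \<psi>"
  have P: "P \<ge> 0" unfolding P_def using \<psi>(2) by (intro Bochner_Integration.integral_nonneg) auto
  obtain d1 where d1: "d1 > 0" "\<And>p q. q - p < d1 \<Longrightarrow> integral\<^sup>L \<L> (\<lambda>s. indicator {p<..q} s * \<psi> s) < e / (2 * (N + 1))"
    using window_small[of "e / (2 * (N + 1))"] e N0 by auto
  define \<delta> where "\<delta> = d1 / 2"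
  have \<delta>: "\<delta> > 0" "\<delta> < d1" using d1 by (auto simp: \<delta>_def)
  obtain d2 where d2: "d2 > 0" "\<And>v v'. v \<in> {\<delta>..T} \<Longrightarrow> v' \<in> {\<delta>..T} \<Longrightarrow> \<bar>v - v'\<bar> < d2 \<Longrightarrow> norm (G v - G v') < e / (2 * (P + 1))"
    using G_modulus[of \<delta> "e / (2 * (P + 1))"] \<delta>(1) e P by auto
  obtain n where n: "1 / real (Suc n) < d2" using reals_Archimedean[OF d2(1)] by (auto simp: inverse_eq_divide)
  let ?V = "{v \<in> grid n ` {0..T}. v \<le> t - \<delta>}"
  let ?B = "\<lambda>v. {s \<in> {0..T}. s \<le> t - \<delta> \<and> grid n s = v}"
  have fin: "finite ?V" using simple_functionD(1)[OF grid_simple[of T n]] by simp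
  have B: "?B v \<in> sets \<L>" for v
  proof -
    have "grid n -` {v} \<inter> space \<L> \<in> sets \<L>" by (rule simple_functionD(2)[OF grid_simple])
    moreover have "{..t - \<delta>} \<inter> {0..T} \<in> sets \<L>" by (intro interval_sets) auto
    moreover have "(grid n -` {v} \<inter> space \<L>) \<inter> ({..t - \<delta>} \<inter> {0..T}) = ?B v" by auto
    ultimately show ?thesis by (metis sets.Int)
  qed
  \<comment> \<open>This set depends on t and the accuracy but not on h, since the integral of any
    dominated h over a cell \<open>?B v\<close> has norm at most \<open>P\<close>.\<close>
  let ?Y = "{\<Sum>v\<in>?V. x v |x. \<forall>v\<in>?V. x v \<in> blinfun_apply (G (t - v)) ` cball 0 P}"
  have "precompact ?Y"
  proof (rule precompact_finite_sum[OF fin])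
    fix v assume "v \<in> ?V"
    then obtain x where x: "x \<in> {0..T}" "v = grid n x" "v \<le> t - \<delta>" by (elim CollectE conjE imageE) auto
    have "v \<ge> 0" unfolding x(2) using x(1) by (intro grid_nonneg) simp
    then have "t - v \<in> {0<..T}" using x(3) t \<delta> by simp
    then have "compact_operator (G (t - v))" using compact by (simp add: compact_ops_def)
    then show "precompact (blinfun_apply (G (t - v)) ` cball 0 P)"
      unfolding compact_operator_iff_precompact by (elim allE[of _ "cball 0 P"] impE) (rule bounded_cball)
  qed
  moreover
  have "\<exists>y\<in>?Y. dist (conv h t) y < e" if h: "dominated h" for h
  proof -
    have hs: "strongly_measurable \<L> h" "AE s in \<L>. norm (h s) \<le> \<psi> s" using h by (simp_all add: dominated_def)
    have nb: "AE s in \<L>. norm (indicator (?B v) s *\<^sub>R h s) \<le> \<psi> s" for v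
      using hs(2) AE_space by eventually_elim (auto simp: indicator_def \<psi>(2))
    have "\<forall>v. \<exists>I. has_strong_bochner_integral \<L> (\<lambda>s. indicator (?B v) s *\<^sub>R h s) I"
      by (intro allI strong_bochner_integral_exists[OF finite_measure_lebesgue_on strongly_measurable_indicator[OF hs(1) B] \<psi>(1) nb])
    from choice[OF this] obtain I where I: "\<forall>v. has_strong_bochner_integral \<L> (\<lambda>s. indicator (?B v) s *\<^sub>R h s) (I v)" ..
    have IP: "norm (I v) \<le> P" for v
      unfolding P_def by (rule strong_bochner_integral_norm_le_integral[OF I[THEN spec] \<psi>(1) nb])
    let ?y = "\<Sum>v\<in>?V. G (t - v) (I v)"
    have y: "?y \<in> ?Y" using IP by (intro CollectI exI[of _ "\<lambda>v. G (t - v) (I v)"] conjI refl ballI imageI) simp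
    have yi: "has_strong_bochner_integral \<L> (\<lambda>s. \<Sum>v\<in>?V. G (t - v) (indicator (?B v) s *\<^sub>R h s)) ?y"
      using I by (intro strong_bochner_integral_sum fin blinfun.bounded_linear_right) auto
    have "norm (conv h t - ?y) \<le> integral\<^sup>L \<L> (\<lambda>s. e / (2 * (P + 1)) * \<psi> s + N * (indicator {t - \<delta><..t} s * \<psi> s))"
    proof (rule strong_bochner_integral_diff_le[OF conv_integral[OF h t] yi])
      show "integrable \<L> (\<lambda>s. e / (2 * (P + 1)) * \<psi> s + N * (indicator {t - \<delta><..t} s * \<psi> s))"
        using \<psi>(1) window_integrable by (intro Bochner_Integration.integrable_add integrable_mult_right) auto
      show "AE s in \<L>. norm (indicator {0..t} s *\<^sub>R G (t - s) (h s) - (\<Sum>v\<in>?V. G (t - v) (indicator (?B v) s *\<^sub>R h s)))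
        \<le> e / (2 * (P + 1)) * \<psi> s + N * (indicator {t - \<delta><..t} s * \<psi> s)"
        using hs(2) AE_space
      proof eventually_elim
        case (elim s)
        then have s: "0 \<le> s" "s \<le> T" by simp_all
        have p0: "0 \<le> \<psi> s" using \<psi>(2) elim(2) by simp
        have e0: "0 \<le> e / (2 * (P + 1)) * \<psi> s" using e P p0 by simp
        show ?case
        proof (cases "s \<le> t - \<delta>")
          case True
          have gs: "grid n s \<in> ?V" using True s grid_le(1)[of n s] by auto
          have "(\<Sum>v\<in>?V. G (t - v) (indicator (?B v) s *\<^sub>R h s)) = (\<Sum>v\<in>?V. if v = grid n s then G (t - v) (h s) else 0)"
            using True s by (intro sum.cong) (auto simp: indicator_def blinfun.zero_right)
          also have "\<dots> = G (t - grid n s) (h s)" using fin gs by (simp only: sum.delta if_True)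
          finally have sum: "(\<Sum>v\<in>?V. G (t - v) (indicator (?B v) s *\<^sub>R h s)) = G (t - grid n s) (h s)" .
          have "norm (G (t - s) (h s) - G (t - grid n s) (h s)) \<le> norm (G (t - s) - G (t - grid n s)) * norm (h s)"
            unfolding blinfun.diff_left[symmetric] by (rule norm_blinfun)
          also have "\<dots> \<le> e / (2 * (P + 1)) * \<psi> s"
          proof (intro mult_mono less_imp_le[OF d2(2)])
            show "t - s \<in> {\<delta>..T}" using True t s by auto
            show "t - grid n s \<in> {\<delta>..T}" using True t s grid_le(1)[of n s] grid_nonneg[OF s(1), of n] by auto
            show "\<bar>t - s - (t - grid n s)\<bar> < d2" using grid_le(1)[of n s] grid_le(2)[of s n] n by auto
          qed (use elim(1) e P in auto)
          finally show ?thesis unfolding sum using True s \<delta>(1) by (simp add: indicator_def)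
        next
          case False
          have z: "(\<Sum>v\<in>?V. G (t - v) (indicator (?B v) s *\<^sub>R h s)) = 0"
            using False by (intro sum.neutral) (auto simp: indicator_def blinfun.zero_right)
          show ?thesis
          proof (cases "s \<le> t")
            case True
            have "norm (G (t - s) (h s)) \<le> N * \<psi> s"
              using norm_G_apply[of "t - s" "h s"] True t s mult_left_mono[OF elim(1) N0] by auto
            then show ?thesis unfolding z using True False s e0 by (simp add: indicator_def)
          next
            case False
            then show ?thesis unfolding z using e0 by (simp add: indicator_def)
          qed
        qed
      qed
    qed
    also have "\<dots> = e / (2 * (P + 1)) * P + N * integral\<^sup>L \<L> (\<lambda>s. indicator {t - \<delta><..t} s * \<psi> s)"
      unfolding P_def using \<psi>(1) window_integrable by (subst Bochner_Integration.integral_add) simp_all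
    also have "\<dots> < e"
    proof -
      have 1: "e / (2 * (P + 1)) * P \<le> e / 2"
        using P e by (simp add: field_simps)
      have "integral\<^sup>L \<L> (\<lambda>s. indicator {t - \<delta><..t} s * \<psi> s) < e / (2 * (N + 1))" using \<delta> by (intro d1(2)) simp
      then have "N * integral\<^sup>L \<L> (\<lambda>s. indicator {t - \<delta><..t} s * \<psi> s) \<le> N * (e / (2 * (N + 1)))"
        using N0 by (intro mult_left_mono) auto
      also have "\<dots> < (N + 1) * (e / (2 * (N + 1)))" using N0 e by (intro mult_strict_right_mono) auto
      also have "\<dots> = e / 2" using N0 by (simp add: field_simps)
      finally show ?thesis using 1 by linarith
    qed
    finally show ?thesis using y by (intro bexI[of _ ?y]) (simp_all add: dist_norm)
  qed
  then have "\<forall>x\<in>{conv h t |h. dominated h}. \<exists>y\<in>?Y. dist x y < e" by (intro ballI) (elim CollectE exE conjE, simp only:)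
  ultimately show "\<exists>Y. precompact Y \<and> (\<forall>x\<in>{conv h t |h. dominated h}. \<exists>y\<in>Y. dist x y < e)" by (intro exI[of _ ?Y] conjI)
qed

section \<open>Tonelli approximation of the nonlinear equation\<close>

definition admissible :: "real \<Rightarrow> (real \<Rightarrow> 'w) \<Rightarrow> bool" where
  "admissible r w \<longleftrightarrow> continuous_on {0..T} w \<and> (\<forall>t\<in>{0..T}. norm (w t) \<le> r)"

lemma integral_\<psi>_nonneg: "0 \<le> integral\<^sup>L \<L> \<psi>"
  using \<psi>(2) by (intro Bochner_Integration.integral_nonneg) auto

lemma admissible_delay:
  assumes "admissible r w" "d \<ge> 0"
  shows "admissible r (\<lambda>s. w (max 0 (s - d)))"
  unfolding admissible_def
proof
  show "continuous_on {0..T} (\<lambda>s. w (max 0 (s - d)))"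
    by (rule continuous_on_compose2[of "{0..T}" w])
      (use assms T in \<open>auto simp: admissible_def intro!: continuous_intros\<close>)
  show "\<forall>t\<in>{0..T}. norm (w (max 0 (t - d))) \<le> r"
    using assms T by (auto simp: admissible_def)
qed

text \<open>Tonelli's scheme: with the delay \<open>d\<close> the equation can be solved step by step on intervals of
  length \<open>d\<close>, so that no fixed point theorem is needed.\<close>

lemma delayed_equation:
  assumes dom: "\<And>w. admissible r w \<Longrightarrow> dominated (\<lambda>s. \<Phi> s (w s))"
    and bound: "N * norm \<zeta> + N * integral\<^sup>L \<L> \<psi> \<le> r" and d: "d > 0"
  shows "\<exists>w. admissible r w \<and> (\<forall>t\<in>{0..T}. w t = G t \<zeta> + conv (\<lambda>s. \<Phi> s (w (max 0 (s - d)))) t)"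
proof -
  define \<Theta> where "\<Theta> w t = G t \<zeta> + conv (\<lambda>s. \<Phi> s (w (max 0 (s - d)))) t" for w t
  define W where "W j = (\<Theta> ^^ j) (\<lambda>t. G t \<zeta>)" for j
  have W_Suc: "W (Suc j) t = G t \<zeta> + conv (\<lambda>s. \<Phi> s (W j (max 0 (s - d)))) t" for j t
    by (simp add: W_def \<Theta>_def)
  have delay_dom: "dominated (\<lambda>s. \<Phi> s (w (max 0 (s - d))))" if "admissible r w" for w
    using dom[OF admissible_delay[OF that]] d by simp
  have adm: "admissible r (W j)" for j
  proof (induction j)
    case 0
    have "norm (G t \<zeta>) \<le> r" if "t \<in> {0..T}" for t
      using norm_G_apply[OF that, of \<zeta>] bound mult_nonneg_nonneg[OF N0 integral_\<psi>_nonneg] by linarith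
    then show ?case using strong[of \<zeta>] by (simp add: admissible_def W_def)
  next
    case (Suc j)
    have "continuous_on {0..T} (\<lambda>t. G t \<zeta> + conv (\<lambda>s. \<Phi> s (W j (max 0 (s - d)))) t)"
      by (intro continuous_on_add strong conv_continuous delay_dom Suc.IH)
    moreover have "norm (G t \<zeta> + conv (\<lambda>s. \<Phi> s (W j (max 0 (s - d)))) t) \<le> r" if "t \<in> {0..T}" for t
      using norm_G_apply[OF that, of \<zeta>] norm_conv_le[OF delay_dom[OF Suc.IH] that] bound
        norm_triangle_ineq[of "G t \<zeta>" "conv (\<lambda>s. \<Phi> s (W j (max 0 (s - d)))) t"] by linarith
    ultimately show ?case by (simp add: admissible_def W_Suc)
  qed
  \<comment> \<open>The delay makes the iterate \<open>W j\<close> final up to time j d: up to time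
    (j+1) d the next iterate reads only values at times at most j d, which have settled. The
    induction starts because the convolution vanishes at time 0.\<close>
  have stable: "\<forall>t\<in>{0..T}. t \<le> real j * d \<longrightarrow> W (Suc j) t = W j t" for j
  proof (induction j)
    case 0
    show ?case using conv_0[OF delay_dom[OF adm[of 0]]] by (auto simp: W_Suc) (simp add: W_def)
  next
    case (Suc j)
    show ?case
    proof (intro ballI impI)
      fix t assume t: "t \<in> {0..T}" "t \<le> real (Suc j) * d"
      have "\<Phi> s (W (Suc j) (max 0 (s - d))) = \<Phi> s (W j (max 0 (s - d)))" if "s \<in> {0..t}" for s
      proof -
        have "max 0 (s - d) \<in> {0..T}" using that t d T by auto
        moreover have "max 0 (s - d) \<le> real j * d" using that t d by (simp add: algebra_simps)
        ultimately show ?thesis using Suc.IH by simp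
      qed
      from conv_cong[of t "\<lambda>s. \<Phi> s (W (Suc j) (max 0 (s - d)))" "\<lambda>s. \<Phi> s (W j (max 0 (s - d)))", OF this]
      show "W (Suc (Suc j)) t = W (Suc j) t" unfolding W_Suc[of "Suc j"] W_Suc[of j] by simp
    qed
  qed
  obtain J where J: "T < real J * d" using reals_Archimedean3[OF d] by blast
  have "W J t = G t \<zeta> + conv (\<lambda>s. \<Phi> s (W J (max 0 (s - d)))) t" if "t \<in> {0..T}" for t
    using stable[of J] that J by (simp add: W_Suc)
  then show ?thesis using adm[of J] by (intro exI[of _ "W J"] conjI ballI)
qed

theorem convolution_equation_solvable:
  assumes dom: "\<And>w. admissible r w \<Longrightarrow> dominated (\<lambda>s. \<Phi> s (w s))"
    and cont: "AE s in \<L>. continuous_on UNIV (\<Phi> s)"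
    and bound: "N * norm \<zeta> + N * integral\<^sup>L \<L> \<psi> \<le> r"
  shows "\<exists>w. admissible r w \<and> (\<forall>t\<in>{0..T}. w t = G t \<zeta> + conv (\<lambda>s. \<Phi> s (w s)) t)"
proof -
  have "\<forall>n. \<exists>w. admissible r w \<and> (\<forall>t\<in>{0..T}. w t = G t \<zeta> + conv (\<lambda>s. \<Phi> s (w (max 0 (s - 1 / real (Suc n))))) t)"
    by (intro allI delayed_equation[OF dom bound]) simp_all
  from choice[OF this] obtain w where w0: "\<forall>n. admissible r (w n) \<and>
    (\<forall>t\<in>{0..T}. w n t = G t \<zeta> + conv (\<lambda>s. \<Phi> s (w n (max 0 (s - 1 / real (Suc n))))) t)" ..
  define h where "h n s = \<Phi> s (w n (max 0 (s - 1 / real (Suc n))))" for n s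
  have adm: "admissible r (w n)" for n using w0 by blast
  have w: "w n t = G t \<zeta> + conv (h n) t" if "t \<in> {0..T}" for n t
    unfolding h_def using w0 that by blast
  have h: "dominated (h n)" for n
    unfolding h_def by (rule dom[OF admissible_delay[OF adm]]) simp
  have "\<exists>\<rho> v. strict_mono (\<rho> :: nat \<Rightarrow> nat) \<and> uniform_limit {0..T} (\<lambda>k. w (\<rho> k)) v sequentially"
  proof (rule Arzela_Ascoli_interval[OF T])
    fix e :: real assume "e > 0"
    then have e: "e / 2 > 0" by simp
    from conv_equicontinuous[OF e] obtain d where d: "d > 0"
      "\<forall>h. dominated h \<longrightarrow> (\<forall>t\<in>{0..T}. \<forall>t'\<in>{0..T}. \<bar>t - t'\<bar> < d \<longrightarrow> dist (conv h t) (conv h t') < e / 2)"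
      by (elim exE conjE)
    have "uniformly_continuous_on {0..T} (\<lambda>t. G t \<zeta>)"
      by (rule compact_uniformly_continuous[OF strong]) simp
    with e obtain d' where d': "d' > 0" "\<forall>t\<in>{0..T}. \<forall>t'\<in>{0..T}. dist t' t < d' \<longrightarrow> dist (G t' \<zeta>) (G t \<zeta>) < e / 2"
      unfolding uniformly_continuous_on_def by (elim allE[of _ "e / 2"] impE) (assumption, elim exE conjE)
    show "\<exists>d>0. \<forall>n. \<forall>t\<in>{0..T}. \<forall>t'\<in>{0..T}. \<bar>t - t'\<bar> < d \<longrightarrow> dist (w n t) (w n t') < e"
    proof (intro exI[of _ "min d d'"] conjI allI ballI impI)
      show "0 < min d d'" using d(1) d'(1) by simp
      fix n t t' assume t: "t \<in> {0..T}" "t' \<in> {0..T}" "\<bar>t - t'\<bar> < min d d'"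
      have 1: "dist (conv (h n) t) (conv (h n) t') < e / 2"
        using d(2)[rule_format, OF h t(1,2)] t(3) by simp
      have 2: "dist (G t \<zeta>) (G t' \<zeta>) < e / 2"
        using d'(2)[rule_format, OF t(2,1)] t(3) by (simp add: dist_real_def)
      show "dist (w n t) (w n t') < e"
        unfolding w[OF t(1)] w[OF t(2)] using dist_triangle_add[of "G t \<zeta>" "conv (h n) t" "G t' \<zeta>" "conv (h n) t'"] 1 2 by linarith
    qed
  next
    fix t assume t: "t \<in> {0..T}"
    have "precompact {G t \<zeta>}" by (auto simp: precompact_def intro!: exI[of _ "{G t \<zeta>}"])
    from precompact_sum[OF this precompact_conv[OF t]]
    show "precompact (range (\<lambda>n. w n t))"
    proof (rule precompact_subset)
      show "range (\<lambda>n. w n t) \<subseteq> {x + y |x y. x \<in> {G t \<zeta>} \<and> y \<in> {conv h t |h. dominated h}}"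
      proof (rule image_subsetI)
        fix n
        show "w n t \<in> {x + y |x y. x \<in> {G t \<zeta>} \<and> y \<in> {conv h t |h. dominated h}}"
          unfolding w[OF t] by (intro CollectI exI[of _ "G t \<zeta>"] exI[of _ "conv (h n) t"] exI[of _ "h n"] conjI refl h singletonI)
      qed
    qed
  qed
  then obtain \<rho> v where \<rho>: "strict_mono (\<rho> :: nat \<Rightarrow> nat)" and v: "uniform_limit {0..T} (\<lambda>k. w (\<rho> k)) v sequentially"
    by (elim exE conjE)
  have pt: "(\<lambda>k. w (\<rho> k) t) \<longlonglongrightarrow> v t" if "t \<in> {0..T}" for t
    by (rule tendsto_uniform_limitI[OF v that])
  have v_cont: "continuous_on {0..T} v"
    by (rule uniform_limit_theorem[OF _ v]) (use adm in \<open>auto simp: admissible_def\<close>)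
  have v_adm: "admissible r v"
    unfolding admissible_def
  proof (intro conjI ballI v_cont)
    fix t assume t: "t \<in> {0..T}"
    show "norm (v t) \<le> r"
      by (rule LIMSEQ_le_const2[OF tendsto_norm[OF pt[OF t]]]) (use adm t in \<open>auto simp: admissible_def\<close>)
  qed
  \<comment> \<open>Two limits at once: uniform convergence replaces the function at the delayed
    time by \<open>v\<close>, and continuity of \<open>v\<close> removes the delay.\<close>
  have delayed: "(\<lambda>k. w (\<rho> k) (max 0 (s - 1 / real (Suc (\<rho> k))))) \<longlonglongrightarrow> v s" if s: "s \<in> {0..T}" for s
  proof -
    define x where "x k = max 0 (s - 1 / real (Suc (\<rho> k)))" for k
    have x: "x k \<in> {0..T}" for k
    proof -
      have "0 \<le> 1 / real (Suc (\<rho> k))" by simp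
      moreover have "0 \<le> s" "s \<le> T" using s by simp_all
      ultimately show ?thesis unfolding x_def atLeastAtMost_iff by linarith
    qed
    have "(\<lambda>k. 1 / real (Suc (\<rho> k))) \<longlonglongrightarrow> 0"
      using LIMSEQ_subseq_LIMSEQ[OF LIMSEQ_Suc[OF lim_const_over_n[of 1]] \<rho>] by (simp add: o_def)
    from tendsto_max[OF tendsto_const[of 0] tendsto_diff[OF tendsto_const[of s] this]]
    have "x \<longlonglongrightarrow> s" unfolding x_def[abs_def] using s by simp
    from continuous_on_tendsto_compose[OF v_cont this s] x
    have vx: "(\<lambda>k. v (x k)) \<longlonglongrightarrow> v s" by simp
    have "(\<lambda>k. w (\<rho> k) (x k) - v (x k)) \<longlonglongrightarrow> 0"
    proof (rule tendstoI)
      fix e :: real assume "e > 0"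
      from uniform_limitD[OF v this]
      show "\<forall>\<^sub>F k in sequentially. dist (w (\<rho> k) (x k) - v (x k)) 0 < e"
        by eventually_elim (use x in \<open>simp add: dist_norm\<close>)
    qed
    from tendsto_add[OF this vx] show ?thesis by (simp add: x_def)
  qed
  have "v t = G t \<zeta> + conv (\<lambda>s. \<Phi> s (v s)) t" if t: "t \<in> {0..T}" for t
  proof -
    have "AE s in \<L>. (\<lambda>k. h (\<rho> k) s) \<longlonglongrightarrow> \<Phi> s (v s)"
      using cont AE_space
    proof eventually_elim
      case (elim s)
      then show ?case unfolding h_def
        by (intro continuous_on_tendsto_compose[OF elim(1) delayed]) simp_all
    qed
    from conv_tendsto[of "\<lambda>k. h (\<rho> k)", OF h dom[OF v_adm] this t]
    have "(\<lambda>k. G t \<zeta> + conv (h (\<rho> k)) t) \<longlonglongrightarrow> G t \<zeta> + conv (\<lambda>s. \<Phi> s (v s)) t"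
      by (rule tendsto_add[OF tendsto_const])
    then show ?thesis unfolding w[OF t, symmetric] by (rule LIMSEQ_unique[OF pt[OF t]])
  qed
  then show ?thesis using v_adm by (intro exI[of _ v] conjI ballI)
qed

end

text \<open>Cauchy-Schwarz against the constant 1, in the form that the variance of the norm is
  nonnegative.\<close>

lemma integral_norm_le_L2:
  assumes T: "T > 0" and u: "in_L2 T u"
  shows "integrable (lebesgue_on {0..T}) (\<lambda>t. norm (u t))"
    and "integral\<^sup>L (lebesgue_on {0..T}) (\<lambda>t. norm (u t)) \<le> T powr (1/2) * L2_norm_on T u"
proof -
  let ?M = "lebesgue_on {0..T}"
  interpret finite_measure ?M by (rule finite_measure_lebesgue_on)
  have sq: "integrable ?M (\<lambda>t. (norm (u t))\<^sup>2)" using u by (simp add: in_L2_def)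
  \<comment> \<open>Integrability of the square contains its measurability, and the norm is its
    square root.\<close>
  have "(\<lambda>t. sqrt ((norm (u t))\<^sup>2)) \<in> borel_measurable ?M"
    using borel_measurable_integrable[OF sq] by measurable
  then have meas: "(\<lambda>t. norm (u t)) \<in> borel_measurable ?M" by simp
  show int: "integrable ?M (\<lambda>t. norm (u t))"
  proof (rule Bochner_Integration.integrable_bound[where f = "\<lambda>t. 1 + (norm (u t))\<^sup>2"])
    show "integrable ?M (\<lambda>t. 1 + (norm (u t))\<^sup>2)" using sq by simp
    have "x \<le> 1 + x\<^sup>2" for x :: real
      using zero_le_power2[of "x - 1 / 2"] by (simp add: power2_eq_square algebra_simps)
    then show "AE t in ?M. norm (norm (u t)) \<le> norm (1 + (norm (u t))\<^sup>2)" by simp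
  qed (rule meas)
  define a where "a = integral\<^sup>L ?M (\<lambda>t. norm (u t))"
  define b where "b = integral\<^sup>L ?M (\<lambda>t. (norm (u t))\<^sup>2)"
  have "measure ?M (space ?M) = T" using T by (simp add: measure_restrict_space)
  then have one: "integral\<^sup>L ?M (\<lambda>t. c) = T * c" for c :: real by simp
  have "0 \<le> integral\<^sup>L ?M (\<lambda>t. (norm (u t) - a / T)\<^sup>2)"
    by (intro Bochner_Integration.integral_nonneg) simp
  also have "\<dots> = integral\<^sup>L ?M (\<lambda>t. (norm (u t))\<^sup>2 - 2 * (a / T) * norm (u t) + (a / T)\<^sup>2)"
    by (simp add: power2_eq_square algebra_simps)
  also have "\<dots> = b - 2 * (a / T) * a + T * (a / T)\<^sup>2"
    using sq int by (simp add: a_def[symmetric] b_def[symmetric] one del: lebesgue_integral_const)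
  also have "\<dots> = b - a\<^sup>2 / T" using T by (simp add: power2_eq_square field_simps)
  finally have "a\<^sup>2 \<le> T * b" using T by (simp add: field_simps)
  then have "a \<le> sqrt (T * b)" by (rule real_le_rsqrt)
  then show "a \<le> T powr (1/2) * L2_norm_on T u"
    using T by (simp add: L2_norm_on_def b_def real_sqrt_mult powr_half_sqrt)
qed

theorem theorem2p10:
  fixes K :: "complex set"
    and sW :: "complex \<Rightarrow> 'w \<Rightarrow> 'w::banach"
    and sU :: "complex \<Rightarrow> 'u \<Rightarrow> 'u::banach"
    and T \<alpha> \<beta> \<nu> N M r\<^sub>0 :: real
    and D :: "'w set" and A :: "'w \<Rightarrow> 'w"
    and G :: "real \<Rightarrow> 'w \<Rightarrow>\<^sub>L 'w"
    and B :: "'u \<Rightarrow>\<^sub>L 'w"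
    and \<zeta> :: 'w
    and f :: "real \<Rightarrow> 'w \<Rightarrow> 'w"
    and \<gamma> :: "real \<Rightarrow> real \<Rightarrow> real"
    and u :: "real \<Rightarrow> 'u"
  assumes field: "scalar_field K"
    and W: "normed_space_over K sW"
    and U: "normed_space_over K sU"
    and params: "T > 0" "\<alpha> > 0" "\<beta> \<ge> 0" "0 < \<nu>" "\<nu> < 1"
    and A_linear: "linear_operator_on K sW D A"
    and A_closed: "closed_operator D A"
    and A_dense: "densely_defined D"
    and A_sectorial: "sectorial K sW D A (\<nu> * pi / 2)"
    and A_compact: "compact_resolvent K sW D A"
    and G: "resolvent_family K sW D A \<alpha> \<beta> \<nu> G"
    and N: "\<forall>t\<in>{0..T}. norm (G t) \<le> N"
    and B: "homogeneous_over K sU sW B" "norm B = M"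
    and f_cont: "AE t in lebesgue_on {0..T}. continuous_on UNIV (f t)"
    and f_meas: "\<forall>w. strongly_measurable (lebesgue_on {0..T}) (\<lambda>t. f t w)"
    and \<gamma>: "\<forall>r>0. (\<forall>t\<in>{0..T}. \<gamma> r t > 0) \<and> integrable (lebesgue_on {0..T}) (\<gamma> r)"
    and f_bound: "\<forall>r>0. AE t in lebesgue_on {0..T}. \<forall>w. norm w \<le> r \<longrightarrow> norm (f t w) \<le> \<gamma> r t"
    and u: "in_L2 T u"
    and r0: "r\<^sub>0 > 0"
      "N * norm \<zeta> + N * M * T powr (1/2) * L2_norm_on T u + N * L1_norm_on T (\<gamma> r\<^sub>0) \<le> r\<^sub>0"
  shows "\<exists>w. mild_solution G B u f \<zeta> T w"
proof -
  let ?L = "lebesgue_on {0..T}"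
  \<comment> \<open>Dominates B u(s) + f(s, x) whenever the norm of x is at most
    \<open>r\<^sub>0\<close>. With Cauchy-Schwarz for u, the condition on \<open>r\<^sub>0\<close>
    bounds N times the norm of \<zeta> plus N times the integral of \<psi> by
    \<open>r\<^sub>0\<close>.\<close>
  define \<psi> where "\<psi> t = M * norm (u t) + \<gamma> r\<^sub>0 t" for t
  have M0: "M \<ge> 0" using B(2) norm_ge_zero[of B] by simp
  have N0: "N \<ge> 0" using order_trans[OF norm_ge_zero N[rule_format, of 0]] params(1) by simp
  have \<gamma>0: "\<gamma> r\<^sub>0 t \<ge> 0" if "t \<in> {0..T}" for t using \<gamma> r0(1) that by (intro less_imp_le) blast
  have \<gamma>i: "integrable ?L (\<gamma> r\<^sub>0)" using \<gamma> r0(1) by blast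
  note u' = integral_norm_le_L2[OF params(1) u]
  have "\<forall>x. continuous_on {0..} (\<lambda>t. G t x)" using G unfolding resolvent_family_def by (elim conjE)
  then have strong: "continuous_on {0..T} (\<lambda>t. G t x)" for x
    by (intro continuous_on_subset[of "{0..}" "\<lambda>t. G t x" "{0..T}"]) (erule spec, simp)
  note Gc = resolvent_family_compact_continuous[OF field W params A_linear A_closed A_dense A_sectorial A_compact G N]
  interpret compact_convolution G T N \<psi>
  proof
    show "integrable ?L \<psi>" unfolding \<psi>_def using u'(1) \<gamma>i by (intro Bochner_Integration.integrable_add integrable_mult_right) simp_all
    show "0 \<le> \<psi> t" if "t \<in> {0..T}" for t using M0 \<gamma>0[OF that] by (simp add: \<psi>_def)
    show "G t \<in> compact_ops" if "t \<in> {0<..T}" for t using Gc(2)[OF that] by (simp add: compact_ops_def)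
  qed (use params(1) N strong Gc(1) in simp_all)
  have "integral\<^sup>L ?L \<psi> = M * integral\<^sup>L ?L (\<lambda>t. norm (u t)) + integral\<^sup>L ?L (\<gamma> r\<^sub>0)"
    unfolding \<psi>_def using u'(1) \<gamma>i by (subst Bochner_Integration.integral_add) simp_all
  moreover have "integral\<^sup>L ?L (\<gamma> r\<^sub>0) = L1_norm_on T (\<gamma> r\<^sub>0)"
    unfolding L1_norm_on_def using \<gamma>0 by (intro Bochner_Integration.integral_cong) auto
  ultimately have "integral\<^sup>L ?L \<psi> \<le> M * (T powr (1/2) * L2_norm_on T u) + L1_norm_on T (\<gamma> r\<^sub>0)"
    using mult_left_mono[OF u'(2) M0] by simp
  from mult_left_mono[OF this N0] r0(2)
  have bound: "N * norm \<zeta> + N * integral\<^sup>L ?L \<psi> \<le> r\<^sub>0" by (simp add: algebra_simps)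
  have dom: "dominated (\<lambda>s. B (u s) + f s (w s))" if w: "admissible r\<^sub>0 w" for w
    unfolding dominated_def
  proof
    have "strongly_measurable ?L u" using u by (simp add: in_L2_def)
    then have "strongly_measurable ?L (\<lambda>s. B (u s))" by (rule strongly_measurable_linear) (rule blinfun.bounded_linear_right)
    moreover have "continuous_on {0..T} w" using w by (simp add: admissible_def)
    then have "strongly_measurable ?L (\<lambda>s. f s (w s))"
      by (rule strongly_measurable_Caratheodory[OF f_cont f_meas[THEN spec]])
    ultimately show "strongly_measurable ?L (\<lambda>s. B (u s) + f s (w s))" by (rule strongly_measurable_add)
    have "AE s in ?L. \<forall>w. norm w \<le> r\<^sub>0 \<longrightarrow> norm (f s w) \<le> \<gamma> r\<^sub>0 s" by (rule f_bound[rule_format, OF r0(1)])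
    then show "AE s in ?L. norm (B (u s) + f s (w s)) \<le> \<psi> s"
      using AE_space
    proof eventually_elim
      case (elim s)
      have "norm (f s (w s)) \<le> \<gamma> r\<^sub>0 s" using elim w by (simp add: admissible_def)
      moreover have "norm (B (u s)) \<le> M * norm (u s)" using norm_blinfun[of B "u s"] B(2) by simp
      ultimately show ?case using norm_triangle_ineq[of "B (u s)" "f s (w s)"] by (simp add: \<psi>_def)
    qed
  qed
  have Phi_cont: "AE s in ?L. continuous_on UNIV (\<lambda>x. B (u s) + f s x)"
    using f_cont by eventually_elim (intro continuous_on_add continuous_on_const)
  have "\<exists>w. admissible r\<^sub>0 w \<and> (\<forall>t\<in>{0..T}. w t = G t \<zeta> + conv (\<lambda>s. B (u s) + f s (w s)) t)"
    by (rule convolution_equation_solvable[OF _ Phi_cont bound]) (rule dom)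
  then obtain w where w: "admissible r\<^sub>0 w" "\<forall>t\<in>{0..T}. w t = G t \<zeta> + conv (\<lambda>s. B (u s) + f s (w s)) t"
    by (elim exE conjE)
  show ?thesis
    unfolding mild_solution_def
  proof (intro exI[of _ w] conjI ballI)
    show "continuous_on {0..T} w" using w(1) by (simp add: admissible_def)
    fix t assume t: "t \<in> {0..T}"
    have "{0..t} \<in> sets ?L" using t by (intro interval_sets) auto
    from strong_bochner_integral_restrict[OF this conv_integral[OF dom[OF w(1)] t]]
    have "has_strong_bochner_integral (lebesgue_on {0..t}) (\<lambda>s. G (t - s) (B (u s) + f s (w s))) (conv (\<lambda>s. B (u s) + f s (w s)) t)"
      using t by (simp add: restrict_restrict_space Int_absorb1)
    then show "\<exists>I. has_strong_bochner_integral (lebesgue_on {0..t}) (\<lambda>s. G (t - s) (B (u s) + f s (w s))) I \<and> w t = G t \<zeta> + I"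
      using w(2) t by (intro exI[of _ "conv (\<lambda>s. B (u s) + f s (w s)) t"]) simp
  qed
qed

end
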